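(* Let $\mathcal U,\mathcal Y$ be Hilbert spaces and let $S(z)\in\mathcal L(\mathcal U,\mathcal Y)\langle\langle z\rangle\rangle$ be a formal power series in noncommuting indeterminates $z=(z_1,\dots,z_d)$ with coefficients in $\mathcal L(\mathcal U,\mathcal Y)$. Then the following are equivalent: (1) $S\in\mathcal S_{nc,d}(\mathcal U,\mathcal Y)$, i.e. the map $M_S:\mathcal U\langle z\rangle\to\mathcal Y\langle\langle z\rangle\rangle$, $M_S:p(z)\mapsto S(z)p(z)$, extends to define a contraction operator from $H^2_{\mathcal U}(\mathcal F_d)$ into $H^2_{\mathcal Y}(\mathcal F_d)$. (2) The kernel $K_S(z,w):=k_{\rm Sz}(z,w)I_{\mathcal Y}-S(z)\,k_{\rm Sz}(z,w)\,S(w)^*$ is a noncommutative positive kernel. (3) There exist a Hilbert space $\mathcal X$ and a unitary operator $$\mathbf U=\begin{bmatrix} A & B \\ C & D \end{bmatrix}=\begin{bmatrix} A_1 & B_1 \\ \vdots & \vdots \\ A_d & B_d \\ C & D \end{bmatrix}:\begin{bmatrix}\mathcal X \\ \mathcal U\end{bmatrix}\to\begin{bmatrix}\mathcal X \\ \vdots \\ \mathcal X \\ \mathcal Y\end{bmatrix}$$ such that $$S(z)=D+\sum_{j=1}^d\sum_{v\in\mathcal F_d}C\mathbf A^vB_j\,z^vz_j=D+C(I-Z(z)A)^{-1}Z(z)B .$$ (4) There exist a Hilbert space $\mathcal X$ and a contractive block operator matrix $\mathbf U$ of the same block form $\mathcal X\oplus\mathcal U\to\mathcal X^d\oplus\mathcal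 Y$ such that $S(z)$ is given by the same formula $S(z)=D+C(I-Z(z)A)^{-1}Z(z)B$.
   Context: $\mathcal L(\mathcal U,\mathcal Y)$ denotes the bounded linear operators between Hilbert spaces. $d\ge1$ is a fixed integer and $\mathcal F_d$ is the free semigroup with unit generated by the letters $\{1,\dots,d\}$: words $\alpha=i_N\cdots i_1$, product given by concatenation, unit the empty word $\emptyset$; the transpose is $\alpha^\top=i_1\cdots i_N$. For indeterminates, $z^\alpha=z_{i_N}\cdots z_{i_1}$, $z^\emptyset=1$; for an operator tuple $\mathbf A=(A_1,\dots,A_d)$ on $\mathcal X$, $\mathbf A^\alpha=A_{i_N}\cdots A_{i_1}$, $\mathbf A^\emptyset=I$. $z=(z_1,\dots,z_d)$ and $w=(w_1,\dots,w_d)$ are two sets of indeterminates, noncommuting within each set; each $z_i$ commutes with each $w_j$, and indeterminates commute with operator coefficients. $\mathcal Y\langle z\rangle$ and $\mathcal Y\langle\langle z\rangle\rangle$ denote polynomials, respectively formal power series, with coefficients in $\mathcal Y$ (similarly with $\mathcal L(\mathcal U,\mathcal Y)$ in place of $\mathcal Y$). Products are given by convolution: $\big(\sum_\alpha s_\alpha z^\alpha\big)\big(\sum_\beta f_\beta z^\beta\big)=\sum_v\big(\sum_{\alpha\beta=v}s_\alpha f_\beta\big)z^v$. If $S(z)=\sum_\alpha s_\alpha z^\alpha$ then $S(w)^*=\sum_\alpha s_\alpha^*w^{\alpha^\top}$. The Fock space is $H^2_{\mathcal Y}(\mathcal F_d)=\{f=\sum_\alpha f_\alpha z^\alpha:\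 f_\alpha\in\mathcal Y,\ \|f\|^2=\sum_\alpha\|f_\alpha\|^2<\infty\}$. The noncommutative Szegő kernel is $k_{\rm Sz}(z,w)=\sum_{\alpha\in\mathcal F_d}z^\alpha w^{\alpha^\top}$. A formal kernel $K(z,w)=\sum_{\alpha,\beta}K_{\alpha,\beta}z^\alpha w^{\beta^\top}$ with $K_{\alpha,\beta}\in\mathcal L(\mathcal Y)$ is a (noncommutative) positive kernel if either of the following equivalent conditions holds: $K(z,w)=H(z)H(w)^*$ for some Hilbert space $\mathcal X$ and some $H\in\mathcal L(\mathcal X,\mathcal Y)\langle\langle z\rangle\rangle$; or $\sum_{\alpha,\alpha'}\langle K_{\alpha,\alpha'}y_{\alpha'},y_\alpha\rangle\ge0$ for all finitely supported functions $\alpha\mapsto y_\alpha\in\mathcal Y$. Here $Z(z)=\begin{bmatrix}z_1I_{\mathcal X}&\cdots&z_dI_{\mathcal X}\end{bmatrix}$, $A$ is the column of $A_1,\dots,A_d$, $B$ is the column of $B_1,\dots,B_d$, and $(I-Z(z)A)^{-1}=\sum_v\mathbf A^vz^v$. *)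

theory Defs
  imports "HOL-Analysis.Analysis" "HOL-Library.Function_Algebras"
begin

section \<open>Complex Hilbert spaces\<close>

text \<open>
  A Hilbert space is a subset of an ambient additive group together with a complex scalar
  multiplication and an inner product (linear in the first argument) on that subset.  Nothing is
  required of the scalar multiplication and of the inner product outside the carrier.  Carriers
  are sets, rather than types of a type class, so that one can quantify existentially over Hilbert
  spaces.
\<close>

record 'a hilb =
  hcarrier :: "'a set"
  hscale :: "complex \<Rightarrow> 'a \<Rightarrow> 'a"
  hinner :: "'a \<Rightarrow> 'a \<Rightarrow> complex"

definition hnorm :: "('a, 'm) hilb_scheme \<Rightarrow> 'a \<Rightarrow> real" where
  "hnorm H x = sqrt (Re (hinner H x x))"

locale hilbert_space =
  fixes H :: "'a::ab_group_add hilb"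
  assumes zero_mem: "0 \<in> hcarrier H"
    and add_mem: "\<lbrakk>x \<in> hcarrier H; y \<in> hcarrier H\<rbrakk> \<Longrightarrow> x + y \<in> hcarrier H"
    and scale_mem: "x \<in> hcarrier H \<Longrightarrow> hscale H c x \<in> hcarrier H"
    and scale_add_right: "\<lbrakk>x \<in> hcarrier H; y \<in> hcarrier H\<rbrakk> \<Longrightarrow>
          hscale H c (x + y) = hscale H c x + hscale H c y"
    and scale_add_left: "x \<in> hcarrier H \<Longrightarrow>
          hscale H (b + c) x = hscale H b x + hscale H c x"
    and scale_scale: "x \<in> hcarrier H \<Longrightarrow> hscale H b (hscale H c x) = hscale H (b * c) x"
    and scale_one: "x \<in> hcarrier H \<Longrightarrow> hscale H 1 x = x"
    and inner_commute: "\<lbrakk>x \<in> hcarrier H; y \<in> hcarrier H\<rbrakk> \<Longrightarrow>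
          hinner H y x = cnj (hinner H x y)"
    and inner_add_left: "\<lbrakk>x \<in> hcarrier H; y \<in> hcarrier H; z \<in> hcarrier H\<rbrakk> \<Longrightarrow>
          hinner H (x + y) z = hinner H x z + hinner H y z"
    and inner_scale_left: "\<lbrakk>x \<in> hcarrier H; y \<in> hcarrier H\<rbrakk> \<Longrightarrow>
          hinner H (hscale H c x) y = c * hinner H x y"
    and inner_nonneg: "x \<in> hcarrier H \<Longrightarrow> hinner H x x \<in> \<real>\<^sub>\<ge>\<^sub>0"
    and inner_eq_zero: "\<lbrakk>x \<in> hcarrier H; hinner H x x = 0\<rbrakk> \<Longrightarrow> x = 0"
    and complete: "\<lbrakk>\<And>n::nat. s n \<in> hcarrier H;
          \<And>e. e > 0 \<Longrightarrow> \<exists>N. \<forall>m\<ge>N. \<forall>n\<ge>N. hnorm H (s m - s n) < e\<rbrakk> \<Longrightarrow>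
          \<exists>l\<in>hcarrier H. (\<lambda>n. hnorm H (s n - l)) \<longlonglongrightarrow> 0"

text \<open>
  Operators are functions on the ambient types; only their values on the carrier of the domain
  are meaningful.
\<close>

definition linear_op :: "'a::ab_group_add hilb \<Rightarrow> 'b::ab_group_add hilb \<Rightarrow> ('a \<Rightarrow> 'b) \<Rightarrow> bool" where
  "linear_op H K T \<longleftrightarrow>
     (\<forall>x\<in>hcarrier H. T x \<in> hcarrier K) \<and>
     (\<forall>x\<in>hcarrier H. \<forall>y\<in>hcarrier H. T (x + y) = T x + T y) \<and>
     (\<forall>c. \<forall>x\<in>hcarrier H. T (hscale H c x) = hscale K c (T x))"

definition bounded_op :: "'a::ab_group_add hilb \<Rightarrow> 'b::ab_group_add hilb \<Rightarrow> ('a \<Rightarrow> 'b) \<Rightarrow> bool" where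
  "bounded_op H K T \<longleftrightarrow>
     linear_op H K T \<and> (\<exists>M. \<forall>x\<in>hcarrier H. hnorm K (T x) \<le> M * hnorm H x)"

definition contraction_op :: "'a::ab_group_add hilb \<Rightarrow> 'b::ab_group_add hilb \<Rightarrow> ('a \<Rightarrow> 'b) \<Rightarrow> bool" where
  "contraction_op H K T \<longleftrightarrow>
     linear_op H K T \<and> (\<forall>x\<in>hcarrier H. hnorm K (T x) \<le> hnorm H x)"

definition unitary_op :: "'a::ab_group_add hilb \<Rightarrow> 'b::ab_group_add hilb \<Rightarrow> ('a \<Rightarrow> 'b) \<Rightarrow> bool" where
  "unitary_op H K T \<longleftrightarrow>
     linear_op H K T \<and>
     (\<forall>x\<in>hcarrier H. \<forall>y\<in>hcarrier H. hinner K (T x) (T y) = hinner H x y) \<and>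
     T ` hcarrier H = hcarrier K"

text \<open>
  The Hilbert space adjoint.  By the Riesz theorem the description is well defined whenever
  \<^term>\<open>T\<close> is a bounded operator and \<^term>\<open>y\<close> lies in the carrier of \<^term>\<open>K\<close>.
\<close>

definition adjoint_op :: "'a::ab_group_add hilb \<Rightarrow> 'b::ab_group_add hilb \<Rightarrow> ('a \<Rightarrow> 'b) \<Rightarrow> 'b \<Rightarrow> 'a" where
  "adjoint_op H K T y =
     (THE x'. x' \<in> hcarrier H \<and> (\<forall>x\<in>hcarrier H. hinner K (T x) y = hinner H x x'))"

definition hsum :: "'a::ab_group_add hilb \<Rightarrow> 'b::ab_group_add hilb \<Rightarrow> ('a \<times> 'b) hilb"
    (infixr \<open>\<oplus>\<^sub>H\<close> 65) where
  "H \<oplus>\<^sub>H K =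
     \<lparr> hcarrier = hcarrier H \<times> hcarrier K,
       hscale = (\<lambda>c (x, y). (hscale H c x, hscale K c y)),
       hinner = (\<lambda>(x, y) (x', y'). hinner H x x' + hinner K y y') \<rparr>"

text \<open>The direct sum of copies of \<^term>\<open>H\<close> indexed by the elements of \<^typ>\<open>'d\<close>.\<close>

definition hpow :: "'a::ab_group_add hilb \<Rightarrow> ('d::finite \<Rightarrow> 'a) hilb" where
  "hpow H =
     \<lparr> hcarrier = {f. \<forall>j. f j \<in> hcarrier H},
       hscale = (\<lambda>c f j. hscale H c (f j)),
       hinner = (\<lambda>f g. \<Sum>j\<in>UNIV. hinner H (f j) (g j)) \<rparr>"


section \<open>Formal power series and kernels\<close>

text \<open>
  The letters are the elements of a finite type \<^typ>\<open>'d\<close> (so the number \<open>d\<close> of letters is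
  \<open>CARD('d)\<close>, which is at least 1), and the word \<open>i\<^sub>N \<dots> i\<^sub>1\<close> is the list
  \<open>[i\<^sub>N, \<dots>, i\<^sub>1]\<close>.  Concatenation is \<open>@\<close>, the empty word is \<open>[]\<close>, and transposition is \<^const>\<open>rev\<close>.
  A formal power series in \<open>z\<close> is the function mapping each word to its coefficient.
\<close>

type_synonym ('d, 'c) series = "'d list \<Rightarrow> 'c"

definition op_series :: "'u::ab_group_add hilb \<Rightarrow> 'y::ab_group_add hilb \<Rightarrow>
    ('d, 'u \<Rightarrow> 'y) series \<Rightarrow> bool" where
  "op_series U Y S \<longleftrightarrow> (\<forall>\<alpha>. bounded_op U Y (S \<alpha>))"

text \<open>The product of an operator-valued and a vector-valued series.\<close>

definition series_app :: "('d, 'u \<Rightarrow> 'y::ab_group_add) series \<Rightarrow> ('d, 'u) series \<Rightarrow> ('d, 'y) series" where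
  "series_app S f v = (\<Sum>(\<alpha>, \<beta>) | \<alpha> @ \<beta> = v. S \<alpha> (f \<beta>))"

definition polys :: "'u::ab_group_add hilb \<Rightarrow> ('d, 'u) series set" where
  "polys U = {p. (\<forall>\<alpha>. p \<alpha> \<in> hcarrier U) \<and> finite {\<alpha>. p \<alpha> \<noteq> 0}}"

definition fock :: "'u::ab_group_add hilb \<Rightarrow> ('d list \<Rightarrow> 'u) hilb" where
  "fock U =
     \<lparr> hcarrier = {f. (\<forall>\<alpha>. f \<alpha> \<in> hcarrier U) \<and> (\<lambda>\<alpha>. (hnorm U (f \<alpha>))\<^sup>2) summable_on UNIV},
       hscale = (\<lambda>c f \<alpha>. hscale U c (f \<alpha>)),
       hinner = (\<lambda>f g. \<Sum>\<^sub>\<infinity>\<alpha>. hinner U (f \<alpha>) (g \<alpha>)) \<rparr>"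

definition schur_class :: "'u::ab_group_add hilb \<Rightarrow> 'y::ab_group_add hilb \<Rightarrow>
    ('d::finite, 'u \<Rightarrow> 'y) series set" where
  "schur_class U Y = {S. op_series U Y S \<and>
     (\<exists>M. contraction_op (fock U) (fock Y) M \<and> (\<forall>p\<in>polys U. M p = series_app S p))}"

text \<open>
  A formal power series \<open>F\<close> in two sets \<open>z\<close>, \<open>w\<close> of indeterminates with operator coefficients:
  \<open>F \<alpha> \<beta>\<close> is the coefficient of \<open>z\<^sup>\<alpha> w\<^sup>\<beta>\<close>.  Since every \<open>z\<^sub>i\<close> commutes with every \<open>w\<^sub>j\<close>, the monomials
  multiply as \<open>(z\<^sup>\<alpha> w\<^sup>\<beta>) (z\<^sup>\<alpha>\<^sup>' w\<^sup>\<beta>\<^sup>') = z\<^sup>\<alpha>\<^sup>\<alpha>\<^sup>' w\<^sup>\<beta>\<^sup>\<beta>\<^sup>'\<close>.  Sums, differences and 0 of operators and of series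
  are those of \<^theory>\<open>HOL-Library.Function_Algebras\<close>, that is, pointwise.
\<close>

type_synonym ('d, 'c) series2 = "'d list \<Rightarrow> 'd list \<Rightarrow> 'c"

definition series2_mult :: "('d, 'b \<Rightarrow> 'c::ab_group_add) series2 \<Rightarrow> ('d, 'a \<Rightarrow> 'b) series2 \<Rightarrow>
    ('d, 'a \<Rightarrow> 'c) series2"  (infixl \<open>\<star>\<close> 70) where
  "(F \<star> G) v u =
     (\<Sum>(\<alpha>, \<alpha>') | \<alpha> @ \<alpha>' = v. \<Sum>(\<beta>, \<beta>') | \<beta> @ \<beta>' = u. F \<alpha> \<beta> \<circ> G \<alpha>' \<beta>')"

definition series_z :: "('d, 'u \<Rightarrow> 'y::ab_group_add) series \<Rightarrow> ('d, 'u \<Rightarrow> 'y) series2" where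
  "series_z S = (\<lambda>\<alpha> \<beta>. if \<beta> = [] then S \<alpha> else 0)"

text \<open>The series \<open>S(w)\<^sup>* = (\<Sum>\<alpha>. S\<^sub>\<alpha>\<^sup>* w\<^sup>\<alpha>\<^sup>\<top>)\<close>; its coefficient at \<open>w\<^sup>\<beta>\<close> is \<open>(S (rev \<beta>))\<^sup>*\<close>.\<close>

definition series_w_adj :: "'u::ab_group_add hilb \<Rightarrow> 'y::ab_group_add hilb \<Rightarrow>
    ('d, 'u \<Rightarrow> 'y) series \<Rightarrow> ('d, 'y \<Rightarrow> 'u) series2" where
  "series_w_adj U Y S = (\<lambda>\<alpha> \<beta>. if \<alpha> = [] then adjoint_op U Y (S (rev \<beta>)) else 0)"

text \<open>The kernel \<open>k\<^sub>S\<^sub>z(z,w) I = (\<Sum>\<alpha>. z\<^sup>\<alpha> w\<^sup>\<alpha>\<^sup>\<top>) I\<close>.\<close>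

definition szego :: "('d, 'a::ab_group_add \<Rightarrow> 'a) series2" where
  "szego = (\<lambda>\<alpha> \<beta>. if \<beta> = rev \<alpha> then id else 0)"

definition kernel_S :: "'u::ab_group_add hilb \<Rightarrow> 'y::ab_group_add hilb \<Rightarrow>
    ('d, 'u \<Rightarrow> 'y) series \<Rightarrow> ('d, 'y \<Rightarrow> 'y) series2" where
  "kernel_S U Y S = szego - series_z S \<star> szego \<star> series_w_adj U Y S"

text \<open>
  A kernel is indexed as \<open>K(z,w) = (\<Sum>\<alpha> \<beta>. K\<^sub>\<alpha>\<^sub>,\<^sub>\<beta> z\<^sup>\<alpha> w\<^sup>\<beta>\<^sup>\<top>)\<close>, so the operator \<open>K\<^sub>\<alpha>\<^sub>,\<^sub>\<beta>\<close> is the coefficient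
  \<open>K \<alpha> (rev \<beta>)\<close>.
\<close>

definition positive_kernel :: "'y::ab_group_add hilb \<Rightarrow> ('d, 'y \<Rightarrow> 'y) series2 \<Rightarrow> bool" where
  "positive_kernel Y K \<longleftrightarrow>
     (\<forall>\<alpha> \<beta>. bounded_op Y Y (K \<alpha> (rev \<beta>))) \<and>
     (\<forall>y. (\<forall>\<alpha>. y \<alpha> \<in> hcarrier Y) \<and> finite {\<alpha>. y \<alpha> \<noteq> 0} \<longrightarrow>
       (\<Sum>\<alpha> | y \<alpha> \<noteq> 0. \<Sum>\<alpha>' | y \<alpha>' \<noteq> 0. hinner Y (K \<alpha> (rev \<alpha>') (y \<alpha>')) (y \<alpha>)) \<in> \<real>\<^sub>\<ge>\<^sub>0)"


section \<open>Realizations\<close>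

text \<open>
  The block operator matrix with rows \<open>A\<^sub>j B\<^sub>j\<close>, for each letter \<open>j\<close>, and last row \<open>C D\<close>.
\<close>

definition block_op :: "('d \<Rightarrow> 'x \<Rightarrow> 'x::ab_group_add) \<Rightarrow> ('d \<Rightarrow> 'u \<Rightarrow> 'x) \<Rightarrow> ('x \<Rightarrow> 'y::ab_group_add) \<Rightarrow>
    ('u \<Rightarrow> 'y) \<Rightarrow> 'x \<times> 'u \<Rightarrow> ('d \<Rightarrow> 'x) \<times> 'y" where
  "block_op A B C D = (\<lambda>(x, u). (\<lambda>j. A j x + B j u, C x + D u))"

definition bounded_blocks :: "'x::ab_group_add hilb \<Rightarrow> 'u::ab_group_add hilb \<Rightarrow> 'y::ab_group_add hilb \<Rightarrow>
    ('d \<Rightarrow> 'x \<Rightarrow> 'x) \<Rightarrow> ('d \<Rightarrow> 'u \<Rightarrow> 'x) \<Rightarrow> ('x \<Rightarrow> 'y) \<Rightarrow> ('u \<Rightarrow> 'y) \<Rightarrow> bool" where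
  "bounded_blocks X U Y A B C D \<longleftrightarrow>
     (\<forall>j. bounded_op X X (A j)) \<and> (\<forall>j. bounded_op U X (B j)) \<and>
     bounded_op X Y C \<and> bounded_op U Y D"

text \<open>
  The series \<open>D + (\<Sum>j v. C A\<^sup>v B\<^sub>j z\<^sup>v z\<^sub>j)\<close>.  For the word \<open>v = [i\<^sub>N, \<dots>, i\<^sub>1]\<close> the operator
  \<open>A\<^sup>v = A i\<^sub>N \<circ> \<dots> \<circ> A i\<^sub>1\<close> is \<^term>\<open>foldr A v\<close>.
\<close>

definition transfer :: "('d \<Rightarrow> 'x \<Rightarrow> 'x) \<Rightarrow> ('d \<Rightarrow> 'u \<Rightarrow> 'x) \<Rightarrow> ('x \<Rightarrow> 'y::ab_group_add) \<Rightarrow>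
    ('u \<Rightarrow> 'y) \<Rightarrow> ('d, 'u \<Rightarrow> 'y) series" where
  "transfer A B C D \<alpha> =
     (if \<alpha> = [] then D else 0) + (\<Sum>(j, v) | v @ [j] = \<alpha>. C \<circ> foldr A v \<circ> B j)"

text \<open>
  The same series is \<open>D + C (I - Z(z) A)\<^sup>-\<^sup>1 Z(z) B\<close>, where \<open>(I - Z(z) A)\<^sup>-\<^sup>1 = (\<Sum>v. A\<^sup>v z\<^sup>v)\<close> and
  \<open>Z(z) B = (\<Sum>j. B\<^sub>j z\<^sub>j)\<close>.
\<close>

definition series_mult :: "('d, 'b \<Rightarrow> 'c::ab_group_add) series \<Rightarrow> ('d, 'a \<Rightarrow> 'b) series \<Rightarrow>
    ('d, 'a \<Rightarrow> 'c) series" where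
  "series_mult S T v = (\<Sum>(\<alpha>, \<beta>) | \<alpha> @ \<beta> = v. S \<alpha> \<circ> T \<beta>)"

definition const_series :: "('a \<Rightarrow> 'b::ab_group_add) \<Rightarrow> ('d, 'a \<Rightarrow> 'b) series" where
  "const_series T \<alpha> = (if \<alpha> = [] then T else 0)"

definition letter_series :: "('d \<Rightarrow> 'a \<Rightarrow> 'b::ab_group_add) \<Rightarrow> ('d, 'a \<Rightarrow> 'b) series" where
  "letter_series B \<alpha> = (case \<alpha> of [j] \<Rightarrow> B j | _ \<Rightarrow> 0)"

lemma finite_splits: "finite {(\<alpha>, \<beta>). \<alpha> @ \<beta> = v}"
proof (rule finite_subset)
  show "{(\<alpha>, \<beta>). \<alpha> @ \<beta> = v} \<subseteq> (\<lambda>n. (take n v, drop n v)) ` {..length v}"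
  proof clarify
    fix \<alpha> \<beta> :: "'a list"
    assume "v = \<alpha> @ \<beta>"
    then show "(\<alpha>, \<beta>) \<in> (\<lambda>n. (take n (\<alpha> @ \<beta>), drop n (\<alpha> @ \<beta>))) ` {..length (\<alpha> @ \<beta>)}"
      by (intro image_eqI[where x = "length \<alpha>"]) auto
  qed
qed simp

lemma transfer_eq_resolvent:
  fixes A :: "'d \<Rightarrow> 'x \<Rightarrow> 'x::ab_group_add" and C :: "'x \<Rightarrow> 'y::ab_group_add"
  assumes "\<And>j. A j 0 = 0" and "C 0 = 0"
  shows "transfer A B C D =
    const_series D + series_mult (const_series C) (series_mult (foldr A) (letter_series B))"
proof
  fix \<alpha> :: "'d list"
  have A0: "foldr A v 0 = 0" for v
    by (induction v) (simp_all add: assms)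
  have L0: "foldr A v \<circ> letter_series B w = 0" if "\<And>j. w \<noteq> [j]" for v w
    using that by (auto simp: letter_series_def fun_eq_iff A0 split: list.splits)
  have C0: "C \<circ> 0 = (0 :: 'a \<Rightarrow> 'y)"
    by (simp add: fun_eq_iff assms)
  have outer: "series_mult (const_series C) F v = C \<circ> F v" for F :: "('d, 'a \<Rightarrow> 'x) series" and v
  proof -
    have "series_mult (const_series C) F v = (\<Sum>(\<alpha>, \<beta>)\<in>{([] :: 'd list, v)}. const_series C \<alpha> \<circ> F \<beta>)"
      unfolding series_mult_def
      by (rule sum.mono_neutral_right[OF finite_splits])
         (auto simp: const_series_def fun_eq_iff split: if_splits)
    then show ?thesis by (simp add: const_series_def)
  qed
  show "transfer A B C D \<alpha> =
    (const_series D + series_mult (const_series C) (series_mult (foldr A) (letter_series B))) \<alpha>"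
  proof (cases \<alpha> rule: rev_cases)
    case Nil
    have "series_mult (foldr A) (letter_series B) [] = 0"
      unfolding series_mult_def by (rule sum.neutral) (auto simp: letter_series_def)
    then show ?thesis using Nil
      by (simp add: transfer_def outer const_series_def C0)
  next
    case (snoc w i)
    have "series_mult (foldr A) (letter_series B) \<alpha> =
        (\<Sum>(v, \<beta>)\<in>{(w, [i])}. foldr A v \<circ> letter_series B \<beta>)"
      unfolding series_mult_def
      by (rule sum.mono_neutral_right[OF finite_splits]) (use snoc in \<open>auto intro!: L0\<close>)
    also have "\<dots> = foldr A w \<circ> B i"
      by (simp add: letter_series_def)
    finally have 1: "series_mult (foldr A) (letter_series B) \<alpha> = foldr A w \<circ> B i" .
    have "{(j, v). v @ [j] = \<alpha>} = {(i, w)}"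
      using snoc by auto
    then have "transfer A B C D \<alpha> = C \<circ> foldr A w \<circ> B i"
      using snoc by (simp add: transfer_def)
    then show ?thesis
      using snoc 1 by (simp add: outer const_series_def comp_assoc)
  qed
qed

text \<open>Equality of operator series is equality on the carrier of the domain.\<close>

definition series_eq_on :: "'u hilb \<Rightarrow> ('d, 'u \<Rightarrow> 'y) series \<Rightarrow> ('d, 'u \<Rightarrow> 'y) series \<Rightarrow> bool" where
  "series_eq_on U S T \<longleftrightarrow> (\<forall>\<alpha>. \<forall>u\<in>hcarrier U. S \<alpha> u = T \<alpha> u)"

definition unitary_realization :: "'x::ab_group_add hilb \<Rightarrow> 'u::ab_group_add hilb \<Rightarrow>
    'y::ab_group_add hilb \<Rightarrow> ('d::finite, 'u \<Rightarrow> 'y) series \<Rightarrow> bool" where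
  "unitary_realization X U Y S \<longleftrightarrow>
     (\<exists>A B C D. bounded_blocks X U Y A B C D \<and>
        unitary_op (X \<oplus>\<^sub>H U) (hpow X \<oplus>\<^sub>H Y) (block_op A B C D) \<and>
        series_eq_on U S (transfer A B C D))"

definition contractive_realization :: "'x::ab_group_add hilb \<Rightarrow> 'u::ab_group_add hilb \<Rightarrow>
    'y::ab_group_add hilb \<Rightarrow> ('d::finite, 'u \<Rightarrow> 'y) series \<Rightarrow> bool" where
  "contractive_realization X U Y S \<longleftrightarrow>
     (\<exists>A B C D. bounded_blocks X U Y A B C D \<and>
        contraction_op (X \<oplus>\<^sub>H U) (hpow X \<oplus>\<^sub>H Y) (block_op A B C D) \<and>
        series_eq_on U S (transfer A B C D))"

text \<open>
  HOL cannot quantify existentially over types, so state spaces range over all Hilbert spaces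
  whose carrier is a subset of the following type.  Its first factor \<^typ>\<open>'x\<close> is an
  arbitrary additive group, so any given Hilbert space is among them for a suitable \<^typ>\<open>'x\<close>.  The
  second factor guarantees, for every choice of \<^typ>\<open>'x\<close>, room for a Hilbert sum of countably many
  copies of \<open>\<U> \<oplus> \<Y>\<close>.
\<close>

type_synonym ('x, 'u, 'y) state = "'x \<times> (nat \<Rightarrow> 'u \<times> 'y)"

end

theory Submission
  imports Defs
begin

text \<open>
  Write \<open>M\<^sub>S\<close> for multiplication by \<open>S\<close> and \<open>R\<^sub>j\<close> for right multiplication by \<open>z\<^sub>j\<close> on the Fock spaces.

  Membership in the Schur class and positivity of the kernel are the same statement, because \<open>K\<^sub>S\<close> is the matrix of
  \<open>I - M\<^sub>S M\<^sub>S\<^sup>*\<close> with respect to monomials: its quadratic form at a polynomial \<open>y\<close> is \<open>\<parallel>y\<parallel>\<^sup>2 - \<parallel>M\<^sub>S\<^sup>* y\<parallel>\<^sup>2\<close>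
  (\<open>kernel_form_eq\<close>), where the formal adjoint \<open>M\<^sub>S\<^sup>*\<close> maps polynomials to polynomials whatever \<open>S\<close> is.  If \<open>M\<^sub>S\<^sup>*\<close> does not
  increase norms, the Riesz theorem puts \<open>S f\<close> into the Fock space for each \<open>f\<close> in the Fock space, with norm at most \<open>\<parallel>f\<parallel>\<close>
  (\<open>series_app_contraction_if_adjoint_bound\<close>).

  A contractive realization is a dissipative linear system on the tree of words with input-output map \<open>M\<^sub>S\<close>; adding up
  the energy inequality over all words shows that \<open>M\<^sub>S\<close> is contractive (\<open>schur_class_if_contractive_realization\<close>).
  Unitary realizations are contractive.

  It remains to construct a unitary realization of a contractive multiplier.  A sequence-valued operator \<open>\<Delta>\<close> with
  \<open>\<Delta>\<^sup>*\<Delta> = I - M\<^sub>S M\<^sub>S\<^sup>*\<close> is found by a telescoping series (\<open>defect_operator\<close>).  As \<open>M\<^sub>S\<^sup>*\<close> commutes with \<open>R\<^sub>j\<^sup>*\<close>, the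
  vectors \<open>((\<Delta> R\<^sub>j\<^sup>* f)\<^sub>j, f\<^sub>\<emptyset>)\<close> and \<open>(\<Delta> f, (M\<^sub>S\<^sup>* f)\<^sub>\<emptyset>)\<close> have the same Gramian, which yields a coisometric operator matrix
  with transfer function \<open>S\<close> (\<open>coisometry_from_equal_gramians\<close>, \<open>operator_realization_if_contraction\<close>).  Its kernel \<open>N\<close> is
  absorbed by adjoining \<open>l2(\<nat>, N)\<close> to the state space, which gives a unitary matrix with the same transfer function
  (\<open>unitary_from_coisometry\<close>).  All spaces involved consist of sequences over \<open>\<U> \<oplus> \<Y>\<close> up to reindexing, so the state
  space can finally be moved into the prescribed type (\<open>unitary_realization_htransport\<close>).
\<close>

section \<open>Hilbert space geometry\<close>

context hilbert_space
begin

lemma scale_zero_left: "x \<in> hcarrier H \<Longrightarrow> hscale H 0 x = 0"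
  using scale_add_left[of x 0 0] by simp

lemma scale_minus_one: "x \<in> hcarrier H \<Longrightarrow> hscale H (-1) x = - x"
  using scale_add_left[of x "-1" 1] scale_zero_left[of x] scale_one[of x]
  by (simp add: eq_neg_iff_add_eq_0)

lemma minus_mem: "x \<in> hcarrier H \<Longrightarrow> - x \<in> hcarrier H"
  using scale_minus_one[of x] scale_mem[of x "-1"] by simp

lemma diff_mem: "\<lbrakk>x \<in> hcarrier H; y \<in> hcarrier H\<rbrakk> \<Longrightarrow> x - y \<in> hcarrier H"
  using add_mem[of x "- y"] minus_mem[of y] by simp

lemma sum_mem: "(\<And>i. i \<in> I \<Longrightarrow> f i \<in> hcarrier H) \<Longrightarrow> sum f I \<in> hcarrier H"
  by (induction I rule: infinite_finite_induct) (auto intro: zero_mem add_mem)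

lemma scale_zero_right: "hscale H c 0 = 0"
  using scale_add_right[of 0 0 c] zero_mem by simp

lemma scale_diff_right:
  assumes "x \<in> hcarrier H" "y \<in> hcarrier H"
  shows "hscale H c (x - y) = hscale H c x - hscale H c y"
  using scale_add_right[of "x - y" y c] diff_mem[OF assms] assms by (simp add: eq_diff_eq)

lemma inner_add_right:
  assumes "x \<in> hcarrier H" "y \<in> hcarrier H" "z \<in> hcarrier H"
  shows "hinner H x (y + z) = hinner H x y + hinner H x z"
  using inner_commute[of "y + z" x] inner_add_left[of y z x] inner_commute[of y x]
    inner_commute[of z x] assms add_mem[of y z] by simp

lemma inner_scale_right:
  assumes "x \<in> hcarrier H" "y \<in> hcarrier H"
  shows "hinner H x (hscale H c y) = cnj c * hinner H x y"
  using inner_commute[of "hscale H c y" x] inner_scale_left[of y x c] inner_commute[of y x]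
    assms scale_mem[of y c] by simp

lemma inner_zero_left: "x \<in> hcarrier H \<Longrightarrow> hinner H 0 x = 0"
  using inner_add_left[of 0 0 x] zero_mem by simp

lemma inner_zero_right: "x \<in> hcarrier H \<Longrightarrow> hinner H x 0 = 0"
  using inner_add_right[of x 0 0] zero_mem by simp

lemma inner_minus_left:
  "\<lbrakk>x \<in> hcarrier H; y \<in> hcarrier H\<rbrakk> \<Longrightarrow> hinner H (- x) y = - hinner H x y"
  using inner_scale_left[of x y "-1"] by (simp add: scale_minus_one)

lemma inner_minus_right:
  "\<lbrakk>x \<in> hcarrier H; y \<in> hcarrier H\<rbrakk> \<Longrightarrow> hinner H x (- y) = - hinner H x y"
  using inner_scale_right[of x y "-1"] by (simp add: scale_minus_one)

lemma inner_diff_left: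
  "\<lbrakk>x \<in> hcarrier H; y \<in> hcarrier H; z \<in> hcarrier H\<rbrakk> \<Longrightarrow>
    hinner H (x - y) z = hinner H x z - hinner H y z"
  using inner_add_left[of x "- y" z] by (simp add: minus_mem inner_minus_left)

lemma inner_diff_right:
  "\<lbrakk>x \<in> hcarrier H; y \<in> hcarrier H; z \<in> hcarrier H\<rbrakk> \<Longrightarrow>
    hinner H x (y - z) = hinner H x y - hinner H x z"
  using inner_add_right[of x y "- z"] by (simp add: minus_mem inner_minus_right)

lemma inner_sum_left:
  "\<lbrakk>\<And>i. i \<in> I \<Longrightarrow> f i \<in> hcarrier H; x \<in> hcarrier H\<rbrakk> \<Longrightarrow>
    hinner H (sum f I) x = (\<Sum>i\<in>I. hinner H (f i) x)"
  by (induction I rule: infinite_finite_induct)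
     (auto simp: inner_zero_left inner_add_left sum_mem)

lemma inner_sum_right:
  "\<lbrakk>\<And>i. i \<in> I \<Longrightarrow> f i \<in> hcarrier H; x \<in> hcarrier H\<rbrakk> \<Longrightarrow>
    hinner H x (sum f I) = (\<Sum>i\<in>I. hinner H x (f i))"
  by (induction I rule: infinite_finite_induct)
     (auto simp: inner_zero_right inner_add_right sum_mem)

lemma inner_self: "x \<in> hcarrier H \<Longrightarrow> hinner H x x = of_real ((hnorm H x)\<^sup>2)"
  using inner_nonneg[of x] by (auto simp: hnorm_def nonneg_Reals_def simp flip: of_real_power)

lemma norm_sq: "x \<in> hcarrier H \<Longrightarrow> (hnorm H x)\<^sup>2 = Re (hinner H x x)"
  using inner_self[of x] by simp

lemma norm_nonneg: "x \<in> hcarrier H \<Longrightarrow> 0 \<le> hnorm H x"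
  using inner_nonneg[of x] by (auto simp: hnorm_def nonneg_Reals_def)

lemma norm_zero: "hnorm H 0 = 0"
  by (simp add: hnorm_def inner_zero_left zero_mem)

lemma norm_eq_zero: "\<lbrakk>x \<in> hcarrier H; hnorm H x = 0\<rbrakk> \<Longrightarrow> x = 0"
  using inner_eq_zero[of x] inner_self[of x] by simp

lemma inner_all_eq:
  assumes "x \<in> hcarrier H" "y \<in> hcarrier H"
    and "\<And>z. z \<in> hcarrier H \<Longrightarrow> hinner H x z = hinner H y z"
  shows "x = y"
  using inner_eq_zero[of "x - y"] assms diff_mem[of x y] inner_diff_left[of x y "x - y"] by simp

lemma norm_minus_commute:
  assumes "x \<in> hcarrier H" "y \<in> hcarrier H"
  shows "hnorm H (x - y) = hnorm H (y - x)"
  using assms by (simp add: hnorm_def inner_diff_left inner_diff_right diff_mem algebra_simps)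

lemma norm_scale:
  assumes x: "x \<in> hcarrier H"
  shows "hnorm H (hscale H c x) = cmod c * hnorm H x"
proof (rule power2_eq_imp_eq)
  have "hinner H (hscale H c x) (hscale H c x) = (c * cnj c) * hinner H x x"
    using x by (simp add: inner_scale_left inner_scale_right scale_mem)
  also have "\<dots> = of_real ((cmod c * hnorm H x)\<^sup>2)"
    using inner_self[OF x] by (simp add: power_mult_distrib flip: complex_norm_square)
  finally show "(hnorm H (hscale H c x))\<^sup>2 = (cmod c * hnorm H x)\<^sup>2"
    using norm_sq[OF scale_mem[OF x, of c]] by (metis Re_complex_of_real)
qed (use x in \<open>simp_all add: norm_nonneg scale_mem\<close>)

lemma norm_add_sq:
  assumes "x \<in> hcarrier H" "y \<in> hcarrier H"
  shows "(hnorm H (x + y))\<^sup>2 = (hnorm H x)\<^sup>2 + 2 * Re (hinner H x y) + (hnorm H y)\<^sup>2"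
  using assms inner_commute[of x y]
  by (simp add: norm_sq add_mem inner_add_left inner_add_right)

lemma norm_diff_sq:
  assumes "x \<in> hcarrier H" "y \<in> hcarrier H"
  shows "(hnorm H (x - y))\<^sup>2 = (hnorm H x)\<^sup>2 - 2 * Re (hinner H x y) + (hnorm H y)\<^sup>2"
  using assms inner_commute[of x y]
  by (simp add: norm_sq diff_mem inner_diff_left inner_diff_right)

lemma cauchy_schwarz:
  assumes x: "x \<in> hcarrier H" and y: "y \<in> hcarrier H"
  shows "cmod (hinner H x y) \<le> hnorm H x * hnorm H y"
proof (cases "y = 0")
  case True
  then show ?thesis using x by (simp add: inner_zero_right norm_zero)
next
  case False
  define n where "n = (hnorm H y)\<^sup>2"
  define c where "c = hinner H x y"
  have n: "n > 0" using False norm_eq_zero[OF y] norm_nonneg[OF y] by (auto simp: n_def)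
  have mem: "hscale H (of_real n) x \<in> hcarrier H" "hscale H c y \<in> hcarrier H"
    using x y scale_mem by auto
  have "0 \<le> (hnorm H (hscale H (of_real n) x - hscale H c y))\<^sup>2" by simp
  also have "\<dots> = n\<^sup>2 * (hnorm H x)\<^sup>2 - 2 * Re (of_real n * (cnj c * c)) + (cmod c)\<^sup>2 * n"
    using n unfolding norm_diff_sq[OF mem] by (simp add: norm_scale x y inner_scale_left inner_scale_right
        mem power_mult_distrib c_def[symmetric] n_def[symmetric] algebra_simps)
  also have "cnj c * c = of_real ((cmod c)\<^sup>2)"
    by (metis complex_norm_square mult.commute)
  finally have "0 \<le> n * (n * (hnorm H x)\<^sup>2 - (cmod c)\<^sup>2)"
    by (simp add: algebra_simps power2_eq_square)
  then have "(cmod c)\<^sup>2 \<le> (hnorm H x * hnorm H y)\<^sup>2"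
    using n by (simp add: zero_le_mult_iff power_mult_distrib n_def mult.commute)
  then show ?thesis
    unfolding c_def by (rule power2_le_imp_le) (simp add: norm_nonneg x y)
qed

lemma norm_triangle:
  assumes x: "x \<in> hcarrier H" and y: "y \<in> hcarrier H"
  shows "hnorm H (x + y) \<le> hnorm H x + hnorm H y"
proof (rule power2_le_imp_le)
  have "Re (hinner H x y) \<le> hnorm H x * hnorm H y"
    using cauchy_schwarz[OF x y] complex_Re_le_cmod order_trans by blast
  then show "(hnorm H (x + y))\<^sup>2 \<le> (hnorm H x + hnorm H y)\<^sup>2"
    by (simp add: norm_add_sq x y power2_sum)
qed (simp add: norm_nonneg x y)

lemma inner_tendsto:
  assumes "\<And>n. s n \<in> hcarrier H" "l \<in> hcarrier H" "y \<in> hcarrier H"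
    and "(\<lambda>n. hnorm H (s n - l)) \<longlonglongrightarrow> 0"
  shows "(\<lambda>n. hinner H (s n) y) \<longlonglongrightarrow> hinner H l y"
proof (rule LIM_zero_cancel, rule Lim_null_comparison)
  show "(\<lambda>n. hnorm H (s n - l) * hnorm H y) \<longlonglongrightarrow> 0"
    using tendsto_mult_right[OF assms(4), of "hnorm H y"] by simp
  show "\<forall>\<^sub>F n in sequentially. cmod (hinner H (s n) y - hinner H l y) \<le> hnorm H (s n - l) * hnorm H y"
    using cauchy_schwarz[of "s _ - l" y] assms by (auto simp: inner_diff_left diff_mem)
qed

lemma norm_tendsto:
  assumes "\<And>n. s n \<in> hcarrier H" "l \<in> hcarrier H"
    and "(\<lambda>n. hnorm H (s n - l)) \<longlonglongrightarrow> 0"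
  shows "(\<lambda>n. hnorm H (s n)) \<longlonglongrightarrow> hnorm H l"
proof (rule LIM_zero_cancel, rule Lim_null_comparison)
  show "\<forall>\<^sub>F n in sequentially. norm (hnorm H (s n) - hnorm H l) \<le> hnorm H (s n - l)"
  proof (intro always_eventually allI)
    fix n
    have m: "s n - l \<in> hcarrier H" "l - s n \<in> hcarrier H" using assms diff_mem by auto
    have "hnorm H (s n) \<le> hnorm H (s n - l) + hnorm H l"
      using norm_triangle[OF m(1) assms(2)] by simp
    moreover have "hnorm H l \<le> hnorm H (s n - l) + hnorm H (s n)"
      using norm_triangle[OF m(2) assms(1)[of n]] norm_minus_commute[OF assms(1,2), of n] by simp
    ultimately show "norm (hnorm H (s n) - hnorm H l) \<le> hnorm H (s n - l)" by simp
  qed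
qed (use assms in auto)

end

text \<open>
  The orthogonal complement of any set is closed, hence a Hilbert space; a double complement
  replaces the closed linear span, and density becomes a statement about inner products.
\<close>

definition ocomp :: "'a::ab_group_add hilb \<Rightarrow> 'a set \<Rightarrow> 'a hilb" where
  "ocomp H M = H\<lparr>hcarrier := {x \<in> hcarrier H. \<forall>m\<in>M. hinner H x m = 0}\<rparr>"

lemma ocomp_simps [simp]:
  "hcarrier (ocomp H M) = {x \<in> hcarrier H. \<forall>m\<in>M. hinner H x m = 0}"
  "hscale (ocomp H M) = hscale H" "hinner (ocomp H M) = hinner H" "hnorm (ocomp H M) = hnorm H"
  by (auto simp: ocomp_def hnorm_def)

lemma (in hilbert_space) hilbert_ocomp:
  assumes M: "M \<subseteq> hcarrier H"
  shows "hilbert_space (ocomp H M)"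
proof unfold_locales
  fix s :: "nat \<Rightarrow> 'a"
  assume s: "\<And>n. s n \<in> hcarrier (ocomp H M)"
    and "\<And>e. e > 0 \<Longrightarrow> \<exists>N. \<forall>m\<ge>N. \<forall>n\<ge>N. hnorm (ocomp H M) (s m - s n) < e"
  then obtain l where l: "l \<in> hcarrier H" "(\<lambda>n. hnorm H (s n - l)) \<longlonglongrightarrow> 0"
    using complete[of s] by auto
  have "hinner H l m = 0" if "m \<in> M" for m
  proof -
    have "(\<lambda>n. hinner H (s n) m) \<longlonglongrightarrow> hinner H l m"
      using inner_tendsto[of s l m] s l that M by auto
    moreover have "(\<lambda>n. hinner H (s n) m) = (\<lambda>n. 0)" using s that by auto
    ultimately show ?thesis by (metis LIMSEQ_unique tendsto_const)
  qed
  then show "\<exists>l\<in>hcarrier (ocomp H M). (\<lambda>n. hnorm (ocomp H M) (s n - l)) \<longlonglongrightarrow> 0"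
    using l by auto
qed (use M in \<open>auto simp: zero_mem add_mem scale_mem scale_add_right scale_add_left scale_scale scale_one
      inner_add_left inner_scale_left inner_nonneg inner_eq_zero inner_zero_left subset_iff
      intro: inner_commute\<close>)

text \<open>
  The Riesz representation theorem, proved by minimising \<open>\<parallel>m\<parallel>\<^sup>2 - 2 Re \<phi>(m)\<close> over the subspace \<open>M\<close>: by the
  parallelogram law a minimising sequence is Cauchy, and its limit represents \<open>\<phi>\<close>.  The subspaces of
  interest are not closed (polynomials inside the Fock space, the range of an operator), so the limit is only
  found in the double complement.
\<close>

lemma (in hilbert_space) riesz_on_subspace:
  assumes M: "M \<subseteq> hcarrier H" "0 \<in> M" "\<And>x y. \<lbrakk>x \<in> M; y \<in> M\<rbrakk> \<Longrightarrow> x + y \<in> M"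
      "\<And>x c. x \<in> M \<Longrightarrow> hscale H c x \<in> M"
    and \<phi>: "\<And>x y. \<lbrakk>x \<in> M; y \<in> M\<rbrakk> \<Longrightarrow> \<phi> (x + y) = \<phi> x + \<phi> y"
      "\<And>x c. x \<in> M \<Longrightarrow> \<phi> (hscale H c x) = c * \<phi> x"
      "\<And>x. x \<in> M \<Longrightarrow> cmod (\<phi> x) \<le> b * hnorm H x"
    and b: "0 \<le> b"
  shows "\<exists>k\<in>hcarrier (ocomp H (hcarrier (ocomp H M))).
    (\<forall>m\<in>M. \<phi> m = hinner H m k) \<and> hnorm H k \<le> b"
proof -
  have MH: "\<And>x. x \<in> M \<Longrightarrow> x \<in> hcarrier H" using M(1) by auto
  define q where "q m = (hnorm H m)\<^sup>2 - 2 * Re (\<phi> m)" for m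
  have q_lower: "- b\<^sup>2 \<le> q m" if "m \<in> M" for m
  proof -
    have "Re (\<phi> m) \<le> b * hnorm H m"
      using \<phi>(3)[OF that] complex_Re_le_cmod order_trans by blast
    moreover have "0 \<le> (hnorm H m - b)\<^sup>2" by simp
    ultimately show ?thesis by (simp add: q_def power2_diff mult.commute)
  qed
  define I where "I = Inf (q ` M)"
  have bdd: "bdd_below (q ` M)" using q_lower by (auto intro!: bdd_belowI)
  have I_le: "I \<le> q m" if "m \<in> M" for m
    unfolding I_def using that bdd by (intro cInf_lower) auto
  have "\<exists>m\<in>M. q m < I + 1 / real (Suc n)" for n
    using cInf_lessD[of "q ` M" "I + 1 / real (Suc n)"] M(2) unfolding I_def by auto
  then obtain s where s: "\<And>n. s n \<in> M" "\<And>n. q (s n) < I + 1 / real (Suc n)" by metis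
  have sH: "\<And>n. s n \<in> hcarrier H" using s MH by auto
  have near: "(hnorm H (s n - s k))\<^sup>2 \<le> 2 / real (Suc n) + 2 / real (Suc k)" for n k
  proof -
    define m where "m = hscale H (1/2) (s n + s k)"
    have m: "m \<in> M" using s M by (auto simp: m_def)
    have "(hnorm H m)\<^sup>2 = (hnorm H (s n + s k))\<^sup>2 / 4"
      using sH by (simp add: m_def norm_scale add_mem power_mult_distrib power2_eq_square)
    moreover have "2 * \<phi> m = \<phi> (s n) + \<phi> (s k)"
      using s M \<phi> by (simp add: m_def)
    then have "2 * Re (\<phi> m) = Re (\<phi> (s n)) + Re (\<phi> (s k))"
      by (metis plus_complex.sel(1) Re_complex_of_real mult_2)
    ultimately have "(hnorm H (s n - s k))\<^sup>2 = 2 * (q (s n) + q (s k) - 2 * q m)"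
      using sH inner_commute[of "s n" "s k"]
      by (simp add: q_def norm_add_sq norm_diff_sq field_simps)
    then show ?thesis using s(2)[of n] s(2)[of k] I_le[OF m] by simp
  qed
  have cauchy: "\<exists>N. \<forall>m\<ge>N. \<forall>n\<ge>N. hnorm H (s m - s n) < e" if e: "e > 0" for e
  proof -
    obtain N where N: "4 / e\<^sup>2 < real N"
      using reals_Archimedean2 by blast
    have "hnorm H (s m - s n) < e" if "m \<ge> N" "n \<ge> N" for m n
    proof (rule power2_less_imp_less)
      have 1: "2 / real (Suc k) < e\<^sup>2 / 2" if "k \<ge> N" for k
      proof -
        have "4 / e\<^sup>2 < real (Suc k)" using N that by linarith
        then show ?thesis using e by (simp add: field_simps)
      qed
      have "2 / real (Suc m) + 2 / real (Suc n) < e\<^sup>2 / 2 + e\<^sup>2 / 2"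
        by (intro add_strict_mono 1 that)
      also have "\<dots> = e\<^sup>2" by simp
      finally show "(hnorm H (s m - s n))\<^sup>2 < e\<^sup>2" using near[of m n] by linarith
    qed (use e in simp)
    then show ?thesis by blast
  qed
  let ?D = "ocomp H (hcarrier (ocomp H M))"
  interpret D: hilbert_space ?D by (rule hilbert_ocomp) auto
  have MD: "m \<in> hcarrier ?D" if "m \<in> M" for m
    using MH[OF that] that inner_commute[of _ m] by auto
  obtain k where k: "k \<in> hcarrier ?D" "(\<lambda>n. hnorm H (s n - k)) \<longlonglongrightarrow> 0"
    using D.complete[of s] cauchy MD s(1) by auto
  have kH: "k \<in> hcarrier H" using k by simp
  have Re_eq: "Re (\<phi> m) = Re (hinner H m k)" if m: "m \<in> M" for m
  proof -
    have mH: "m \<in> hcarrier H" using MH m .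
    have ineq: "0 \<le> 2 * t * (Re (hinner H k m) - Re (\<phi> m)) + t\<^sup>2 * (hnorm H m)\<^sup>2" for t :: real
    proof (rule tendsto_le[OF sequentially_bot])
      have "(\<lambda>n. Re (hinner H (s n) m)) \<longlonglongrightarrow> Re (hinner H k m)"
        using inner_tendsto[OF sH kH mH k(2)] by (rule tendsto_Re)
      then show "(\<lambda>n. 2 * t * (Re (hinner H (s n) m) - Re (\<phi> m)) + t\<^sup>2 * (hnorm H m)\<^sup>2) \<longlonglongrightarrow>
          2 * t * (Re (hinner H k m) - Re (\<phi> m)) + t\<^sup>2 * (hnorm H m)\<^sup>2"
        by (intro tendsto_add tendsto_mult tendsto_diff tendsto_const)
      show "(\<lambda>n. - (1 / real (Suc n))) \<longlonglongrightarrow> 0"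
        using tendsto_minus[OF lim_inverse_n'[THEN LIMSEQ_Suc]] by simp
      show "\<forall>\<^sub>F n in sequentially. - (1 / real (Suc n)) \<le>
          2 * t * (Re (hinner H (s n) m) - Re (\<phi> m)) + t\<^sup>2 * (hnorm H m)\<^sup>2"
      proof (intro always_eventually allI)
        fix n
        have tm: "hscale H (of_real t) m \<in> M" "hscale H (of_real t) m \<in> hcarrier H"
          using m M mH scale_mem by auto
        have "q (s n + hscale H (of_real t) m) =
            q (s n) + (2 * t * (Re (hinner H (s n) m) - Re (\<phi> m)) + t\<^sup>2 * (hnorm H m)\<^sup>2)"
          using s(1) sH m mH tm by (simp add: q_def norm_add_sq inner_scale_right norm_scale \<phi>
              power_mult_distrib algebra_simps)
        moreover have "I \<le> q (s n + hscale H (of_real t) m)"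
          using I_le M(3) s(1) tm by auto
        ultimately show "- (1 / real (Suc n)) \<le>
            2 * t * (Re (hinner H (s n) m) - Re (\<phi> m)) + t\<^sup>2 * (hnorm H m)\<^sup>2"
          using s(2)[of n] by simp
      qed
    qed
    \<comment> \<open>A quadratic \<open>2 t a + t\<^sup>2 c\<close> that is never negative has \<open>a = 0\<close>.\<close>
    define a where "a = Re (hinner H k m) - Re (\<phi> m)"
    define c where "c = (hnorm H m)\<^sup>2"
    have "a = 0"
    proof (rule ccontr)
      assume "a \<noteq> 0"
      have c: "c \<ge> 0" by (simp add: c_def)
      define t where "t = - a / (c + 1)"
      have a: "a = - t * (c + 1)" using c by (simp add: t_def)
      have "0 \<le> 2 * t * a + t\<^sup>2 * c"
        using ineq[of t] by (simp only: a_def c_def)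
      also have "\<dots> = - (t\<^sup>2 * (c + 2))"
        by (simp add: a power2_eq_square algebra_simps)
      also have "\<dots> < 0" using c a \<open>a \<noteq> 0\<close> by simp
      finally show False by simp
    qed
    then show ?thesis
      using inner_commute[OF mH kH] by (simp add: a_def)
  qed
  have eq: "\<phi> m = hinner H m k" if m: "m \<in> M" for m
  proof (rule complex_eqI)
    show "Re (\<phi> m) = Re (hinner H m k)" by (rule Re_eq[OF m])
    \<comment> \<open>The imaginary part of \<open>\<phi>(m)\<close> is minus the real part of \<open>\<phi>(i m)\<close>.\<close>
    show "Im (\<phi> m) = Im (hinner H m k)"
      using Re_eq[OF M(4)[OF m, of \<i>]] m MH kH by (simp add: \<phi> inner_scale_left)
  qed
  have "hnorm H k \<le> b"
  proof -
    have "(hnorm H k)\<^sup>2 \<le> b * hnorm H k"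
    proof (rule tendsto_le[OF sequentially_bot])
      show "(\<lambda>n. b * hnorm H (s n)) \<longlonglongrightarrow> b * hnorm H k"
        by (intro tendsto_intros norm_tendsto sH kH k)
      show "(\<lambda>n. Re (hinner H (s n) k)) \<longlonglongrightarrow> (hnorm H k)\<^sup>2"
        unfolding norm_sq[OF kH] by (intro tendsto_Re inner_tendsto sH kH k)
      show "\<forall>\<^sub>F n in sequentially. Re (hinner H (s n) k) \<le> b * hnorm H (s n)"
      proof (intro always_eventually allI)
        fix n
        show "Re (hinner H (s n) k) \<le> b * hnorm H (s n)"
          using eq[OF s(1)[of n]] \<phi>(3)[OF s(1)[of n]] complex_Re_le_cmod[of "\<phi> (s n)"] by simp
      qed
    qed
    then show ?thesis
      using norm_nonneg[OF kH] b by (cases "hnorm H k = 0") (auto simp: power2_eq_square)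
  qed
  then show ?thesis using k eq by blast
qed

section \<open>Operators and adjoints\<close>

lemma linear_opD:
  assumes "linear_op H K T"
  shows "x \<in> hcarrier H \<Longrightarrow> T x \<in> hcarrier K"
    and "\<lbrakk>x \<in> hcarrier H; y \<in> hcarrier H\<rbrakk> \<Longrightarrow> T (x + y) = T x + T y"
    and "x \<in> hcarrier H \<Longrightarrow> T (hscale H c x) = hscale K c (T x)"
  using assms by (auto simp: linear_op_def)

lemma linear_op_zero:
  assumes "hilbert_space H" "linear_op H K T"
  shows "T 0 = 0"
proof -
  interpret hilbert_space H by fact
  show ?thesis using linear_opD(2)[OF assms(2) zero_mem zero_mem] by simp
qed

lemma linear_op_diff:
  assumes "hilbert_space H" "linear_op H K T" "x \<in> hcarrier H" "y \<in> hcarrier H"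
  shows "T (x - y) = T x - T y"
proof -
  interpret hilbert_space H by fact
  show ?thesis
    using linear_opD(2)[OF assms(2) diff_mem[OF assms(3,4)] assms(4)] by (simp add: eq_diff_eq)
qed

lemma linear_op_sum:
  assumes "hilbert_space H" "linear_op H K T" "\<And>i. i \<in> I \<Longrightarrow> f i \<in> hcarrier H"
  shows "T (sum f I) = (\<Sum>i\<in>I. T (f i))"
proof -
  interpret hilbert_space H by fact
  show ?thesis using assms(3)
    by (induction I rule: infinite_finite_induct)
       (auto simp: linear_op_zero[OF assms(1,2)] linear_opD(2)[OF assms(2)] sum_mem)
qed

lemma bounded_op_nonneg_bound:
  assumes "hilbert_space H" "bounded_op H K T"
  obtains b where "0 \<le> b" "\<And>x. x \<in> hcarrier H \<Longrightarrow> hnorm K (T x) \<le> b * hnorm H x"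
proof -
  interpret hilbert_space H by fact
  obtain M where M: "\<And>x. x \<in> hcarrier H \<Longrightarrow> hnorm K (T x) \<le> M * hnorm H x"
    using assms(2) by (auto simp: bounded_op_def)
  show thesis
  proof (rule that[of "\<bar>M\<bar>"])
    show "hnorm K (T x) \<le> \<bar>M\<bar> * hnorm H x" if "x \<in> hcarrier H" for x
      using M[OF that] mult_right_mono[OF abs_ge_self[of M] norm_nonneg[OF that]] by linarith
  qed simp
qed

lemma bounded_op_linear: "bounded_op H K T \<Longrightarrow> linear_op H K T"
  by (simp add: bounded_op_def)

lemma contraction_op_bounded: "contraction_op H K T \<Longrightarrow> bounded_op H K T"
  unfolding contraction_op_def bounded_op_def by (metis mult_1)

lemma adjoint_op_exists:
  assumes H: "hilbert_space H" and K: "hilbert_space K" and T: "linear_op H K T" and b: "0 \<le> b"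
    and bound: "\<And>x. x \<in> hcarrier H \<Longrightarrow> hnorm K (T x) \<le> b * hnorm H x"
    and y: "y \<in> hcarrier K"
  shows "adjoint_op H K T y \<in> hcarrier H \<and>
    (\<forall>x\<in>hcarrier H. hinner K (T x) y = hinner H x (adjoint_op H K T y)) \<and>
    hnorm H (adjoint_op H K T y) \<le> b * hnorm K y"
proof -
  interpret H: hilbert_space H by fact
  interpret K: hilbert_space K by fact
  note TD = linear_opD[OF T]
  have "\<exists>k\<in>hcarrier (ocomp H (hcarrier (ocomp H (hcarrier H)))).
      (\<forall>m\<in>hcarrier H. hinner K (T m) y = hinner H m k) \<and> hnorm H k \<le> b * hnorm K y"
  proof (rule H.riesz_on_subspace)
    show "cmod (hinner K (T x) y) \<le> b * hnorm K y * hnorm H x" if "x \<in> hcarrier H" for x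
    proof -
      have "cmod (hinner K (T x) y) \<le> hnorm K (T x) * hnorm K y"
        by (rule K.cauchy_schwarz) (use that y TD in auto)
      also have "\<dots> \<le> b * hnorm H x * hnorm K y"
        by (rule mult_right_mono) (use that y bound K.norm_nonneg in auto)
      finally show ?thesis by (simp add: ac_simps)
    qed
  qed (use b y in \<open>auto simp: H.zero_mem H.add_mem H.scale_mem TD K.inner_add_left
        K.inner_scale_left K.norm_nonneg\<close>)
  then obtain k where k: "k \<in> hcarrier H" "\<forall>m\<in>hcarrier H. hinner K (T m) y = hinner H m k"
    "hnorm H k \<le> b * hnorm K y" by auto
  have "adjoint_op H K T y = k"
    unfolding adjoint_op_def
  proof (rule the_equality)
    fix x' assume x': "x' \<in> hcarrier H \<and> (\<forall>x\<in>hcarrier H. hinner K (T x) y = hinner H x x')"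
    show "x' = k"
    proof (rule H.inner_all_eq)
      fix z assume z: "z \<in> hcarrier H"
      then have "hinner H z x' = hinner H z k" using x' k by metis
      then show "hinner H x' z = hinner H k z"
        using H.inner_commute[of z x'] H.inner_commute[of z k] x' k z by simp
    qed (use x' k in auto)
  qed (use k in auto)
  then show ?thesis using k by blast
qed

lemma
  assumes "hilbert_space H" "hilbert_space K" "bounded_op H K T"
  shows adjoint_op_mem: "y \<in> hcarrier K \<Longrightarrow> adjoint_op H K T y \<in> hcarrier H"
    and adjoint_op_inner: "\<lbrakk>x \<in> hcarrier H; y \<in> hcarrier K\<rbrakk> \<Longrightarrow>
      hinner K (T x) y = hinner H x (adjoint_op H K T y)"
  using bounded_op_nonneg_bound[OF assms(1,3)]
    adjoint_op_exists[OF assms(1,2) bounded_op_linear[OF assms(3)]] by metis+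

lemma adjoint_op_inner':
  assumes "hilbert_space H" "hilbert_space K" "bounded_op H K T" "x \<in> hcarrier H" "y \<in> hcarrier K"
  shows "hinner K y (T x) = hinner H (adjoint_op H K T y) x"
proof -
  interpret H: hilbert_space H by fact
  interpret K: hilbert_space K by fact
  show ?thesis
    using adjoint_op_inner[OF assms] K.inner_commute[of "T x" y] H.inner_commute[of x "adjoint_op H K T y"]
      linear_opD(1)[OF bounded_op_linear[OF assms(3)]] adjoint_op_mem[OF assms(1-3)] assms(4,5) by simp
qed

lemma linear_op_adjoint:
  assumes "hilbert_space H" "hilbert_space K" "bounded_op H K T"
  shows "linear_op K H (adjoint_op H K T)"
proof -
  interpret H: hilbert_space H by fact
  interpret K: hilbert_space K by fact
  note mem = adjoint_op_mem[OF assms] and adj = adjoint_op_inner'[OF assms, symmetric]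
    and Tm = linear_opD(1)[OF bounded_op_linear[OF assms(3)]]
  show ?thesis
    unfolding linear_op_def
  proof (intro conjI ballI allI)
    fix x y assume xy: "x \<in> hcarrier K" "y \<in> hcarrier K"
    show "adjoint_op H K T (x + y) = adjoint_op H K T x + adjoint_op H K T y"
      by (rule H.inner_all_eq)
         (use xy in \<open>auto simp: mem K.add_mem H.add_mem adj H.inner_add_left K.inner_add_left Tm\<close>)
  next
    fix c x assume x: "x \<in> hcarrier K"
    show "adjoint_op H K T (hscale K c x) = hscale H c (adjoint_op H K T x)"
      by (rule H.inner_all_eq)
         (use x in \<open>auto simp: mem K.scale_mem H.scale_mem adj H.inner_scale_left K.inner_scale_left Tm\<close>)
  qed (rule mem)
qed

lemma bounded_op_adjoint:
  assumes "hilbert_space H" "hilbert_space K" "bounded_op H K T"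
  shows "bounded_op K H (adjoint_op H K T)"
  using bounded_op_nonneg_bound[OF assms(1,3)] linear_op_adjoint[OF assms]
    adjoint_op_exists[OF assms(1,2) bounded_op_linear[OF assms(3)]] unfolding bounded_op_def by metis

lemma contraction_op_adjoint:
  assumes "hilbert_space H" "hilbert_space K" "contraction_op H K T"
  shows "contraction_op K H (adjoint_op H K T)"
  using linear_op_adjoint[OF assms(1,2) contraction_op_bounded[OF assms(3)]] assms
    adjoint_op_exists[OF assms(1,2), of T 1] unfolding contraction_op_def by auto

section \<open>Hilbert sums\<close>

text \<open>
  The Fock space and the finite power of a Hilbert space are both the Hilbert sum of copies indexed by a
  type (words, respectively letters), so one construction serves for both; natural numbers are a third index
  type, needed for dilations.
\<close>

definition l2 :: "'u::ab_group_add hilb \<Rightarrow> ('i \<Rightarrow> 'u) hilb" where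
  "l2 U =
     \<lparr> hcarrier = {f. (\<forall>i. f i \<in> hcarrier U) \<and> (\<lambda>i. (hnorm U (f i))\<^sup>2) summable_on UNIV},
       hscale = (\<lambda>c f i. hscale U c (f i)),
       hinner = (\<lambda>f g. \<Sum>\<^sub>\<infinity>i. hinner U (f i) (g i)) \<rparr>"

lemma fock_eq_l2: "fock = l2"
  by (simp add: fun_eq_iff fock_def l2_def)

lemma hpow_eq_l2: "hpow = l2"
  by (simp add: fun_eq_iff hpow_def l2_def)

lemma l2_simps:
  "f \<in> hcarrier (l2 U) \<longleftrightarrow> (\<forall>i. f i \<in> hcarrier U) \<and> (\<lambda>i. (hnorm U (f i))\<^sup>2) summable_on UNIV"
  "hscale (l2 U) c f = (\<lambda>i. hscale U c (f i))"
  "hinner (l2 U) f g = (\<Sum>\<^sub>\<infinity>i. hinner U (f i) (g i))"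
  by (simp_all add: l2_def)

context hilbert_space
begin

lemma l2_add_mem:
  assumes f: "f \<in> hcarrier (l2 H)" and g: "g \<in> hcarrier (l2 H)"
  shows "f + g \<in> hcarrier (l2 H)"
  unfolding l2_simps
proof (intro conjI allI)
  show "(f + g) i \<in> hcarrier H" for i
    using f g by (auto simp: l2_simps add_mem)
  show "(\<lambda>i. (hnorm H ((f + g) i))\<^sup>2) summable_on UNIV"
  proof (rule summable_on_comparison_test)
    show "(\<lambda>i. 2 * (hnorm H (f i))\<^sup>2 + 2 * (hnorm H (g i))\<^sup>2) summable_on UNIV"
      using f g by (intro summable_on_add summable_on_cmult_right) (auto simp: l2_simps)
    fix i
    have m: "f i \<in> hcarrier H" "g i \<in> hcarrier H" using f g by (auto simp: l2_simps)
    have "0 \<le> (hnorm H (f i - g i))\<^sup>2" by simp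
    then show "(hnorm H ((f + g) i))\<^sup>2 \<le> 2 * (hnorm H (f i))\<^sup>2 + 2 * (hnorm H (g i))\<^sup>2"
      by (simp add: norm_add_sq norm_diff_sq m)
  qed simp
qed

lemma l2_scale_mem:
  assumes f: "f \<in> hcarrier (l2 H)"
  shows "hscale (l2 H) c f \<in> hcarrier (l2 H)"
  using f by (auto simp: l2_simps scale_mem norm_scale power_mult_distrib intro!: summable_on_cmult_right)

lemma l2_inner_abs_summable:
  assumes f: "f \<in> hcarrier (l2 H)" and g: "g \<in> hcarrier (l2 H)"
  shows "(\<lambda>i. cmod (hinner H (f i) (g i))) summable_on UNIV"
proof (rule summable_on_comparison_test)
  show "(\<lambda>i. (hnorm H (f i))\<^sup>2 + (hnorm H (g i))\<^sup>2) summable_on UNIV"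
    using f g by (intro summable_on_add) (auto simp: l2_simps)
  fix i
  have m: "f i \<in> hcarrier H" "g i \<in> hcarrier H" using f g by (auto simp: l2_simps)
  have "2 * (hnorm H (f i) * hnorm H (g i)) \<le> (hnorm H (f i))\<^sup>2 + (hnorm H (g i))\<^sup>2"
    using sum_squares_bound[of "hnorm H (f i)" "hnorm H (g i)"] by simp
  moreover have "0 \<le> hnorm H (f i) * hnorm H (g i)" using m norm_nonneg by simp
  ultimately show "cmod (hinner H (f i) (g i)) \<le> (hnorm H (f i))\<^sup>2 + (hnorm H (g i))\<^sup>2"
    using cauchy_schwarz[OF m] by linarith
qed simp

lemma l2_inner_summable:
  assumes "f \<in> hcarrier (l2 H)" and "g \<in> hcarrier (l2 H)"
  shows "(\<lambda>i. hinner H (f i) (g i)) summable_on UNIV"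
  using abs_summable_summable[OF l2_inner_abs_summable[OF assms]] .

lemma l2_inner_self:
  assumes f: "f \<in> hcarrier (l2 H)"
  shows "hinner (l2 H) f f = of_real (\<Sum>\<^sub>\<infinity>i. (hnorm H (f i))\<^sup>2)"
proof -
  have "hinner (l2 H) f f = (\<Sum>\<^sub>\<infinity>i. of_real ((hnorm H (f i))\<^sup>2))"
    unfolding l2_simps using f by (intro infsum_cong inner_self) (auto simp: l2_simps)
  also have "\<dots> = of_real (\<Sum>\<^sub>\<infinity>i. (hnorm H (f i))\<^sup>2)"
    using f by (intro infsumI has_sum_of_real has_sum_infsum) (simp add: l2_simps)
  finally show ?thesis .
qed

lemma l2_norm_sq:
  assumes f: "f \<in> hcarrier (l2 H)"
  shows "(hnorm (l2 H) f)\<^sup>2 = (\<Sum>\<^sub>\<infinity>i. (hnorm H (f i))\<^sup>2)"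
  by (simp add: hnorm_def l2_inner_self[OF f, unfolded hnorm_def] infsum_nonneg)

lemma l2_norm_nonneg: "f \<in> hcarrier (l2 H) \<Longrightarrow> 0 \<le> hnorm (l2 H) f"
  by (simp add: hnorm_def l2_inner_self[unfolded hnorm_def] infsum_nonneg)

lemma l2_norm_component_le:
  assumes f: "f \<in> hcarrier (l2 H)"
  shows "hnorm H (f i) \<le> hnorm (l2 H) f"
proof (rule power2_le_imp_le)
  have "(\<Sum>i\<in>{i}. (hnorm H (f i))\<^sup>2) \<le> (\<Sum>\<^sub>\<infinity>i. (hnorm H (f i))\<^sup>2)"
    using f by (intro finite_sum_le_infsum) (auto simp: l2_simps)
  then show "(hnorm H (f i))\<^sup>2 \<le> (hnorm (l2 H) f)\<^sup>2"
    by (simp add: l2_norm_sq[OF f])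
qed (rule l2_norm_nonneg[OF f])

lemma l2_complete:
  assumes s: "\<And>n. s n \<in> hcarrier (l2 H)"
    and cau: "\<And>e. e > 0 \<Longrightarrow> \<exists>N. \<forall>m\<ge>N. \<forall>n\<ge>N. hnorm (l2 H) (s m - s n) < e"
  shows "\<exists>l\<in>hcarrier (l2 H). (\<lambda>n. hnorm (l2 H) (s n - l)) \<longlonglongrightarrow> 0"
proof -
  have sm: "s n i \<in> hcarrier H" for n i using s by (auto simp: l2_simps)
  have l2_diff: "f - g \<in> hcarrier (l2 H)" if "f \<in> hcarrier (l2 H)" "g \<in> hcarrier (l2 H)"
    for f g :: "'b \<Rightarrow> 'a"
  proof -
    have "f - g = f + hscale (l2 H) (-1) g"
      using that by (auto simp: l2_simps fun_eq_iff scale_minus_one)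
    then show ?thesis using l2_add_mem[OF that(1) l2_scale_mem[OF that(2), of "-1"]] by metis
  qed
  have "\<exists>l\<in>hcarrier H. (\<lambda>n. hnorm H (s n i - l)) \<longlonglongrightarrow> 0" for i
  proof (rule complete)
    fix e :: real assume "e > 0"
    then obtain N where "\<forall>m\<ge>N. \<forall>n\<ge>N. hnorm (l2 H) (s m - s n) < e" using cau by blast
    moreover have "hnorm H (s m i - s n i) \<le> hnorm (l2 H) (s m - s n)" for m n
      using l2_norm_component_le[OF l2_diff[OF s s], of m n i] by simp
    ultimately show "\<exists>N. \<forall>m\<ge>N. \<forall>n\<ge>N. hnorm H (s m i - s n i) < e"
      by (meson order_le_less_trans)
  qed (rule sm)
  then obtain l where l: "\<And>i. l i \<in> hcarrier H" "\<And>i. (\<lambda>n. hnorm H (s n i - l i)) \<longlonglongrightarrow> 0"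
    by metis
  \<comment> \<open>Fatou's argument: the Cauchy estimate passes to the componentwise limit on every finite set of
    components, and finite partial sums control the whole sum.\<close>
  have fin: "(\<Sum>i\<in>F. (hnorm H (s n i - l i))\<^sup>2) \<le> e\<^sup>2"
    if "finite F" "\<And>m. m \<ge> N \<Longrightarrow> hnorm (l2 H) (s n - s m) \<le> e" for F n N e
  proof (rule tendsto_le[OF sequentially_bot])
    show "(\<lambda>m. \<Sum>i\<in>F. (hnorm H (s n i - s m i))\<^sup>2) \<longlonglongrightarrow> (\<Sum>i\<in>F. (hnorm H (s n i - l i))\<^sup>2)"
    proof (intro tendsto_intros norm_tendsto)
      fix i
      have "hnorm H (s n i - s m i - (s n i - l i)) = hnorm H (s m i - l i)" for m
        using norm_minus_commute[of "l i" "s m i"] l sm by simp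
      then show "(\<lambda>m. hnorm H (s n i - s m i - (s n i - l i))) \<longlonglongrightarrow> 0"
        using l(2)[of i] by simp
    qed (use sm l diff_mem in auto)
    show "\<forall>\<^sub>F m in sequentially. (\<Sum>i\<in>F. (hnorm H (s n i - s m i))\<^sup>2) \<le> e\<^sup>2"
      unfolding eventually_sequentially
    proof (intro exI[of _ N] allI impI)
      fix m assume m: "m \<ge> N"
      have d: "s n - s m \<in> hcarrier (l2 H)" using l2_diff s by blast
      have "(\<Sum>i\<in>F. (hnorm H ((s n - s m) i))\<^sup>2) \<le> (hnorm (l2 H) (s n - s m))\<^sup>2"
        unfolding l2_norm_sq[OF d] using d that(1) by (intro finite_sum_le_infsum) (auto simp: l2_simps)
      also have "\<dots> \<le> e\<^sup>2" using that(2)[OF m] l2_norm_nonneg[OF d] by (intro power_mono)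
      finally show "(\<Sum>i\<in>F. (hnorm H (s n i - s m i))\<^sup>2) \<le> e\<^sup>2" by simp
    qed
  qed simp
  have near: "s n - l \<in> hcarrier (l2 H) \<and> hnorm (l2 H) (s n - l) \<le> e"
    if "\<And>m. m \<ge> N \<Longrightarrow> hnorm (l2 H) (s n - s m) \<le> e" "0 \<le> e" for n N e
  proof
    have "(\<lambda>i. (hnorm H ((s n - l) i))\<^sup>2) summable_on UNIV"
      by (intro nonneg_bdd_above_summable_on)
         (use fin[OF _ that(1)] in \<open>auto intro!: bdd_aboveI[of _ "e\<^sup>2"]\<close>)
    then show m: "s n - l \<in> hcarrier (l2 H)"
      by (auto simp: l2_simps diff_mem sm l)
    have "(hnorm (l2 H) (s n - l))\<^sup>2 \<le> e\<^sup>2"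
      unfolding l2_norm_sq[OF m] using m fin[OF _ that(1)]
      by (intro infsum_le_finite_sums) (auto simp: l2_simps)
    then show "hnorm (l2 H) (s n - l) \<le> e" using that(2) by (rule power2_le_imp_le)
  qed
  obtain N where "\<forall>m\<ge>N. \<forall>n\<ge>N. hnorm (l2 H) (s m - s n) < 1" using cau[of 1] by auto
  then have "s N - l \<in> hcarrier (l2 H)" using near[of N N 1] by (simp add: less_imp_le)
  then have lm: "l \<in> hcarrier (l2 H)" using l2_diff[OF s[of N], of "s N - l"] by simp
  have "(\<lambda>n. hnorm (l2 H) (s n - l)) \<longlonglongrightarrow> 0"
  proof (rule LIMSEQ_I)
    fix e :: real assume e: "e > 0"
    obtain N where N: "\<forall>m\<ge>N. \<forall>n\<ge>N. hnorm (l2 H) (s m - s n) < e/2"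
      using cau[of "e/2"] e by auto
    have "norm (hnorm (l2 H) (s n - l) - 0) < e" if "n \<ge> N" for n
    proof -
      have "\<And>m. m \<ge> N \<Longrightarrow> hnorm (l2 H) (s n - s m) \<le> e/2" using N that by (simp add: less_imp_le)
      then have "s n - l \<in> hcarrier (l2 H) \<and> hnorm (l2 H) (s n - l) \<le> e/2"
        by (intro near) (use e in auto)
      then show ?thesis using e l2_norm_nonneg[of "s n - l"] by simp
    qed
    then show "\<exists>no. \<forall>n\<ge>no. norm (hnorm (l2 H) (s n - l) - 0) < e" by blast
  qed
  then show ?thesis using lm by blast
qed

lemma hilbert_l2: "hilbert_space (l2 H :: ('i \<Rightarrow> 'a) hilb)"
proof unfold_locales
  show "0 \<in> hcarrier (l2 H :: ('i \<Rightarrow> 'a) hilb)"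
    by (simp add: l2_simps zero_mem norm_zero)
next
  fix x y z :: "'i \<Rightarrow> 'a" and c
  assume x: "x \<in> hcarrier (l2 H)" and y: "y \<in> hcarrier (l2 H)"
  show "hinner (l2 H) y x = cnj (hinner (l2 H) x y)"
    unfolding l2_simps infsum_cnj[symmetric]
    using x y by (intro infsum_cong inner_commute) (auto simp: l2_simps)
  show "hinner (l2 H) (hscale (l2 H) c x) y = c * hinner (l2 H) x y"
    unfolding l2_simps infsum_cmult_right'[symmetric]
    using x y by (intro infsum_cong inner_scale_left) (auto simp: l2_simps)
  assume z: "z \<in> hcarrier (l2 H)"
  show "hinner (l2 H) (x + y) z = hinner (l2 H) x z + hinner (l2 H) y z"
    unfolding l2_simps infsum_add[OF l2_inner_summable[OF x z] l2_inner_summable[OF y z], symmetric]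
    using x y z by (intro infsum_cong) (auto simp: l2_simps inner_add_left)
next
  fix x :: "'i \<Rightarrow> 'a" assume x: "x \<in> hcarrier (l2 H)"
  show "hinner (l2 H) x x \<in> \<real>\<^sub>\<ge>\<^sub>0"
    by (simp add: l2_inner_self[OF x] infsum_nonneg)
  assume "hinner (l2 H) x x = 0"
  then have "hnorm (l2 H) x = 0" by (simp add: hnorm_def)
  then have "hnorm H (x i) \<le> 0" for i using l2_norm_component_le[OF x, of i] by simp
  then show "x = 0"
    using x norm_nonneg by (auto simp: l2_simps fun_eq_iff intro!: norm_eq_zero order_antisym)
qed (auto simp: l2_add_mem l2_scale_mem intro: l2_complete,
     auto simp: l2_simps fun_eq_iff scale_add_right scale_add_left scale_scale scale_one)

end

lemma hsum_simps:
  "p \<in> hcarrier (H \<oplus>\<^sub>H K) \<longleftrightarrow> fst p \<in> hcarrier H \<and> snd p \<in> hcarrier K"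
  "hscale (H \<oplus>\<^sub>H K) c p = (hscale H c (fst p), hscale K c (snd p))"
  "hinner (H \<oplus>\<^sub>H K) p q = hinner H (fst p) (fst q) + hinner K (snd p) (snd q)"
  by (auto simp: hsum_def mem_Times_iff split: prod.splits)

lemma hsum_norm_sq:
  assumes "hilbert_space H" "hilbert_space K" "p \<in> hcarrier (H \<oplus>\<^sub>H K)"
  shows "(hnorm (H \<oplus>\<^sub>H K) p)\<^sup>2 = (hnorm H (fst p))\<^sup>2 + (hnorm K (snd p))\<^sup>2"
proof -
  interpret H: hilbert_space H by fact
  interpret K: hilbert_space K by fact
  have "fst p \<in> hcarrier H" "snd p \<in> hcarrier K" using assms(3) by (auto simp: hsum_simps)
  then show ?thesis
    using H.inner_self K.inner_self by (simp add: hnorm_def[of "H \<oplus>\<^sub>H K"] hsum_simps)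
qed

lemma hilbert_hsum:
  assumes "hilbert_space H" "hilbert_space K"
  shows "hilbert_space (H \<oplus>\<^sub>H K)"
proof -
  interpret H: hilbert_space H by fact
  interpret K: hilbert_space K by fact
  note nsq = hsum_norm_sq[OF assms]
  show ?thesis
  proof unfold_locales
    fix x assume x: "x \<in> hcarrier (H \<oplus>\<^sub>H K)" "hinner (H \<oplus>\<^sub>H K) x x = 0"
    then have "of_real ((hnorm H (fst x))\<^sup>2 + (hnorm K (snd x))\<^sup>2) = (0 :: complex)"
      using H.inner_self[of "fst x"] K.inner_self[of "snd x"] by (simp add: hsum_simps)
    then have "(hnorm H (fst x))\<^sup>2 + (hnorm K (snd x))\<^sup>2 = 0" using of_real_eq_0_iff by blast
    then show "x = 0"
      using x by (auto simp: sum_power2_eq_zero_iff hsum_simps prod_eq_iff H.norm_eq_zero K.norm_eq_zero)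
  next
    fix s :: "nat \<Rightarrow> 'a \<times> 'b"
    assume s: "\<And>n. s n \<in> hcarrier (H \<oplus>\<^sub>H K)"
      and cau: "\<And>e. e > 0 \<Longrightarrow> \<exists>N. \<forall>m\<ge>N. \<forall>n\<ge>N. hnorm (H \<oplus>\<^sub>H K) (s m - s n) < e"
    have sm: "fst (s n) \<in> hcarrier H" "snd (s n) \<in> hcarrier K" for n
      using s[of n] by (auto simp: hsum_simps)
    have d: "s m - s n \<in> hcarrier (H \<oplus>\<^sub>H K)" for m n
      using sm H.diff_mem K.diff_mem by (auto simp: hsum_simps)
    have nn: "0 \<le> hnorm (H \<oplus>\<^sub>H K) (s m - s n)" for m n
      using d[of m n] H.inner_nonneg K.inner_nonneg
      by (auto simp: hnorm_def hsum_simps nonneg_Reals_def)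
         (metis Re_complex_of_real add_nonneg_nonneg)
    have le: "hnorm H (fst (s m) - fst (s n)) \<le> hnorm (H \<oplus>\<^sub>H K) (s m - s n)"
      "hnorm K (snd (s m) - snd (s n)) \<le> hnorm (H \<oplus>\<^sub>H K) (s m - s n)" for m n
      by (rule power2_le_imp_le, use nsq[OF d, of m n] nn in auto)+
    have "\<exists>l\<in>hcarrier H. (\<lambda>n. hnorm H (fst (s n) - l)) \<longlonglongrightarrow> 0"
      by (rule H.complete) (use sm cau le order_le_less_trans in meson)+
    then obtain l1 where l1: "l1 \<in> hcarrier H" "(\<lambda>n. hnorm H (fst (s n) - l1)) \<longlonglongrightarrow> 0" by blast
    have "\<exists>l\<in>hcarrier K. (\<lambda>n. hnorm K (snd (s n) - l)) \<longlonglongrightarrow> 0"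
      by (rule K.complete) (use sm cau le order_le_less_trans in meson)+
    then obtain l2 where l2: "l2 \<in> hcarrier K" "(\<lambda>n. hnorm K (snd (s n) - l2)) \<longlonglongrightarrow> 0" by blast
    have m: "s n - (l1, l2) \<in> hcarrier (H \<oplus>\<^sub>H K)" for n
      using sm l1 l2 H.diff_mem K.diff_mem by (auto simp: hsum_simps)
    have "(\<lambda>n. (hnorm (H \<oplus>\<^sub>H K) (s n - (l1, l2)))\<^sup>2) \<longlonglongrightarrow> 0\<^sup>2 + 0\<^sup>2"
      unfolding nsq[OF m] fst_diff snd_diff fst_conv snd_conv
      by (intro tendsto_intros l1 l2)
    then have "(\<lambda>n. sqrt ((hnorm (H \<oplus>\<^sub>H K) (s n - (l1, l2)))\<^sup>2)) \<longlonglongrightarrow> sqrt (0\<^sup>2 + 0\<^sup>2)"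
      by (rule tendsto_real_sqrt)
    then have "(\<lambda>n. hnorm (H \<oplus>\<^sub>H K) (s n - (l1, l2))) \<longlonglongrightarrow> 0"
      by (simp add: tendsto_rabs_zero_iff)
    then show "\<exists>l\<in>hcarrier (H \<oplus>\<^sub>H K). (\<lambda>n. hnorm (H \<oplus>\<^sub>H K) (s n - l)) \<longlonglongrightarrow> 0"
      using l1 l2 by (intro bexI[of _ "(l1, l2)"]) (auto simp: hsum_simps)
  qed (auto simp: hsum_simps zero_prod_def prod_eq_iff H.zero_mem K.zero_mem H.add_mem K.add_mem H.scale_mem K.scale_mem
      H.scale_add_left K.scale_add_left H.scale_add_right K.scale_add_right
      H.scale_scale K.scale_scale H.scale_one K.scale_one
      H.inner_add_left K.inner_add_left H.inner_scale_left K.inner_scale_left algebra_simps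
      intro!: nonneg_Reals_add_I H.inner_nonneg K.inner_nonneg
      simp flip: H.inner_commute K.inner_commute)
qed

section \<open>Sums over factorisations of a word\<close>

lemma sum_splits_Nil: "(\<Sum>(\<alpha>, \<beta>) | \<alpha> @ \<beta> = []. h \<alpha> \<beta>) = (h [] [] :: 'a::comm_monoid_add)"
proof -
  have "{(\<alpha>, \<beta>). \<alpha> @ \<beta> = []} = {([], [])}" by auto
  then show ?thesis by simp
qed

lemma sum_splits_Cons:
  "(\<Sum>(\<alpha>, \<beta>) | \<alpha> @ \<beta> = i # v. h \<alpha> \<beta>) =
    (h [] (i # v) :: 'a::comm_monoid_add) + (\<Sum>(\<alpha>, \<beta>) | \<alpha> @ \<beta> = v. h (i # \<alpha>) \<beta>)"
proof -
  have "{(\<alpha>, \<beta>). \<alpha> @ \<beta> = i # v} = insert ([], i # v) ((\<lambda>(\<alpha>, \<beta>). (i # \<alpha>, \<beta>)) ` {(\<alpha>, \<beta>). \<alpha> @ \<beta> = v})"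
    by (auto simp: append_eq_Cons_conv image_iff)
  moreover have "([], i # v) \<notin> (\<lambda>(\<alpha>, \<beta>). (i # \<alpha>, \<beta>)) ` {(\<alpha>, \<beta>). \<alpha> @ \<beta> = v}" by auto
  ultimately show ?thesis
    by (simp add: finite_splits[unfolded case_prod_unfold] sum.reindex inj_on_def case_prod_unfold prod_eq_iff)
qed

lemma sum_splits_snoc:
  "(\<Sum>(\<alpha>, \<beta>) | \<alpha> @ \<beta> = v @ [j]. h \<alpha> \<beta>) =
    (h (v @ [j]) [] :: 'a::comm_monoid_add) + (\<Sum>(\<alpha>, \<beta>) | \<alpha> @ \<beta> = v. h \<alpha> (\<beta> @ [j]))"
proof -
  have "{(\<alpha>, \<beta>). \<alpha> @ \<beta> = v @ [j]} =
      insert (v @ [j], []) ((\<lambda>(\<alpha>, \<beta>). (\<alpha>, \<beta> @ [j])) ` {(\<alpha>, \<beta>). \<alpha> @ \<beta> = v})"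
  proof (intro set_eqI iffI)
    fix p assume "p \<in> {(\<alpha>, \<beta>). \<alpha> @ \<beta> = v @ [j]}"
    then show "p \<in> insert (v @ [j], []) ((\<lambda>(\<alpha>, \<beta>). (\<alpha>, \<beta> @ [j])) ` {(\<alpha>, \<beta>). \<alpha> @ \<beta> = v})"
      by (cases "snd p" rule: rev_cases) (auto simp: image_iff simp flip: append_assoc)
  qed auto
  moreover have "(v @ [j], []) \<notin> (\<lambda>(\<alpha>, \<beta>). (\<alpha>, \<beta> @ [j])) ` {(\<alpha>, \<beta>). \<alpha> @ \<beta> = v}" by auto
  ultimately show ?thesis
    by (simp add: finite_splits[unfolded case_prod_unfold] sum.reindex inj_on_def case_prod_unfold prod_eq_iff)
qed

lemma sum_splits_head:
  "(\<Sum>(\<alpha>, \<beta>) | \<alpha> @ \<beta> = v. if \<alpha> = [] then h \<beta> else (0 :: 'a::comm_monoid_add)) = h (v :: 'd list)"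
proof -
  have "(\<Sum>(\<alpha>, \<beta>) | \<alpha> @ \<beta> = v. if \<alpha> = [] then h \<beta> else 0) =
      (\<Sum>(\<alpha>, \<beta>) \<in> {([] :: 'd list, v)}. if \<alpha> = [] then h \<beta> else 0)"
    by (rule sum.mono_neutral_right[OF finite_splits]) (auto split: if_splits)
  then show ?thesis by simp
qed

lemma finite_words_length: "finite {v :: 'd::finite list. length v = n}"
  using finite_lists_length_eq[of "UNIV :: 'd set" n] by simp

lemma sum_words_Suc:
  "(\<Sum>v | length v = Suc n. h v) = (\<Sum>v | length v = n. \<Sum>i\<in>UNIV. h (i # v :: 'd::finite list))"
proof -
  have "{v :: 'd list. length v = Suc n} = (\<lambda>(v, i). i # v) ` ({v. length v = n} \<times> UNIV)"
    by (auto simp: length_Suc_conv image_iff)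
  then show ?thesis
    by (simp add: sum.reindex inj_on_def sum.cartesian_product case_prod_unfold prod_eq_iff)
qed

section \<open>Contractive realizations are in the Schur class\<close>

lemma transfer_Nil: "transfer A B C D [] = D"
  by (simp add: transfer_def)

lemma transfer_snoc: "transfer A B C D (v @ [j]) = C \<circ> foldr A v \<circ> B j"
proof -
  have "{(j', v'). v' @ [j'] = v @ [j]} = {(j, v)}" by auto
  then show ?thesis by (simp add: transfer_def)
qed

text \<open>
  The state trajectory, started at 0, of the system \<open>x(i v) = A\<^sub>i x(v) + B\<^sub>i f(v)\<close>,
  \<open>y(v) = C x(v) + D f(v)\<close> on the tree of words.
\<close>

primrec sys_state :: "('d \<Rightarrow> 'x \<Rightarrow> 'x::ab_group_add) \<Rightarrow> ('d \<Rightarrow> 'u \<Rightarrow> 'x) \<Rightarrow> ('d, 'u) series \<Rightarrow> ('d, 'x) series" where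
  "sys_state A B f [] = 0"
| "sys_state A B f (i # v) = A i (sys_state A B f v) + B i (f v)"

text \<open>
  Multiplication by the transfer function is the input-output map of the system; this is what turns a
  contractivity statement about one step of the system into one about the multiplier.
\<close>

lemma transfer_app_eq_output:
  fixes X :: "'x::ab_group_add hilb" and S :: "('d, 'u::ab_group_add \<Rightarrow> 'y::ab_group_add) series"
  assumes X: "hilbert_space X" and Y: "hilbert_space Y" and blocks: "bounded_blocks X U Y A B C D"
    and S: "series_eq_on U S (transfer A B C D)" and f: "\<And>\<alpha>. f \<alpha> \<in> hcarrier U"
  shows "sys_state A B f v \<in> hcarrier X \<and> series_app S f v = C (sys_state A B f v) + D (f v)"
proof -
  interpret X: hilbert_space X by fact
  have A: "\<And>j. linear_op X X (A j)" and B: "\<And>j. linear_op U X (B j)" and C: "linear_op X Y C"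
    using blocks by (auto simp: bounded_blocks_def bounded_op_def)
  \<comment> \<open>\<open>G \<alpha>\<close> is the coefficient of \<open>z\<^sup>\<alpha>\<close> in \<open>(I - Z(z) A)\<^sup>-\<^sup>1 Z(z) B\<close>, computed letter by letter from the left.\<close>
  define G where "G = rec_list (\<lambda>u. 0) (\<lambda>i \<alpha> g u. A i (g u) + (if \<alpha> = [] then B i u else 0))"
  have G: "G [] = (\<lambda>u. 0)" "\<And>i \<alpha>. G (i # \<alpha>) = (\<lambda>u. A i (G \<alpha> u) + (if \<alpha> = [] then B i u else 0))"
    by (auto simp: G_def)
  have Gm: "G \<alpha> u \<in> hcarrier X" if "u \<in> hcarrier U" for \<alpha> u
    by (induction \<alpha>) (use that in \<open>auto simp: G X.zero_mem X.add_mem linear_opD(1)[OF A] linear_opD(1)[OF B]\<close>)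
  have G_snoc: "G (v @ [j]) u = foldr A v (B j u)" for v j u
    by (induction v) (auto simp: G linear_op_zero[OF X A])
  have transfer_G: "transfer A B C D \<alpha> u = C (G \<alpha> u) + (if \<alpha> = [] then D u else 0)" for \<alpha> u
    by (cases \<alpha> rule: rev_cases)
       (auto simp: transfer_Nil transfer_snoc G_snoc G linear_op_zero[OF X C])
  have state: "sys_state A B f v = (\<Sum>(\<alpha>, \<beta>) | \<alpha> @ \<beta> = v. G \<alpha> (f \<beta>))" for v
  proof (induction v)
    case (Cons i v)
    have "(\<Sum>(\<alpha>, \<beta>) | \<alpha> @ \<beta> = i # v. G \<alpha> (f \<beta>)) =
        (\<Sum>(\<alpha>, \<beta>) | \<alpha> @ \<beta> = v. A i (G \<alpha> (f \<beta>))) +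
        (\<Sum>(\<alpha>, \<beta>) | \<alpha> @ \<beta> = v. if \<alpha> = [] then B i (f \<beta>) else 0)"
      unfolding sum_splits_Cons by (simp add: G sum.distrib[symmetric] case_prod_unfold)
    also have "(\<Sum>(\<alpha>, \<beta>) | \<alpha> @ \<beta> = v. A i (G \<alpha> (f \<beta>))) = A i (sys_state A B f v)"
      unfolding Cons.IH case_prod_unfold by (rule linear_op_sum[OF X A, symmetric]) (simp add: Gm f)
    finally show ?case by (simp add: sum_splits_head)
  qed (simp add: sum_splits_Nil G)
  have "series_app S f v = (\<Sum>(\<alpha>, \<beta>) | \<alpha> @ \<beta> = v. C (G \<alpha> (f \<beta>))) +
      (\<Sum>(\<alpha>, \<beta>) | \<alpha> @ \<beta> = v. if \<alpha> = [] then D (f \<beta>) else 0)"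
    using S f by (simp add: series_app_def series_eq_on_def transfer_G sum.distrib[symmetric] case_prod_unfold)
  also have "(\<Sum>(\<alpha>, \<beta>) | \<alpha> @ \<beta> = v. C (G \<alpha> (f \<beta>))) = C (sys_state A B f v)"
    unfolding state case_prod_unfold by (rule linear_op_sum[OF X C, symmetric]) (simp add: Gm f)
  finally have "series_app S f v = C (sys_state A B f v) + D (f v)"
    by (simp add: sum_splits_head)
  moreover have "sys_state A B f v \<in> hcarrier X"
    unfolding state by (auto simp: Gm f intro!: X.sum_mem)
  ultimately show ?thesis by blast
qed

lemma series_app_mem:
  assumes "hilbert_space Y" "op_series U Y S" "\<And>\<alpha>. f \<alpha> \<in> hcarrier U"
  shows "series_app S f v \<in> hcarrier Y"
proof -
  interpret Y: hilbert_space Y by fact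
  show ?thesis unfolding series_app_def
    using assms by (intro Y.sum_mem) (auto simp: op_series_def bounded_op_def linear_op_def)
qed

text \<open>Multiplication by \<^term>\<open>S\<close> makes sense on the whole Fock space, because every word has finitely many
  factorisations.\<close>

lemma contraction_series_app:
  assumes U: "hilbert_space U" and Y: "hilbert_space Y" and S: "op_series U Y S"
    and bound: "\<And>f. f \<in> hcarrier (fock U) \<Longrightarrow>
      series_app S f \<in> hcarrier (fock Y) \<and> hnorm (fock Y) (series_app S f) \<le> hnorm (fock U) f"
  shows "contraction_op (fock U) (fock Y) (series_app S)"
proof -
  interpret Y: hilbert_space Y by fact
  have S': "\<And>\<alpha>. linear_op U Y (S \<alpha>)" using S by (simp add: op_series_def bounded_op_def)
  have "series_app S (hscale (fock U) c f) = hscale (fock Y) c (series_app S f)"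
    if "\<And>\<alpha>. f \<alpha> \<in> hcarrier U" for c f
  proof
    fix v
    have "linear_op Y Y (hscale Y c)"
      by (auto simp: linear_op_def Y.scale_mem Y.scale_add_right Y.scale_scale mult.commute)
    then show "series_app S (hscale (fock U) c f) v = hscale (fock Y) c (series_app S f) v"
      unfolding series_app_def fock_eq_l2 l2_simps case_prod_unfold
      using that by (subst linear_op_sum[OF Y]) (auto simp: linear_opD[OF S'])
  qed
  moreover have "series_app S (f + g) = series_app S f + series_app S g"
    if "\<And>\<alpha>. f \<alpha> \<in> hcarrier U" "\<And>\<alpha>. g \<alpha> \<in> hcarrier U" for f g
    using that by (auto simp: series_app_def fun_eq_iff case_prod_unfold linear_opD[OF S'] sum.distrib)
  ultimately show ?thesis
    using bound unfolding contraction_op_def linear_op_def fock_eq_l2 by (auto simp: l2_simps(1))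
qed

text \<open>
  Energy balance: a contractive system dissipates, so the energy of the states at level \<open>n\<close> plus that of the
  outputs before level \<open>n\<close> is at most the energy of the inputs before level \<open>n\<close>.
\<close>

lemma schur_class_if_contractive_realization:
  fixes X :: "'x::ab_group_add hilb" and S :: "('d::finite, 'u::ab_group_add \<Rightarrow> 'y::ab_group_add) series"
  assumes X: "hilbert_space X" and U: "hilbert_space U" and Y: "hilbert_space Y" and S: "op_series U Y S"
    and R: "contractive_realization X U Y S"
  shows "S \<in> schur_class U Y"
proof -
  interpret X: hilbert_space X by fact
  interpret U: hilbert_space U by fact
  interpret Y: hilbert_space Y by fact
  obtain A B C D where blocks: "bounded_blocks X U Y A B C D"
    and W: "contraction_op (X \<oplus>\<^sub>H U) (hpow X \<oplus>\<^sub>H Y) (block_op A B C D)"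
    and eq: "series_eq_on U S (transfer A B C D)"
    using R by (auto simp: contractive_realization_def)
  have A: "\<And>j. linear_op X X (A j)" and B: "\<And>j. linear_op U X (B j)"
    and C: "linear_op X Y C" and D: "linear_op U Y D"
    using blocks by (auto simp: bounded_blocks_def bounded_op_def)
  \<comment> \<open>One step of the system does not increase energy.\<close>
  have step: "(\<Sum>j\<in>UNIV. (hnorm X (A j x + B j u))\<^sup>2) + (hnorm Y (C x + D u))\<^sup>2 \<le> (hnorm X x)\<^sup>2 + (hnorm U u)\<^sup>2"
    if "x \<in> hcarrier X" "u \<in> hcarrier U" for x u
  proof -
    have m: "A j x + B j u \<in> hcarrier X" "C x + D u \<in> hcarrier Y" for j
      using that linear_opD(1)[OF A] linear_opD(1)[OF B] linear_opD(1)[OF C] linear_opD(1)[OF D]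
      by (auto simp: X.add_mem Y.add_mem)
    have row: "(\<lambda>j. A j x + B j u) \<in> hcarrier (hpow X)" using m by (simp add: hpow_def)
    have in_mem: "(x, u) \<in> hcarrier (X \<oplus>\<^sub>H U)" using that by (simp add: hsum_simps)
    have out_mem: "block_op A B C D (x, u) \<in> hcarrier (hpow X \<oplus>\<^sub>H Y)"
      using row m by (simp add: hsum_simps block_op_def)
    have "(hnorm (hpow X \<oplus>\<^sub>H Y) (block_op A B C D (x, u)))\<^sup>2 \<le> (hnorm (X \<oplus>\<^sub>H U) (x, u))\<^sup>2"
    proof (rule power_mono)
      show "hnorm (hpow X \<oplus>\<^sub>H Y) (block_op A B C D (x, u)) \<le> hnorm (X \<oplus>\<^sub>H U) (x, u)"
        using W in_mem unfolding contraction_op_def by blast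
      show "0 \<le> hnorm (hpow X \<oplus>\<^sub>H Y) (block_op A B C D (x, u))"
        using hilbert_space.norm_nonneg[OF hilbert_hsum[OF X.hilbert_l2 Y]] out_mem
        unfolding hpow_eq_l2 by blast
    qed
    moreover have "(hnorm (hpow X \<oplus>\<^sub>H Y) (block_op A B C D (x, u)))\<^sup>2 =
        (\<Sum>j\<in>UNIV. (hnorm X (A j x + B j u))\<^sup>2) + (hnorm Y (C x + D u))\<^sup>2"
      using row m unfolding hpow_eq_l2
      by (subst hsum_norm_sq[OF X.hilbert_l2 Y]) (auto simp: hsum_simps block_op_def X.l2_norm_sq)
    moreover have "(hnorm (X \<oplus>\<^sub>H U) (x, u))\<^sup>2 = (hnorm X x)\<^sup>2 + (hnorm U u)\<^sup>2"
      using hsum_norm_sq[OF X U in_mem] by simp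
    ultimately show ?thesis by simp
  qed
  have "series_app S f \<in> hcarrier (fock Y) \<and> hnorm (fock Y) (series_app S f) \<le> hnorm (fock U) f"
    if f: "f \<in> hcarrier (fock U)" for f
  proof -
    have fm: "\<And>\<alpha>. f \<alpha> \<in> hcarrier U" and fs: "(\<lambda>\<alpha>. (hnorm U (f \<alpha>))\<^sup>2) summable_on UNIV"
      using f by (auto simp: fock_eq_l2 l2_simps)
    define x where "x = sys_state A B f"
    have x: "x v \<in> hcarrier X" "series_app S f v = C (x v) + D (f v)" for v
      using transfer_app_eq_output[OF X Y blocks eq fm, where v = v] by (auto simp: x_def)
    have x_rec: "x [] = 0" "x (i # v) = A i (x v) + B i (f v)" for i v
      by (simp_all add: x_def)
    have short: "{v :: 'd list. length v < Suc n} = {v. length v < n} \<union> {v. length v = n}" for n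
      by auto
    have fin: "finite {v :: 'd list. length v < n}" for n
      by (induction n) (auto simp: short finite_words_length)
    have energy: "(\<Sum>v | length v = n. (hnorm X (x v))\<^sup>2) + (\<Sum>v | length v < n. (hnorm Y (series_app S f v))\<^sup>2)
        \<le> (\<Sum>v | length v < n. (hnorm U (f v))\<^sup>2)" for n
    proof (induction n)
      case (Suc n)
      have "(\<Sum>v | length v = Suc n. (hnorm X (x v))\<^sup>2) + (\<Sum>v | length v = n. (hnorm Y (series_app S f v))\<^sup>2)
          = (\<Sum>v | length v = n. (\<Sum>j\<in>UNIV. (hnorm X (A j (x v) + B j (f v)))\<^sup>2) + (hnorm Y (C (x v) + D (f v)))\<^sup>2)"
        by (simp add: sum_words_Suc x_rec x(2) sum.distrib)
      also have "\<dots> \<le> (\<Sum>v | length v = n. (hnorm X (x v))\<^sup>2 + (hnorm U (f v))\<^sup>2)"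
        by (intro sum_mono step x fm)
      finally have "(\<Sum>v | length v = Suc n. (hnorm X (x v))\<^sup>2) + (\<Sum>v | length v = n. (hnorm Y (series_app S f v))\<^sup>2)
          \<le> (\<Sum>v | length v = n. (hnorm X (x v))\<^sup>2) + (\<Sum>v | length v = n. (hnorm U (f v))\<^sup>2)"
        by (simp add: sum.distrib)
      moreover have split: "(\<Sum>v | length v < Suc n. h v) = (\<Sum>v | length v < n. h v) + (\<Sum>v | length v = n. h v)"
        for h :: "'d list \<Rightarrow> real"
        unfolding short by (rule sum.union_disjoint) (auto simp: fin finite_words_length)
      ultimately show ?case using Suc.IH unfolding split by linarith
    qed (simp add: x_rec X.norm_zero)
    have bound: "(\<Sum>v\<in>F. (hnorm Y (series_app S f v))\<^sup>2) \<le> (hnorm (fock U) f)\<^sup>2" if F: "finite F" for F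
    proof -
      define n where "n = Suc (Max (insert 0 (length ` F)))"
      have "F \<subseteq> {v. length v < n}" using F by (auto simp: n_def less_Suc_eq_le)
      then have "(\<Sum>v\<in>F. (hnorm Y (series_app S f v))\<^sup>2) \<le> (\<Sum>v | length v < n. (hnorm Y (series_app S f v))\<^sup>2)"
        by (intro sum_mono2 fin) auto
      also have "\<dots> \<le> (\<Sum>v | length v < n. (hnorm U (f v))\<^sup>2)"
        using energy[of n] sum_nonneg[of "{v. length v = n}" "\<lambda>v. (hnorm X (x v))\<^sup>2"] by simp
      also have "\<dots> \<le> (hnorm (fock U) f)\<^sup>2"
        unfolding fock_eq_l2 U.l2_norm_sq[OF f[unfolded fock_eq_l2]]
        by (intro finite_sum_le_infsum fs fin) auto
      finally show ?thesis .
    qed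
    have sm: "series_app S f \<in> hcarrier (l2 Y)"
      unfolding l2_simps
      by (intro conjI allI series_app_mem[OF Y S fm] nonneg_bdd_above_summable_on)
         (use bound in \<open>auto intro!: bdd_aboveI[of _ "(hnorm (fock U) f)\<^sup>2"]\<close>)
    have "(hnorm (l2 Y) (series_app S f))\<^sup>2 \<le> (hnorm (fock U) f)\<^sup>2"
      unfolding Y.l2_norm_sq[OF sm] using sm bound by (intro infsum_le_finite_sums) (auto simp: l2_simps)
    then have "hnorm (l2 Y) (series_app S f) \<le> hnorm (fock U) f"
      by (rule power2_le_imp_le) (use U.l2_norm_nonneg f in \<open>simp add: fock_eq_l2\<close>)
    then show ?thesis using sm by (simp add: fock_eq_l2)
  qed
  then have M: "contraction_op (fock U) (fock Y) (series_app S)"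
    by (intro contraction_series_app U Y S)
  show ?thesis unfolding schur_class_def using S M by auto
qed

section \<open>Positivity of the kernel\<close>

lemma polysD:
  assumes "p \<in> polys U"
  shows "p \<alpha> \<in> hcarrier U" "finite {\<alpha>. p \<alpha> \<noteq> 0}"
  using assms by (auto simp: polys_def)

lemma (in hilbert_space)
  assumes p: "p \<in> polys H"
  shows polys_fock: "p \<in> hcarrier (fock H)"
    and inner_poly: "\<And>f. (\<And>\<alpha>. f \<alpha> \<in> hcarrier H) \<Longrightarrow>
      hinner (fock H) p f = (\<Sum>\<alpha> | p \<alpha> \<noteq> 0. hinner H (p \<alpha>) (f \<alpha>))"
proof -
  have "(\<lambda>\<alpha>. (hnorm H (p \<alpha>))\<^sup>2) summable_on UNIV \<longleftrightarrow> (\<lambda>\<alpha>. (hnorm H (p \<alpha>))\<^sup>2) summable_on {\<alpha>. p \<alpha> \<noteq> 0}"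
    by (rule summable_on_cong_neutral) (auto simp: norm_zero)
  then show "p \<in> hcarrier (fock H)"
    using polysD[OF p] by (simp add: fock_eq_l2 l2_simps)
  fix f :: "('b, 'a) series" assume f: "\<And>\<alpha>. f \<alpha> \<in> hcarrier H"
  have "hinner (fock H) p f = (\<Sum>\<^sub>\<infinity>\<alpha>\<in>{\<alpha>. p \<alpha> \<noteq> 0}. hinner H (p \<alpha>) (f \<alpha>))"
    unfolding fock_eq_l2 l2_simps by (rule infsum_cong_neutral) (auto simp: inner_zero_left f)
  then show "hinner (fock H) p f = (\<Sum>\<alpha> | p \<alpha> \<noteq> 0. hinner H (p \<alpha>) (f \<alpha>))"
    using polysD[OF p] by simp
qed

definition monomial :: "'d list \<Rightarrow> 'u::zero \<Rightarrow> ('d, 'u) series" where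
  "monomial w u v = (if v = w then u else 0)"

lemma (in hilbert_space) monomial_fock:
  assumes "u \<in> hcarrier H"
  shows "monomial w u \<in> polys H"
    and "monomial w u \<in> hcarrier (fock H)"
    and "(\<And>\<alpha>. f \<alpha> \<in> hcarrier H) \<Longrightarrow> hinner (fock H) (monomial w u) f = hinner H u (f w)"
proof -
  show p: "monomial w u \<in> polys H" for w :: "'b list"
    using assms by (auto simp: monomial_def polys_def zero_mem)
  show "monomial w u \<in> hcarrier (fock H)" by (rule polys_fock[OF p])
  assume f: "\<And>\<alpha>. f \<alpha> \<in> hcarrier H"
  show "hinner (fock H) (monomial w u) f = hinner H u (f w)"
  proof (cases "u = 0")
    case True
    then show ?thesis using f inner_poly[OF p f, of w] by (simp add: monomial_def inner_zero_left)
  next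
    case False
    then have "{\<beta>. monomial w u \<beta> \<noteq> 0} = {w}" by (auto simp: monomial_def)
    then show ?thesis using inner_poly[OF p f, of w] by (simp add: monomial_def)
  qed
qed

text \<open>
  The formal adjoint of multiplication by \<^term>\<open>S\<close>, with coefficients \<open>\<Sum>\<beta>. S\<^sub>\<beta>\<^sup>* y\<^sub>\<beta>\<^sub>\<gamma>\<close>.  It maps polynomials to polynomials
  for every \<^term>\<open>S\<close>, because a word has finitely many tails; summing over the support keeps the sum finite.
\<close>

definition adj_app :: "'u::ab_group_add hilb \<Rightarrow> 'y::ab_group_add hilb \<Rightarrow> ('d, 'u \<Rightarrow> 'y) series \<Rightarrow>
    ('d, 'y) series \<Rightarrow> ('d, 'u) series" where
  "adj_app U Y S y \<gamma> = (\<Sum>\<beta> | y (\<beta> @ \<gamma>) \<noteq> 0. adjoint_op U Y (S \<beta>) (y (\<beta> @ \<gamma>)))"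

lemma finite_factorisations: "finite F \<Longrightarrow> finite {(\<beta>, \<gamma>). \<beta> @ \<gamma> \<in> F}"
proof -
  assume "finite F"
  moreover have "{(\<beta>, \<gamma>). \<beta> @ \<gamma> \<in> F} = (\<Union>v\<in>F. {(\<beta>, \<gamma>). \<beta> @ \<gamma> = v})" by auto
  ultimately show ?thesis using finite_splits by auto
qed

lemma sum_factorisations_by_product:
  assumes "finite F"
  shows "(\<Sum>v\<in>F. \<Sum>(\<beta>, \<gamma>) | \<beta> @ \<gamma> = v. h \<beta> \<gamma>) = (\<Sum>(\<beta>, \<gamma>) | \<beta> @ \<gamma> \<in> F. (h \<beta> \<gamma> :: 'a::comm_monoid_add))"
proof -
  let ?P = "{(\<beta>, \<gamma>). \<beta> @ \<gamma> \<in> F}"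
  have "(\<Sum>(\<beta>, \<gamma>) | \<beta> @ \<gamma> \<in> F. h \<beta> \<gamma>) =
      (\<Sum>v\<in>F. \<Sum>(\<beta>, \<gamma>)\<in>{p \<in> ?P. fst p @ snd p = v}. h \<beta> \<gamma>)"
    by (rule sum.group[symmetric]) (use assms finite_factorisations in auto)
  also have "\<dots> = (\<Sum>v\<in>F. \<Sum>(\<beta>, \<gamma>) | \<beta> @ \<gamma> = v. h \<beta> \<gamma>)"
    by (intro sum.cong) auto
  finally show ?thesis by simp
qed

lemma sum_factorisations_by_tail:
  assumes "finite F"
  shows "(\<Sum>(\<beta>, \<gamma>) | \<beta> @ \<gamma> \<in> F. h \<beta> \<gamma>) =
    (\<Sum>\<gamma>\<in>{\<gamma>. \<exists>\<beta>. \<beta> @ \<gamma> \<in> F}. \<Sum>\<beta> | \<beta> @ \<gamma> \<in> F. (h \<beta> \<gamma> :: 'a::comm_monoid_add))"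
proof -
  let ?P = "{(\<beta>, \<gamma>). \<beta> @ \<gamma> \<in> F}"
  have E: "{\<gamma>. \<exists>\<beta>. \<beta> @ \<gamma> \<in> F} = snd ` ?P" by force
  have "(\<Sum>(\<beta>, \<gamma>) | \<beta> @ \<gamma> \<in> F. h \<beta> \<gamma>) =
      (\<Sum>\<gamma>\<in>snd ` ?P. \<Sum>(\<beta>, \<gamma>)\<in>{p \<in> ?P. snd p = \<gamma>}. h \<beta> \<gamma>)"
    by (rule sum.group[symmetric]) (use finite_factorisations[OF assms] in auto)
  also have "\<dots> = (\<Sum>\<gamma>\<in>snd ` ?P. \<Sum>\<beta> | \<beta> @ \<gamma> \<in> F. h \<beta> \<gamma>)"
  proof (rule sum.cong[OF refl])
    fix \<gamma>
    have "{p \<in> ?P. snd p = \<gamma>} = (\<lambda>\<beta>. (\<beta>, \<gamma>)) ` {\<beta>. \<beta> @ \<gamma> \<in> F}" by auto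
    then show "(\<Sum>(\<beta>, \<gamma>)\<in>{p \<in> ?P. snd p = \<gamma>}. h \<beta> \<gamma>) = (\<Sum>\<beta> | \<beta> @ \<gamma> \<in> F. h \<beta> \<gamma>)"
      by (simp add: sum.reindex inj_on_def)
  qed
  finally show ?thesis by (simp add: E)
qed

lemma finite_tails: "finite F \<Longrightarrow> finite {\<gamma>. \<exists>\<beta>. \<beta> @ \<gamma> \<in> F}"
  using finite_imageI[OF finite_factorisations, of F snd] by (rule finite_subset[rotated]) force+

lemma adj_app_polys:
  assumes U: "hilbert_space U" and Y: "hilbert_space Y" and S: "op_series U Y S" and y: "y \<in> polys Y"
  shows "adj_app U Y S y \<in> polys U"
proof -
  interpret U: hilbert_space U by fact
  have "{\<gamma>. adj_app U Y S y \<gamma> \<noteq> 0} \<subseteq> {\<gamma>. \<exists>\<beta>. \<beta> @ \<gamma> \<in> {\<alpha>. y \<alpha> \<noteq> 0}}"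
    by (auto simp: adj_app_def intro: ccontr)
  then show ?thesis
    using finite_tails[OF polysD(2)[OF y]] adjoint_op_mem[OF U Y] S polysD(1)[OF y]
    by (auto simp: polys_def adj_app_def op_series_def intro!: U.sum_mem intro: finite_subset)
qed

text \<open>
  Both sides sum \<open>\<langle>y\<^sub>\<beta>\<^sub>\<gamma>, S\<^sub>\<beta> f\<^sub>\<gamma>\<rangle>\<close> over all factorised words \<open>\<beta>\<gamma>\<close> in the support of \<open>y\<close>, grouped by the word on
  one side and by the tail \<open>\<gamma>\<close> on the other.
\<close>

lemma adj_app_duality:
  assumes U: "hilbert_space U" and Y: "hilbert_space Y" and S: "op_series U Y S" and y: "y \<in> polys Y"
    and f: "\<And>\<alpha>. f \<alpha> \<in> hcarrier U"
  shows "hinner (fock U) (adj_app U Y S y) f = hinner (fock Y) y (series_app S f)"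
proof -
  interpret U: hilbert_space U by fact
  interpret Y: hilbert_space Y by fact
  let ?F = "{\<alpha>. y \<alpha> \<noteq> 0}"
  have F: "finite ?F" and ym: "\<And>\<alpha>. y \<alpha> \<in> hcarrier Y" using polysD[OF y] by auto
  have S': "\<And>\<alpha>. bounded_op U Y (S \<alpha>)" using S by (simp add: op_series_def)
  note am = adjoint_op_mem[OF U Y S'] and Sm = linear_opD(1)[OF bounded_op_linear[OF S']]
  have "hinner (fock Y) y (series_app S f) = (\<Sum>\<alpha>\<in>?F. hinner Y (y \<alpha>) (series_app S f \<alpha>))"
    by (rule Y.inner_poly[OF y]) (rule series_app_mem[OF Y S f])
  also have "\<dots> = (\<Sum>\<alpha>\<in>?F. \<Sum>(\<beta>, \<gamma>) | \<beta> @ \<gamma> = \<alpha>. hinner Y (y (\<beta> @ \<gamma>)) (S \<beta> (f \<gamma>)))"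
    unfolding series_app_def case_prod_unfold
    by (intro sum.cong refl) (auto simp: Y.inner_sum_right Sm f ym)
  also have "\<dots> = (\<Sum>(\<beta>, \<gamma>) | \<beta> @ \<gamma> \<in> ?F. hinner Y (y (\<beta> @ \<gamma>)) (S \<beta> (f \<gamma>)))"
    by (rule sum_factorisations_by_product[OF F])
  also have "\<dots> = (\<Sum>(\<beta>, \<gamma>) | \<beta> @ \<gamma> \<in> ?F. hinner U (adjoint_op U Y (S \<beta>) (y (\<beta> @ \<gamma>))) (f \<gamma>))"
    by (intro sum.cong refl) (auto simp: adjoint_op_inner'[OF U Y S' f ym])
  also have "\<dots> = (\<Sum>\<gamma>\<in>{\<gamma>. \<exists>\<beta>. \<beta> @ \<gamma> \<in> ?F}. \<Sum>\<beta> | \<beta> @ \<gamma> \<in> ?F. hinner U (adjoint_op U Y (S \<beta>) (y (\<beta> @ \<gamma>))) (f \<gamma>))"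
    by (rule sum_factorisations_by_tail[OF F])
  also have "\<dots> = (\<Sum>\<gamma>\<in>{\<gamma>. \<exists>\<beta>. \<beta> @ \<gamma> \<in> ?F}. hinner U (adj_app U Y S y \<gamma>) (f \<gamma>))"
    unfolding adj_app_def by (intro sum.cong refl) (simp add: U.inner_sum_left am ym f)
  also have "\<dots> = (\<Sum>\<gamma> | adj_app U Y S y \<gamma> \<noteq> 0. hinner U (adj_app U Y S y \<gamma>) (f \<gamma>))"
    by (rule sum.mono_neutral_right[OF finite_tails[OF F]])
       (auto simp: U.inner_zero_left f, auto simp: adj_app_def intro: ccontr)
  also have "\<dots> = hinner (fock U) (adj_app U Y S y) f"
    by (rule U.inner_poly[OF adj_app_polys[OF U Y S y], symmetric]) (rule f)
  finally show ?thesis by simp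
qed

text \<open>
  The functional \<open>y \<mapsto> \<langle>y, S f\<rangle>\<close> on polynomials is bounded by \<open>\<parallel>f\<parallel>\<close> through the adjoint, so it is represented by an
  element of the Fock space; testing against monomials shows that this element is \<open>S f\<close>.
\<close>

lemma series_app_contraction_if_adjoint_bound:
  fixes S :: "('d::finite, 'u::ab_group_add \<Rightarrow> 'y::ab_group_add) series"
  assumes U: "hilbert_space U" and Y: "hilbert_space Y" and S: "op_series U Y S"
    and bound: "\<And>y. y \<in> polys Y \<Longrightarrow> hnorm (fock U) (adj_app U Y S y) \<le> hnorm (fock Y) y"
  shows "contraction_op (fock U) (fock Y) (series_app S)"
proof (rule contraction_series_app[OF U Y S])
  interpret U: hilbert_space U by fact
  interpret Y: hilbert_space Y by fact
  interpret FU: hilbert_space "fock U :: ('d list \<Rightarrow> 'u) hilb" unfolding fock_eq_l2 by (rule U.hilbert_l2)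
  interpret FY: hilbert_space "fock Y :: ('d list \<Rightarrow> 'y) hilb" unfolding fock_eq_l2 by (rule Y.hilbert_l2)
  fix f :: "('d, 'u) series" assume f: "f \<in> hcarrier (fock U)"
  have fm: "\<And>\<alpha>. f \<alpha> \<in> hcarrier U" using f by (auto simp: fock_eq_l2 l2_simps)
  define g where "g = series_app S f"
  have gm: "g \<alpha> \<in> hcarrier Y" for \<alpha> unfolding g_def by (rule series_app_mem[OF Y S fm])
  have poly_inner: "hinner (fock Y) y g = (\<Sum>\<alpha>\<in>F. hinner Y (y \<alpha>) (g \<alpha>))"
    if "y \<in> polys Y" "finite F" "{\<alpha>. y \<alpha> \<noteq> 0} \<subseteq> F" for y F
    unfolding Y.inner_poly[OF that(1) gm]
    by (rule sum.mono_neutral_left) (use that gm in \<open>auto simp: Y.inner_zero_left\<close>)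
  \<comment> \<open>\<open>g\<close> is not known to be in the Fock space yet; its inner products with polynomials are finite sums.\<close>
  have "\<exists>k\<in>hcarrier (ocomp (fock Y) (hcarrier (ocomp (fock Y) (polys Y)))).
      (\<forall>y\<in>polys Y. hinner (fock Y) y g = hinner (fock Y) y k) \<and> hnorm (fock Y) k \<le> hnorm (fock U) f"
  proof (rule FY.riesz_on_subspace)
    show "polys Y \<subseteq> hcarrier (fock Y)" using Y.polys_fock by blast
    show "0 \<in> polys Y" by (simp add: polys_def Y.zero_mem)
    have supp_add: "{\<alpha>. (x + y) \<alpha> \<noteq> 0} \<subseteq> {\<alpha>. x \<alpha> \<noteq> 0} \<union> {\<alpha>. y \<alpha> \<noteq> 0}" for x y :: "('d, 'y) series"
      by auto
    have supp_scale: "{\<alpha>. hscale (fock Y) c x \<alpha> \<noteq> 0} \<subseteq> {\<alpha>. x \<alpha> \<noteq> 0}" for x :: "('d, 'y) series" and c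
      by (auto simp: fock_eq_l2 l2_simps Y.scale_zero_right)
    show add: "x + y \<in> polys Y" if "x \<in> polys Y" "y \<in> polys Y" for x y :: "('d, 'y) series"
      using polysD[OF that(1)] polysD[OF that(2)] supp_add[of x y]
      by (auto simp: polys_def Y.add_mem intro: finite_subset)
    show scale: "hscale (fock Y) c x \<in> polys Y" if "x \<in> polys Y" for x :: "('d, 'y) series" and c
      using polysD[OF that] finite_subset[OF supp_scale[of c x]]
      by (auto simp: polys_def fock_eq_l2 l2_simps Y.scale_mem)
    show "hinner (fock Y) (x + y) g = hinner (fock Y) x g + hinner (fock Y) y g"
      if "x \<in> polys Y" "y \<in> polys Y" for x y
    proof -
      let ?F = "{\<alpha>. x \<alpha> \<noteq> 0} \<union> {\<alpha>. y \<alpha> \<noteq> 0}"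
      have F: "finite ?F" using polysD that by blast
      have "hinner (fock Y) (x + y) g = (\<Sum>\<alpha>\<in>?F. hinner Y ((x + y) \<alpha>) (g \<alpha>))"
        by (rule poly_inner[OF add[OF that] F supp_add])
      then show ?thesis
        using poly_inner[OF that(1) F] poly_inner[OF that(2) F]
          polysD(1)[OF that(1)] polysD(1)[OF that(2)] gm by (simp add: Y.inner_add_left sum.distrib)
    qed
    show "hinner (fock Y) (hscale (fock Y) c x) g = c * hinner (fock Y) x g" if "x \<in> polys Y" for x c
      using poly_inner[OF scale[OF that] polysD(2)[OF that] supp_scale] poly_inner[OF that polysD(2)[OF that]]
        polysD(1)[OF that] gm by (simp add: fock_eq_l2 l2_simps Y.inner_scale_left sum_distrib_left)
    show "cmod (hinner (fock Y) y g) \<le> hnorm (fock U) f * hnorm (fock Y) y" if "y \<in> polys Y" for y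
    proof -
      have "cmod (hinner (fock Y) y g) \<le> hnorm (fock U) (adj_app U Y S y) * hnorm (fock U) f"
        unfolding g_def adj_app_duality[OF U Y S that fm, symmetric]
        by (rule FU.cauchy_schwarz) (use f U.polys_fock adj_app_polys[OF U Y S that] in auto)
      also have "\<dots> \<le> hnorm (fock Y) y * hnorm (fock U) f"
        by (rule mult_right_mono) (use bound that FU.norm_nonneg f in auto)
      finally show ?thesis by (simp add: mult.commute)
    qed
  qed (rule FU.norm_nonneg[OF f])
  then obtain k where k: "k \<in> hcarrier (fock Y)" "\<And>y. y \<in> polys Y \<Longrightarrow> hinner (fock Y) y g = hinner (fock Y) y k"
    "hnorm (fock Y) k \<le> hnorm (fock U) f" by auto
  have km: "k \<alpha> \<in> hcarrier Y" for \<alpha> using k(1) by (auto simp: fock_eq_l2 l2_simps)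
  have "g = k"
  proof
    fix \<alpha>
    show "g \<alpha> = k \<alpha>"
    proof (rule Y.inner_all_eq[OF gm km])
      fix z assume z: "z \<in> hcarrier Y"
      have "hinner Y z (g \<alpha>) = hinner (fock Y) (monomial \<alpha> z) g"
        by (rule Y.monomial_fock(3)[OF z gm, symmetric])
      also have "\<dots> = hinner (fock Y) (monomial \<alpha> z) k" by (rule k(2)[OF Y.monomial_fock(1)[OF z]])
      also have "\<dots> = hinner Y z (k \<alpha>)" by (rule Y.monomial_fock(3)[OF z km])
      finally have "hinner Y z (g \<alpha>) = hinner Y z (k \<alpha>)" .
      then show "hinner Y (g \<alpha>) z = hinner Y (k \<alpha>) z"
        using Y.inner_commute[OF z gm] Y.inner_commute[OF z km] by simp
    qed
  qed
  then show "series_app S f \<in> hcarrier (fock Y) \<and> hnorm (fock Y) (series_app S f) \<le> hnorm (fock U) f"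
    using k by (simp add: g_def)
qed

text \<open>
  The series \<open>q = S\<^sup>* y\<close> is a polynomial, so contractivity applies to it: \<open>\<parallel>q\<parallel>\<^sup>2 = \<langle>y, S q\<rangle> \<le> \<parallel>y\<parallel> \<parallel>q\<parallel>\<close>.
\<close>

lemma adjoint_bound_if_schur_class:
  fixes S :: "('d::finite, 'u::ab_group_add \<Rightarrow> 'y::ab_group_add) series"
  assumes U: "hilbert_space U" and Y: "hilbert_space Y" and S: "S \<in> schur_class U Y" and y: "y \<in> polys Y"
  shows "hnorm (fock U) (adj_app U Y S y) \<le> hnorm (fock Y) y"
proof -
  interpret U: hilbert_space U by fact
  interpret Y: hilbert_space Y by fact
  interpret FU: hilbert_space "fock U :: ('d list \<Rightarrow> 'u) hilb" unfolding fock_eq_l2 by (rule U.hilbert_l2)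
  interpret FY: hilbert_space "fock Y :: ('d list \<Rightarrow> 'y) hilb" unfolding fock_eq_l2 by (rule Y.hilbert_l2)
  obtain M where S': "op_series U Y S" and M: "contraction_op (fock U) (fock Y) M"
    and MS: "\<And>p. p \<in> polys U \<Longrightarrow> M p = series_app S p"
    using S by (auto simp: schur_class_def)
  define q where "q = adj_app U Y S y"
  have q: "q \<in> polys U" unfolding q_def by (rule adj_app_polys[OF U Y S' y])
  have qm: "q \<in> hcarrier (fock U)" by (rule U.polys_fock[OF q])
  have ym: "y \<in> hcarrier (fock Y)" by (rule Y.polys_fock[OF y])
  have "hinner (fock U) q q = hinner (fock Y) y (M q)"
    unfolding MS[OF q] using adj_app_duality[OF U Y S' y, of q] polysD(1)[OF q] by (simp add: q_def)
  then have "(hnorm (fock U) q)\<^sup>2 = Re (hinner (fock Y) y (M q))"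
    by (simp add: FU.norm_sq[OF qm])
  also have "\<dots> \<le> cmod (hinner (fock Y) y (M q))" by (rule complex_Re_le_cmod)
  also have "\<dots> \<le> hnorm (fock Y) y * hnorm (fock Y) (M q)"
    by (rule FY.cauchy_schwarz[OF ym]) (use M qm in \<open>auto simp: contraction_op_def linear_op_def\<close>)
  also have "\<dots> \<le> hnorm (fock Y) y * hnorm (fock U) q"
    by (rule mult_left_mono) (use M qm FY.norm_nonneg[OF ym] in \<open>auto simp: contraction_op_def\<close>)
  finally show ?thesis
    using FU.norm_nonneg[OF qm] FY.norm_nonneg[OF ym] unfolding q_def[symmetric]
    by (cases "hnorm (fock U) q = 0") (auto simp: power2_eq_square)
qed

text \<open>
  The coefficient of \<open>z\<^sup>\<alpha> w\<close> to the transpose of \<open>\<alpha>'\<close> collects \<open>S\<^sub>\<beta> S\<^sub>\<beta>\<^sub>'\<^sup>*\<close> over the common tails \<open>\<gamma>\<close> with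
  \<open>\<alpha> = \<beta>\<gamma>\<close> and \<open>\<alpha>' = \<beta>'\<gamma>\<close>.
\<close>

lemma kernel_S_coefficient:
  fixes S :: "('d, 'u::ab_group_add \<Rightarrow> 'y::ab_group_add) series"
  assumes U: "hilbert_space U" and Y: "hilbert_space Y" and S: "op_series U Y S"
  shows "kernel_S U Y S \<alpha> (rev \<alpha>') y = (if \<alpha>' = \<alpha> then y else 0) -
    (\<Sum>(\<beta>, \<gamma>) | \<beta> @ \<gamma> = \<alpha>. \<Sum>(\<beta>', \<gamma>') | \<beta>' @ \<gamma>' = \<alpha>'.
      if \<gamma>' = \<gamma> then S \<beta> (adjoint_op U Y (S \<beta>') y) else 0)"
proof -
  have S0: "S \<beta> 0 = 0" for \<beta>
    using S linear_op_zero[OF U] by (auto simp: op_series_def bounded_op_def)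
  have fun_sum: "(\<Sum>i\<in>I. g i) x = (\<Sum>i\<in>I. g i x)" for g :: "'i \<Rightarrow> 'p \<Rightarrow> 'q::ab_group_add" and I x
    by (induction I rule: infinite_finite_induct) auto
  have inner: "(series_z S \<star> szego) v u x = (\<Sum>(\<beta>, \<gamma>) | \<beta> @ \<gamma> = v. if u = rev \<gamma> then S \<beta> x else 0)" for v u x
  proof -
    have "(\<Sum>(\<beta>, \<beta>') | \<beta> @ \<beta>' = u. series_z S a \<beta> \<circ> szego a' \<beta>') x = (if u = rev a' then S a x else 0)" for a a'
    proof -
      have "(\<Sum>(\<beta>, \<beta>') | \<beta> @ \<beta>' = u. series_z S a \<beta> \<circ> szego a' \<beta>') x =
          (\<Sum>(\<beta>, \<beta>') | \<beta> @ \<beta>' = u. if \<beta> = [] then (if \<beta>' = rev a' then S a x else 0) else 0)"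
        unfolding fun_sum case_prod_unfold
        by (intro sum.cong refl) (auto simp: series_z_def szego_def S0)
      then show ?thesis unfolding sum_splits_head .
    qed
    then show ?thesis unfolding series2_mult_def fun_sum case_prod_unfold by simp
  qed
  let ?P = "series_z S \<star> szego"
  have P0: "?P a c 0 = 0" for a c
    unfolding inner by (rule sum.neutral) (auto simp: S0)
  have tail: "(\<Sum>(\<alpha>, \<beta>) | \<alpha> @ \<beta> = v. if \<beta> = [] then h \<alpha> else (0 :: 'y)) = h (v :: 'd list)" for h v
  proof -
    have "(\<Sum>(\<alpha>, \<beta>) | \<alpha> @ \<beta> = v. if \<beta> = [] then h \<alpha> else 0) =
        (\<Sum>(\<alpha>, \<beta>) \<in> {(v, [] :: 'd list)}. if \<beta> = [] then h \<alpha> else 0)"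
      by (rule sum.mono_neutral_right[OF finite_splits]) (auto split: if_splits)
    then show ?thesis by simp
  qed
  have "(?P \<star> series_w_adj U Y S) \<alpha> (rev \<alpha>') y =
      (\<Sum>(a, a') | a @ a' = \<alpha>. if a' = [] then
        (\<Sum>(c, c') | c @ c' = rev \<alpha>'. ?P a c (adjoint_op U Y (S (rev c')) y)) else 0)"
    unfolding series2_mult_def[of ?P] fun_sum case_prod_unfold
    by (intro sum.cong refl) (auto simp: series_w_adj_def P0 fun_sum)
  also have "\<dots> = (\<Sum>(c, c') | c @ c' = rev \<alpha>'. ?P \<alpha> c (adjoint_op U Y (S (rev c')) y))"
    by (rule tail)
  also have "\<dots> = (\<Sum>(\<beta>', \<gamma>') | \<beta>' @ \<gamma>' = \<alpha>'. ?P \<alpha> (rev \<gamma>') (adjoint_op U Y (S \<beta>') y))"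
    by (rule sum.reindex_bij_witness[of _ "\<lambda>(\<beta>', \<gamma>'). (rev \<gamma>', rev \<beta>')" "\<lambda>(c, c'). (rev c', rev c)"])
       (auto simp flip: rev_append)
  also have "\<dots> = (\<Sum>(\<beta>', \<gamma>') | \<beta>' @ \<gamma>' = \<alpha>'. \<Sum>(\<beta>, \<gamma>) | \<beta> @ \<gamma> = \<alpha>.
      if \<gamma>' = \<gamma> then S \<beta> (adjoint_op U Y (S \<beta>') y) else 0)"
    unfolding inner by simp
  also have "\<dots> = (\<Sum>(\<beta>, \<gamma>) | \<beta> @ \<gamma> = \<alpha>. \<Sum>(\<beta>', \<gamma>') | \<beta>' @ \<gamma>' = \<alpha>'.
      if \<gamma>' = \<gamma> then S \<beta> (adjoint_op U Y (S \<beta>') y) else 0)"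
    unfolding case_prod_unfold by (rule sum.swap)
  finally show ?thesis
    by (simp add: kernel_S_def szego_def)
qed

text \<open>
  The kernel \<open>K\<^sub>S\<close> is the matrix of \<open>I - M\<^sub>S M\<^sub>S\<^sup>*\<close> with respect to monomials.
\<close>

lemma kernel_form_eq:
  assumes U: "hilbert_space U" and Y: "hilbert_space Y" and S: "op_series U Y S" and y: "y \<in> polys Y"
  shows "(\<Sum>\<alpha> | y \<alpha> \<noteq> 0. \<Sum>\<alpha>' | y \<alpha>' \<noteq> 0. hinner Y (kernel_S U Y S \<alpha> (rev \<alpha>') (y \<alpha>')) (y \<alpha>)) =
    of_real ((hnorm (fock Y) y)\<^sup>2 - (hnorm (fock U) (adj_app U Y S y))\<^sup>2)"
proof -
  interpret U: hilbert_space U by fact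
  interpret Y: hilbert_space Y by fact
  interpret FU: hilbert_space "fock U :: ('c list \<Rightarrow> 'a) hilb" unfolding fock_eq_l2 by (rule U.hilbert_l2)
  interpret FY: hilbert_space "fock Y :: ('c list \<Rightarrow> 'b) hilb" unfolding fock_eq_l2 by (rule Y.hilbert_l2)
  let ?F = "{\<alpha>. y \<alpha> \<noteq> 0}"
  have F: "finite ?F" and ym: "\<And>\<alpha>. y \<alpha> \<in> hcarrier Y" using polysD[OF y] by auto
  have S': "\<And>\<alpha>. bounded_op U Y (S \<alpha>)" using S by (simp add: op_series_def)
  note am = adjoint_op_mem[OF U Y S'] and Sm = linear_opD(1)[OF bounded_op_linear[OF S']]
  define q where "q = adj_app U Y S y"
  have q: "q \<in> polys U" unfolding q_def by (rule adj_app_polys[OF U Y S y])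
  have qm: "\<And>\<gamma>. q \<gamma> \<in> hcarrier U" using polysD(1)[OF q] .
  define g where "g \<alpha> = (\<Sum>(\<beta>, \<gamma>) | \<beta> @ \<gamma> = \<alpha>. S \<beta> (q \<gamma>))" for \<alpha>
  have inner_sum: "(\<Sum>\<alpha>'\<in>?F. \<Sum>(\<beta>', \<gamma>') | \<beta>' @ \<gamma>' = \<alpha>'. if \<gamma>' = \<gamma> then S \<beta> (adjoint_op U Y (S \<beta>') (y \<alpha>')) else 0)
      = S \<beta> (q \<gamma>)" for \<beta> \<gamma>
  proof -
    have "(\<Sum>\<alpha>'\<in>?F. \<Sum>(\<beta>', \<gamma>') | \<beta>' @ \<gamma>' = \<alpha>'. if \<gamma>' = \<gamma> then S \<beta> (adjoint_op U Y (S \<beta>') (y \<alpha>')) else 0)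
        = (\<Sum>\<alpha>'\<in>?F. \<Sum>(\<beta>', \<gamma>') | \<beta>' @ \<gamma>' = \<alpha>'. if \<gamma>' = \<gamma> then S \<beta> (adjoint_op U Y (S \<beta>') (y (\<beta>' @ \<gamma>'))) else 0)"
      by (intro sum.cong refl) auto
    also have "\<dots> = (\<Sum>(\<beta>', \<gamma>') | \<beta>' @ \<gamma>' \<in> ?F. if \<gamma>' = \<gamma> then S \<beta> (adjoint_op U Y (S \<beta>') (y (\<beta>' @ \<gamma>'))) else 0)"
      by (rule sum_factorisations_by_product[OF F])
    also have "\<dots> = (\<Sum>(\<beta>', \<gamma>') \<in> (\<lambda>\<beta>'. (\<beta>', \<gamma>)) ` {\<beta>'. \<beta>' @ \<gamma> \<in> ?F}. S \<beta> (adjoint_op U Y (S \<beta>') (y (\<beta>' @ \<gamma>'))))"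
      by (rule sum.mono_neutral_cong_right[OF finite_factorisations[OF F]]) (auto split: if_splits)
    also have "\<dots> = (\<Sum>\<beta>' | \<beta>' @ \<gamma> \<in> ?F. S \<beta> (adjoint_op U Y (S \<beta>') (y (\<beta>' @ \<gamma>))))"
      by (simp add: sum.reindex inj_on_def)
    also have "\<dots> = S \<beta> (q \<gamma>)"
      unfolding q_def adj_app_def
      by (subst linear_op_sum[OF U bounded_op_linear[OF S']]) (auto simp: am ym)
    finally show ?thesis .
  qed
  have row: "(\<Sum>\<alpha>'\<in>?F. kernel_S U Y S \<alpha> (rev \<alpha>') (y \<alpha>')) = y \<alpha> - g \<alpha>" if "\<alpha> \<in> ?F" for \<alpha>
  proof -
    have "(\<Sum>\<alpha>'\<in>?F. \<Sum>(\<beta>, \<gamma>) | \<beta> @ \<gamma> = \<alpha>. \<Sum>(\<beta>', \<gamma>') | \<beta>' @ \<gamma>' = \<alpha>'.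
      if \<gamma>' = \<gamma> then S \<beta> (adjoint_op U Y (S \<beta>') (y \<alpha>')) else 0) = g \<alpha>"
      unfolding g_def inner_sum[symmetric] case_prod_unfold by (rule sum.swap)
    moreover have "(\<Sum>\<alpha>'\<in>?F. if \<alpha>' = \<alpha> then y \<alpha>' else 0) = y \<alpha>"
      using F that by (simp add: sum.delta)
    ultimately show ?thesis
      unfolding kernel_S_coefficient[OF U Y S] by (simp add: sum_subtractf)
  qed
  have gm: "g \<alpha> \<in> hcarrier Y" for \<alpha>
    unfolding g_def by (intro Y.sum_mem) (auto simp: Sm qm)
  have kern_mem: "kernel_S U Y S \<alpha> (rev \<alpha>') (y \<alpha>') \<in> hcarrier Y" for \<alpha> \<alpha>'
    unfolding kernel_S_coefficient[OF U Y S]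
    by (intro Y.diff_mem Y.sum_mem) (auto intro!: Y.sum_mem simp: Y.zero_mem ym Sm am)
  have "(\<Sum>\<alpha>\<in>?F. \<Sum>\<alpha>'\<in>?F. hinner Y (kernel_S U Y S \<alpha> (rev \<alpha>') (y \<alpha>')) (y \<alpha>)) =
      (\<Sum>\<alpha>\<in>?F. hinner Y (y \<alpha> - g \<alpha>) (y \<alpha>))"
    by (intro sum.cong refl, subst Y.inner_sum_left[symmetric]) (auto simp: kern_mem ym row)
  also have "\<dots> = (\<Sum>\<alpha>\<in>?F. hinner Y (y \<alpha>) (y \<alpha>)) - (\<Sum>\<alpha>\<in>?F. cnj (hinner Y (y \<alpha>) (g \<alpha>)))"
    by (simp add: Y.inner_diff_left ym gm sum_subtractf Y.inner_commute[OF ym gm])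
  also have "(\<Sum>\<alpha>\<in>?F. hinner Y (y \<alpha>) (y \<alpha>)) = hinner (fock Y) y y"
    by (rule Y.inner_poly[OF y, symmetric]) (rule ym)
  also have "(\<Sum>\<alpha>\<in>?F. cnj (hinner Y (y \<alpha>) (g \<alpha>))) = cnj (hinner (fock Y) y (series_app S q))"
    by (simp add: Y.inner_poly[OF y] gm g_def series_app_def[abs_def] flip: g_def)
  also have "hinner (fock Y) y (series_app S q) = hinner (fock U) q q"
    using adj_app_duality[OF U Y S y qm] by (simp add: q_def)
  finally show ?thesis
    unfolding FU.inner_self[OF U.polys_fock[OF q]] FY.inner_self[OF Y.polys_fock[OF y]]
    by (simp add: q_def)
qed

lemma bounded_op_zero:
  assumes "hilbert_space K" shows "bounded_op H K 0"
proof -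
  interpret hilbert_space K by fact
  show ?thesis
    unfolding bounded_op_def linear_op_def
    by (auto simp: zero_mem scale_zero_right norm_zero intro!: exI[of _ 0])
qed

lemma bounded_op_id: "bounded_op H H id"
  unfolding bounded_op_def linear_op_def by (auto intro!: exI[of _ 1])

lemma bounded_op_add:
  assumes H: "hilbert_space H" and K: "hilbert_space K" and S: "bounded_op H K S" and T: "bounded_op H K T"
  shows "bounded_op H K (S + T)"
proof -
  interpret K: hilbert_space K by fact
  obtain a b where ab: "\<And>x. x \<in> hcarrier H \<Longrightarrow> hnorm K (S x) \<le> a * hnorm H x"
    "\<And>x. x \<in> hcarrier H \<Longrightarrow> hnorm K (T x) \<le> b * hnorm H x"
    using bounded_op_nonneg_bound[OF H S] bounded_op_nonneg_bound[OF H T] by metis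
  note D = linear_opD[OF bounded_op_linear[OF S]] linear_opD[OF bounded_op_linear[OF T]]
  have "hnorm K ((S + T) x) \<le> (a + b) * hnorm H x" if "x \<in> hcarrier H" for x
    using K.norm_triangle[of "S x" "T x"] ab[OF that] D that by (simp add: distrib_right)
  then show ?thesis
    unfolding bounded_op_def linear_op_def using D by (auto simp: K.add_mem K.scale_add_right)
qed

lemma bounded_op_comp:
  assumes H: "hilbert_space H" and K: "hilbert_space K" and S: "bounded_op K L S" and T: "bounded_op H K T"
  shows "bounded_op H L (S \<circ> T)"
proof -
  obtain a b where ab: "0 \<le> a" "\<And>x. x \<in> hcarrier K \<Longrightarrow> hnorm L (S x) \<le> a * hnorm K x"
    "\<And>x. x \<in> hcarrier H \<Longrightarrow> hnorm K (T x) \<le> b * hnorm H x"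
    using bounded_op_nonneg_bound[OF K S] bounded_op_nonneg_bound[OF H T] by metis
  note D = linear_opD[OF bounded_op_linear[OF S]] linear_opD[OF bounded_op_linear[OF T]]
  have "hnorm L ((S \<circ> T) x) \<le> (a * b) * hnorm H x" if "x \<in> hcarrier H" for x
    using ab(2)[of "T x"] mult_left_mono[OF ab(3)[OF that] ab(1)] D that by simp
  then show ?thesis
    unfolding bounded_op_def linear_op_def using D by auto
qed

lemma bounded_op_diff:
  assumes H: "hilbert_space H" and K: "hilbert_space K" and S: "bounded_op H K S" and T: "bounded_op H K T"
  shows "bounded_op H K (S - T)"
proof -
  interpret K: hilbert_space K by fact
  have neg: "bounded_op K K uminus"
    unfolding bounded_op_def linear_op_def
  proof (intro conjI ballI allI exI[of _ 1])
    show "- hscale K c x = hscale K c (- x)" if "x \<in> hcarrier K" for c x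
      using that by (simp add: K.scale_scale K.scale_mem mult.commute flip: K.scale_minus_one)
    show "hnorm K (- x) \<le> 1 * hnorm K x" if "x \<in> hcarrier K" for x
      using K.norm_scale[OF that, of "-1"] that by (simp add: K.scale_minus_one)
    show "- (x + y) = - x + - y" for x y :: 'b by simp
  qed (rule K.minus_mem)
  have "S - T = S + (uminus \<circ> T)" by (simp add: fun_eq_iff)
  then show ?thesis using bounded_op_add[OF H K S bounded_op_comp[OF H K neg T]] by metis
qed

lemma bounded_op_sum:
  assumes "hilbert_space H" "hilbert_space K" "\<And>i. i \<in> I \<Longrightarrow> bounded_op H K (T i)"
  shows "bounded_op H K (sum T I)"
  using assms(3)
  by (induction I rule: infinite_finite_induct) (auto simp: bounded_op_zero bounded_op_add assms(1,2))

lemma bounded_op_kernel_S: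
  assumes U: "hilbert_space U" and Y: "hilbert_space Y" and S: "op_series U Y S"
  shows "bounded_op Y Y (kernel_S U Y S \<alpha> u)"
proof -
  have S': "\<And>\<alpha>. bounded_op U Y (S \<alpha>)" using S by (simp add: op_series_def)
  have mult: "bounded_op H L ((F \<star> G) v w)"
    if "hilbert_space H" "hilbert_space K" "hilbert_space L"
      "\<And>v w. bounded_op K L (F v w)" "\<And>v w. bounded_op H K (G v w)"
    for H :: "'p::ab_group_add hilb" and K :: "'q::ab_group_add hilb" and L :: "'r::ab_group_add hilb"
      and F :: "('c, 'q \<Rightarrow> 'r) series2" and G v w
    unfolding series2_mult_def case_prod_unfold
    by (intro bounded_op_sum bounded_op_comp[OF that(1,2)] that)
  have "kernel_S U Y S \<alpha> u = szego \<alpha> u - (series_z S \<star> szego \<star> series_w_adj U Y S) \<alpha> u"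
    by (simp add: kernel_S_def fun_eq_iff)
  moreover have "bounded_op Y Y (szego \<alpha> u - (series_z S \<star> szego \<star> series_w_adj U Y S) \<alpha> u)"
    by (intro bounded_op_diff Y mult[OF Y U Y] mult[OF U U Y] U)
       (auto simp: szego_def series_z_def series_w_adj_def bounded_op_id bounded_op_zero U Y S' bounded_op_adjoint)
  ultimately show ?thesis by metis
qed

lemma schur_class_iff_positive_kernel:
  fixes S :: "('d::finite, 'u::ab_group_add \<Rightarrow> 'y::ab_group_add) series"
  assumes U: "hilbert_space U" and Y: "hilbert_space Y" and S: "op_series U Y S"
  shows "S \<in> schur_class U Y \<longleftrightarrow> positive_kernel Y (kernel_S U Y S)"
    and "S \<in> schur_class U Y \<Longrightarrow> contraction_op (fock U) (fock Y) (series_app S)"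
proof -
  interpret U: hilbert_space U by fact
  interpret Y: hilbert_space Y by fact
  interpret FU: hilbert_space "fock U :: ('d list \<Rightarrow> 'u) hilb" unfolding fock_eq_l2 by (rule U.hilbert_l2)
  interpret FY: hilbert_space "fock Y :: ('d list \<Rightarrow> 'y) hilb" unfolding fock_eq_l2 by (rule Y.hilbert_l2)
  have real: "of_real r \<in> \<real>\<^sub>\<ge>\<^sub>0 \<longleftrightarrow> 0 \<le> r" for r by simp
  have "positive_kernel Y (kernel_S U Y S) \<longleftrightarrow>
      (\<forall>y\<in>polys Y. 0 \<le> (hnorm (fock Y) y)\<^sup>2 - (hnorm (fock U) (adj_app U Y S y))\<^sup>2)"
    unfolding positive_kernel_def using bounded_op_kernel_S[OF U Y S] kernel_form_eq[OF U Y S]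
    by (simp add: polys_def del: of_real_diff of_real_power)
  also have "\<dots> \<longleftrightarrow> (\<forall>y\<in>polys Y. hnorm (fock U) (adj_app U Y S y) \<le> hnorm (fock Y) y)"
  proof (intro ball_cong refl)
    fix y :: "('d, 'y) series" assume y: "y \<in> polys Y"
    have "0 \<le> hnorm (fock Y) y" "0 \<le> hnorm (fock U) (adj_app U Y S y)"
      using FY.norm_nonneg[OF Y.polys_fock[OF y]] FU.norm_nonneg[OF U.polys_fock[OF adj_app_polys[OF U Y S y]]]
      by auto
    then show "0 \<le> (hnorm (fock Y) y)\<^sup>2 - (hnorm (fock U) (adj_app U Y S y))\<^sup>2 \<longleftrightarrow>
        hnorm (fock U) (adj_app U Y S y) \<le> hnorm (fock Y) y" by simp
  qed
  finally have pos: "positive_kernel Y (kernel_S U Y S) \<longleftrightarrow> \<dots>" .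
  show contr: "contraction_op (fock U) (fock Y) (series_app S)" if "S \<in> schur_class U Y"
    using series_app_contraction_if_adjoint_bound[OF U Y S] adjoint_bound_if_schur_class[OF U Y that] by blast
  have "S \<in> schur_class U Y" if "positive_kernel Y (kernel_S U Y S)"
    using series_app_contraction_if_adjoint_bound[OF U Y S] that S unfolding pos schur_class_def by blast
  then show "S \<in> schur_class U Y \<longleftrightarrow> positive_kernel Y (kernel_S U Y S)"
    using adjoint_bound_if_schur_class[OF U Y] unfolding pos by blast
qed

section \<open>Reindexing Hilbert sums\<close>

context hilbert_space
begin

lemma l2_reindex:
  assumes \<phi>: "bij_betw \<phi> UNIV UNIV"
  shows "f \<circ> \<phi> \<in> hcarrier (l2 H) \<longleftrightarrow> f \<in> hcarrier (l2 H)"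
    and "hinner (l2 H) (f \<circ> \<phi>) (g \<circ> \<phi>) = hinner (l2 H) f g"
proof -
  have "(\<forall>i. f (\<phi> i) \<in> hcarrier H) \<longleftrightarrow> (\<forall>i. f i \<in> hcarrier H)"
    using bij_betw_imp_surj_on[OF \<phi>] by (metis UNIV_I imageE)
  then show "f \<circ> \<phi> \<in> hcarrier (l2 H) \<longleftrightarrow> f \<in> hcarrier (l2 H)"
    using summable_on_reindex_bij_betw[OF \<phi>, of "\<lambda>i. (hnorm H (f i))\<^sup>2"] by (simp add: l2_simps)
  show "hinner (l2 H) (f \<circ> \<phi>) (g \<circ> \<phi>) = hinner (l2 H) f g"
    using infsum_reindex_bij_betw[OF \<phi>, of "\<lambda>i. hinner H (f i) (g i)"] by (simp add: l2_simps)
qed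

lemma l2_split_point:
  fixes f g :: "'i \<Rightarrow> 'a"
  assumes \<sigma>: "bij_betw \<sigma> UNIV (- {i})"
  shows "f \<in> hcarrier (l2 H) \<longleftrightarrow> f i \<in> hcarrier H \<and> f \<circ> \<sigma> \<in> hcarrier (l2 H)"
    and "\<lbrakk>f \<in> hcarrier (l2 H); g \<in> hcarrier (l2 H)\<rbrakk> \<Longrightarrow>
      hinner (l2 H) f g = hinner H (f i) (g i) + hinner (l2 H) (f \<circ> \<sigma>) (g \<circ> \<sigma>)"
proof -
  have UNIV_eq: "insert i (- {i}) = UNIV" by auto
  have "- {i} = range \<sigma>" using \<sigma> by (simp add: bij_betw_def)
  then have "(\<forall>k. f k \<in> hcarrier H) \<longleftrightarrow> f i \<in> hcarrier H \<and> (\<forall>k. f (\<sigma> k) \<in> hcarrier H)"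
    by (metis ComplI imageE rangeI singletonD)
  moreover have "h summable_on UNIV \<longleftrightarrow> (\<lambda>k. h (\<sigma> k)) summable_on UNIV" for h :: "'i \<Rightarrow> real"
    using summable_on_insert_iff[of h i "- {i}"] summable_on_reindex_bij_betw[OF \<sigma>, of h]
    by (simp add: UNIV_eq)
  ultimately show "f \<in> hcarrier (l2 H) \<longleftrightarrow> f i \<in> hcarrier H \<and> f \<circ> \<sigma> \<in> hcarrier (l2 H)"
    by (auto simp: l2_simps)
  assume fg: "f \<in> hcarrier (l2 H)" "g \<in> hcarrier (l2 H)"
  have "infsum (\<lambda>k. hinner H (f k) (g k)) (insert i (- {i})) =
      hinner H (f i) (g i) + infsum (\<lambda>k. hinner H (f k) (g k)) (- {i})"
    by (rule infsum_insert) (use l2_inner_summable[OF fg] in \<open>auto intro: summable_on_subset_banach\<close>)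
  then show "hinner (l2 H) f g = hinner H (f i) (g i) + hinner (l2 H) (f \<circ> \<sigma>) (g \<circ> \<sigma>)"
    using infsum_reindex_bij_betw[OF \<sigma>, of "\<lambda>k. hinner H (f k) (g k)"]
    by (simp add: l2_simps UNIV_eq)
qed

lemma l2_uncurry:
  fixes f g :: "'d::finite \<Rightarrow> 'i \<Rightarrow> 'a"
  shows "(\<lambda>(j, i). f j i) \<in> hcarrier (l2 H) \<longleftrightarrow> (\<forall>j. f j \<in> hcarrier (l2 H))"
    and "\<lbrakk>\<And>j. f j \<in> hcarrier (l2 H); \<And>j. g j \<in> hcarrier (l2 H)\<rbrakk> \<Longrightarrow>
      hinner (l2 H) (\<lambda>(j, i). f j i) (\<lambda>(j, i). g j i) = (\<Sum>j\<in>UNIV. hinner (l2 H) (f j) (g j))"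
proof -
  show mem: "(\<lambda>(j, i). f j i) \<in> hcarrier (l2 H) \<longleftrightarrow> (\<forall>j. f j \<in> hcarrier (l2 H))"
    for f :: "'d \<Rightarrow> 'i \<Rightarrow> 'a"
  proof
    assume L: "(\<lambda>(j, i). f j i) \<in> hcarrier (l2 H)"
    then have "(\<lambda>(j, i). (hnorm H (f j i))\<^sup>2) summable_on Sigma UNIV (\<lambda>_. UNIV)"
      by (simp add: l2_simps case_prod_unfold)
    then show "\<forall>j. f j \<in> hcarrier (l2 H)"
      using L summable_on_SigmaD1[of "\<lambda>j i. (hnorm H (f j i))\<^sup>2" UNIV "\<lambda>_. UNIV"]
      by (auto simp: l2_simps)
  next
    assume R: "\<forall>j. f j \<in> hcarrier (l2 H)"
    have "(\<lambda>(j, i). (hnorm H (f j i))\<^sup>2) summable_on Sigma UNIV (\<lambda>_. UNIV)"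
      by (rule summable_on_SigmaI[where g = "\<lambda>j. \<Sum>\<^sub>\<infinity>i. (hnorm H (f j i))\<^sup>2"])
         (use R in \<open>auto simp: l2_simps\<close>)
    then show "(\<lambda>(j, i). f j i) \<in> hcarrier (l2 H)"
      using R by (auto simp: l2_simps case_prod_unfold)
  qed
  assume "\<And>j. f j \<in> hcarrier (l2 H)" "\<And>j. g j \<in> hcarrier (l2 H)"
  then have "(\<lambda>p. hinner H (case p of (j, i) \<Rightarrow> f j i) (case p of (j, i) \<Rightarrow> g j i)) summable_on UNIV"
    using l2_inner_summable mem by blast
  then have "(\<lambda>(j, i). hinner H (f j i) (g j i)) summable_on UNIV \<times> UNIV"
    by (simp add: case_prod_unfold)
  from infsum_Sigma'_banach[OF this]
  show "hinner (l2 H) (\<lambda>(j, i). f j i) (\<lambda>(j, i). g j i) = (\<Sum>j\<in>UNIV. hinner (l2 H) (f j) (g j))"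
    by (simp add: l2_simps case_prod_unfold)
qed

lemma l2_nat_cons:
  "case_nat a e \<in> hcarrier (l2 H) \<longleftrightarrow> a \<in> hcarrier H \<and> e \<in> hcarrier (l2 H)"
  "\<lbrakk>a \<in> hcarrier H; e \<in> hcarrier (l2 H); b \<in> hcarrier H; g \<in> hcarrier (l2 H)\<rbrakk> \<Longrightarrow>
    hinner (l2 H) (case_nat a e) (case_nat b g) = hinner H a b + hinner (l2 H) e g"
proof -
  have "bij_betw Suc UNIV (- {0})"
    by (auto simp: bij_betw_def image_iff) (metis not0_implies_Suc)
  note split = l2_split_point[OF this]
  have "case_nat a e \<circ> Suc = e" for a :: 'a and e by auto
  then show mem: "case_nat a e \<in> hcarrier (l2 H) \<longleftrightarrow> a \<in> hcarrier H \<and> e \<in> hcarrier (l2 H)" for a e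
    using split(1)[of "case_nat a e"] by simp
  assume "a \<in> hcarrier H" "e \<in> hcarrier (l2 H)" "b \<in> hcarrier H" "g \<in> hcarrier (l2 H)"
  then show "hinner (l2 H) (case_nat a e) (case_nat b g) = hinner H a b + hinner (l2 H) e g"
    using split(2)[of "case_nat a e" "case_nat b g"] mem by (simp add: comp_def)
qed

end

section \<open>Defect operators\<close>

text \<open>
  A square root of \<open>I - L\<^sup>2\<close> up to an isometry, without spectral theory: since
  \<open>1 - x = (1 - x)\<^sup>2 (1 + x + x\<^sup>2 + \<dots>)\<close>, the vectors \<open>(1 - L\<^sup>2) L\<^sup>n x\<close> have squared norms that telescope
  to \<open>\<parallel>x\<parallel>\<^sup>2 - \<parallel>L x\<parallel>\<^sup>2\<close>.  The value of \<open>D\<close> is a sequence of vectors rather than a vector, which does no harm since only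
  the inner products of its values will matter.
\<close>

lemma (in hilbert_space) defect_operator:
  assumes L: "contraction_op H H L"
    and adj: "\<And>x y. \<lbrakk>x \<in> hcarrier H; y \<in> hcarrier H\<rbrakk> \<Longrightarrow> hinner H (L x) y = hinner H x (L y)"
  defines "D \<equiv> \<lambda>x n. (L ^^ n) x - (L ^^ (n + 2)) x"
  shows "linear_op H (l2 H) D"
    and "\<lbrakk>x \<in> hcarrier H; y \<in> hcarrier H\<rbrakk> \<Longrightarrow>
      hinner (l2 H) (D x) (D y) = hinner H x y - hinner H (L x) (L y)"
proof -
  have lin: "linear_op H H L" and contr: "\<And>x. x \<in> hcarrier H \<Longrightarrow> hnorm H (L x) \<le> hnorm H x"
    using L by (auto simp: contraction_op_def)
  have mem: "(L ^^ n) x \<in> hcarrier H" if "x \<in> hcarrier H" for n x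
    by (induction n) (use that linear_opD(1)[OF lin] in auto)
  have pow_add: "(L ^^ n) (x + y) = (L ^^ n) x + (L ^^ n) y"
    if "x \<in> hcarrier H" "y \<in> hcarrier H" for n x y
    by (induction n) (use that linear_opD(2)[OF lin] mem in auto)
  have pow_scale: "(L ^^ n) (hscale H c x) = hscale H c ((L ^^ n) x)" if "x \<in> hcarrier H" for n c x
    by (induction n) (use that linear_opD(3)[OF lin] mem in auto)
  have Dm: "D x n \<in> hcarrier H" if "x \<in> hcarrier H" for x n
    unfolding D_def by (intro diff_mem mem that)
  \<comment> \<open>The inner products of \<open>D x\<close> and \<open>D y\<close> are second differences of \<open>b\<close>, so their partial sums are first
    differences of \<open>b\<close>.\<close>
  define b where "b x y n = hinner H ((L ^^ n) x) ((L ^^ n) y)" for x y n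
  have terms: "hinner H (D x n) (D y n) = (b x y n - b x y (Suc n)) - (b x y (Suc n) - b x y (Suc (Suc n)))"
    and cross: "b x y n - b x y (Suc n) = hinner H (D x n) ((L ^^ n) y)"
    if "x \<in> hcarrier H" "y \<in> hcarrier H" for x y n
    using that mem[OF that(1)] mem[OF that(2)] linear_opD(1)[OF lin]
    by (simp_all add: D_def b_def inner_diff_left inner_diff_right diff_mem adj)
  have partial: "(\<Sum>n<N. hinner H (D x n) (D y n)) =
      (b x y 0 - b x y (Suc 0)) - (b x y N - b x y (Suc N))" if "x \<in> hcarrier H" "y \<in> hcarrier H" for x y N
    by (induction N) (simp_all add: terms[OF that])
  have D_l2: "D x \<in> hcarrier (l2 H)" if x: "x \<in> hcarrier H" for x
  proof -
    have decr: "Re (b x x (Suc n)) \<le> Re (b x x n)" for n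
      using power_mono[OF contr[OF mem[OF x, of n]], of 2] norm_nonneg[OF mem[OF x, of "Suc n"]]
        norm_sq[OF mem[OF x, of n]] norm_sq[OF mem[OF x, of "Suc n"]]
      by (simp add: b_def)
    have "(\<Sum>n<N. (hnorm H (D x n))\<^sup>2) \<le> Re (b x x 0 - b x x (Suc 0))" for N
    proof -
      have "(\<Sum>n<N. (hnorm H (D x n))\<^sup>2) = Re (\<Sum>n<N. hinner H (D x n) (D x n))"
        by (simp add: norm_sq Dm x)
      then show ?thesis unfolding partial[OF x x] using decr[of N] by simp
    qed
    then have "summable (\<lambda>n. (hnorm H (D x n))\<^sup>2)"
      by (intro summableI_nonneg_bounded) auto
    then have "(\<lambda>n. (hnorm H (D x n))\<^sup>2) summable_on UNIV"
      by (rule summable_nonneg_imp_summable_on) simp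
    then show ?thesis using Dm[OF x] by (simp add: l2_simps)
  qed
  show "linear_op H (l2 H) D"
    unfolding linear_op_def
  proof (intro conjI ballI allI)
    show "D (x + y) = D x + D y" if "x \<in> hcarrier H" "y \<in> hcarrier H" for x y
      using that linear_opD(2)[OF lin] mem by (auto simp: D_def fun_eq_iff pow_add linear_opD(1)[OF lin])
    show "D (hscale H c x) = hscale (l2 H) c (D x)" if "x \<in> hcarrier H" for c x
      using that mem by (auto simp: D_def fun_eq_iff pow_scale l2_simps scale_diff_right linear_opD[OF lin])
  qed (rule D_l2)
  assume x: "x \<in> hcarrier H" and y: "y \<in> hcarrier H"
  have "(\<lambda>n. hinner H (D x n) (D y n)) sums hinner (l2 H) (D x) (D y)"
    unfolding l2_simps by (intro has_sum_imp_sums has_sum_infsum l2_inner_summable D_l2 x y)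
  then have lim1: "(\<lambda>N. (b x y 0 - b x y (Suc 0)) - (b x y N - b x y (Suc N))) \<longlonglongrightarrow> hinner (l2 H) (D x) (D y)"
    by (simp add: sums_def partial[OF x y])
  have "(\<lambda>N. b x y N - b x y (Suc N)) \<longlonglongrightarrow> 0"
  proof (rule Lim_null_comparison)
    have "summable (\<lambda>n. (hnorm H (D x n))\<^sup>2)"
      using D_l2[OF x] by (intro summable_on_imp_summable) (simp add: l2_simps)
    then have "(\<lambda>n. sqrt ((hnorm H (D x n))\<^sup>2)) \<longlonglongrightarrow> sqrt 0"
      by (intro tendsto_real_sqrt summable_LIMSEQ_zero)
    then have "(\<lambda>n. hnorm H (D x n)) \<longlonglongrightarrow> 0"
      by (simp add: norm_nonneg Dm x)
    then show "(\<lambda>n. hnorm H (D x n) * hnorm H y) \<longlonglongrightarrow> 0"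
      by (rule tendsto_mult_left_zero)
    show "\<forall>\<^sub>F n in sequentially. norm (b x y n - b x y (Suc n)) \<le> hnorm H (D x n) * hnorm H y"
    proof (intro always_eventually allI)
      fix n
      have "hnorm H ((L ^^ n) y) \<le> hnorm H y"
      proof (induction n)
        case (Suc n)
        then show ?case using contr[OF mem[OF y, of n]] by simp
      qed simp
      then have "hnorm H (D x n) * hnorm H ((L ^^ n) y) \<le> hnorm H (D x n) * hnorm H y"
        by (intro mult_left_mono norm_nonneg Dm x)
      then show "norm (b x y n - b x y (Suc n)) \<le> hnorm H (D x n) * hnorm H y"
        unfolding cross[OF x y] using cauchy_schwarz[OF Dm[OF x, of n] mem[OF y, of n]] by linarith
    qed
  qed
  then have "(\<lambda>N. (b x y 0 - b x y (Suc 0)) - (b x y N - b x y (Suc N))) \<longlonglongrightarrow> (b x y 0 - b x y (Suc 0)) - 0"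
    by (intro tendsto_diff tendsto_const)
  then show "hinner (l2 H) (D x) (D y) = hinner H x y - hinner H (L x) (L y)"
    using LIMSEQ_unique[OF lim1] by (simp add: b_def)
qed

section \<open>A lurking isometry\<close>

text \<open>
  Equal Gramians define an isometry \<open>a f \<mapsto> b f\<close>, whose adjoint \<open>V\<close> is a coisometry on all of \<open>H\<close>.  Constructing
  \<open>V\<close> first, by the Riesz theorem applied to \<open>a f \<mapsto> \<langle>b f, h\<rangle>\<close>, avoids extending the isometry by continuity: everything
  follows by testing against the dense set of vectors \<open>a f\<close>.
\<close>

lemma coisometry_from_equal_gramians:
  assumes Q: "hilbert_space Q" and H: "hilbert_space H" and K: "hilbert_space K"
    and a: "linear_op Q K a" and b: "linear_op Q H b"
    and gram: "\<And>f g. \<lbrakk>f \<in> hcarrier Q; g \<in> hcarrier Q\<rbrakk> \<Longrightarrow> hinner K (a f) (a g) = hinner H (b f) (b g)"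
    and dense: "\<And>k. \<lbrakk>k \<in> hcarrier K; \<And>f. f \<in> hcarrier Q \<Longrightarrow> hinner K (a f) k = 0\<rbrakk> \<Longrightarrow> k = 0"
  obtains V where "contraction_op H K V" "\<And>f. f \<in> hcarrier Q \<Longrightarrow> adjoint_op H K V (a f) = b f"
    "\<And>k. k \<in> hcarrier K \<Longrightarrow> V (adjoint_op H K V k) = k"
proof -
  interpret Q: hilbert_space Q by fact
  interpret H: hilbert_space H by fact
  interpret K: hilbert_space K by fact
  note am = linear_opD(1)[OF a] and bm = linear_opD(1)[OF b]
  have uniq: "k = k'" if "k \<in> hcarrier K" "k' \<in> hcarrier K"
    "\<And>f. f \<in> hcarrier Q \<Longrightarrow> hinner K (a f) k = hinner K (a f) k'" for k k'
    using dense[of "k - k'"] that by (simp add: K.diff_mem K.inner_diff_right am)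
  have norm_eq: "hnorm K (a f) = hnorm H (b f)" if "f \<in> hcarrier Q" for f
    using gram[OF that that] by (simp add: hnorm_def)
  have well: "b f = b g" if "f \<in> hcarrier Q" "g \<in> hcarrier Q" "a f = a g" for f g
  proof -
    have "hnorm H (b (f - g)) = hnorm K (a (f - g))"
      using that by (simp add: norm_eq Q.diff_mem)
    also have "a (f - g) = 0" using that by (simp add: linear_op_diff[OF Q a])
    finally have "b (f - g) = 0"
      using H.norm_eq_zero bm Q.diff_mem that K.norm_zero by metis
    then show ?thesis using that by (simp add: linear_op_diff[OF Q b])
  qed
  have "\<exists>k\<in>hcarrier K. (\<forall>f\<in>hcarrier Q. hinner H (b f) h = hinner K (a f) k) \<and> hnorm K k \<le> hnorm H h"
    if h: "h \<in> hcarrier H" for h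
  proof -
    define pre where "pre m = (SOME f. f \<in> hcarrier Q \<and> a f = m)" for m
    have pre: "b (pre (a f)) = b f" if "f \<in> hcarrier Q" for f
    proof -
      have "pre (a f) \<in> hcarrier Q \<and> a (pre (a f)) = a f"
        unfolding pre_def by (rule someI[of _ f]) (use that in simp)
      then show ?thesis using well that by blast
    qed
    let ?M = "a ` hcarrier Q"
    have "\<exists>k\<in>hcarrier (ocomp K (hcarrier (ocomp K ?M))).
        (\<forall>m\<in>?M. hinner H (b (pre m)) h = hinner K m k) \<and> hnorm K k \<le> hnorm H h"
    proof (rule K.riesz_on_subspace)
      show "0 \<in> ?M" using linear_op_zero[OF Q a] Q.zero_mem by (metis imageI)
      show "x + y \<in> ?M" if "x \<in> ?M" "y \<in> ?M" for x y
        using that linear_opD(2)[OF a] Q.add_mem by (auto simp flip: linear_opD(2)[OF a])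
      show "hscale K c x \<in> ?M" if "x \<in> ?M" for x c
        using that Q.scale_mem by (auto simp flip: linear_opD(3)[OF a])
      show "hinner H (b (pre (x + y))) h = hinner H (b (pre x)) h + hinner H (b (pre y)) h"
        if "x \<in> ?M" "y \<in> ?M" for x y
      proof -
        obtain f g where fg: "f \<in> hcarrier Q" "g \<in> hcarrier Q" "x = a f" "y = a g" using \<open>x \<in> ?M\<close> \<open>y \<in> ?M\<close> by blast
        then have "b (pre (x + y)) = b f + b g"
          using pre[of "f + g"] linear_opD(2)[OF a] linear_opD(2)[OF b] Q.add_mem by metis
        then show ?thesis using fg by (simp add: pre H.inner_add_left bm h)
      qed
      show "hinner H (b (pre (hscale K c x))) h = c * hinner H (b (pre x)) h" if "x \<in> ?M" for x c
      proof -
        obtain f where f: "f \<in> hcarrier Q" "x = a f" using \<open>x \<in> ?M\<close> by blast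
        then have "b (pre (hscale K c x)) = hscale H c (b f)"
          using pre[of "hscale Q c f"] linear_opD(3)[OF a] linear_opD(3)[OF b] Q.scale_mem by metis
        then show ?thesis using f by (simp add: pre H.inner_scale_left bm h)
      qed
      show "cmod (hinner H (b (pre x)) h) \<le> hnorm H h * hnorm K x" if "x \<in> ?M" for x
      proof -
        obtain f where f: "f \<in> hcarrier Q" "x = a f" using \<open>x \<in> ?M\<close> by blast
        then show ?thesis using H.cauchy_schwarz[OF bm[OF f(1)] h] by (simp add: pre norm_eq mult.commute)
      qed
    qed (use am h H.norm_nonneg in auto)
    then show ?thesis using pre by auto
  qed
  then obtain V where V: "\<And>h. h \<in> hcarrier H \<Longrightarrow> V h \<in> hcarrier K"
    "\<And>h f. \<lbrakk>h \<in> hcarrier H; f \<in> hcarrier Q\<rbrakk> \<Longrightarrow> hinner K (a f) (V h) = hinner H (b f) h"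
    "\<And>h. h \<in> hcarrier H \<Longrightarrow> hnorm K (V h) \<le> hnorm H h"
    by metis
  have lin: "linear_op H K V"
    unfolding linear_op_def
  proof (intro conjI ballI allI V(1))
    show "V (x + y) = V x + V y" if "x \<in> hcarrier H" "y \<in> hcarrier H" for x y
      by (rule uniq) (use that in \<open>auto simp: V H.add_mem K.add_mem K.inner_add_right H.inner_add_right am bm\<close>)
    show "V (hscale H c x) = hscale K c (V x)" if "x \<in> hcarrier H" for c x
      by (rule uniq) (use that in \<open>auto simp: V H.scale_mem K.scale_mem K.inner_scale_right H.inner_scale_right am bm\<close>)
  qed
  have contr: "contraction_op H K V" using lin V by (simp add: contraction_op_def)
  note bdd = contraction_op_bounded[OF contr]
  note adj = adjoint_op_inner'[OF H K bdd] and adjm = adjoint_op_mem[OF H K bdd]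
  have Gb: "adjoint_op H K V (a f) = b f" if "f \<in> hcarrier Q" for f
    by (rule H.inner_all_eq) (use that in \<open>auto simp: adjm am bm V simp flip: adj\<close>)
  show thesis
  proof (rule that[OF contr Gb])
    show "V (adjoint_op H K V k) = k" if k: "k \<in> hcarrier K" for k
    proof (rule uniq)
      fix f assume f: "f \<in> hcarrier Q"
      have "hinner K (a f) (V (adjoint_op H K V k)) = hinner H (b f) (adjoint_op H K V k)"
        using V adjm k f by simp
      also have "\<dots> = hinner K (V (b f)) k" using adjoint_op_inner[OF H K bdd bm[OF f] k] by simp
      also have "V (b f) = a f"
        by (rule uniq) (use f in \<open>auto simp: V am bm gram\<close>)
      finally show "hinner K (a f) (V (adjoint_op H K V k)) = hinner K (a f) k" .
    qed (use k V adjm in auto)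
  qed
qed

section \<open>From a coisometry to a unitary operator\<close>

text \<open>
  Let \<open>G = V\<^sup>*\<close>, an isometry, and let \<open>N\<close> be the kernel of \<open>V\<close>.  Then \<open>h \<mapsto> (V h, h - G V h)\<close> is unitary from the domain of
  \<open>V\<close> onto the sum of its codomain and \<open>N\<close>.  The surplus \<open>N\<close> is absorbed by enlarging the state space by
  \<open>E = l2(\<nat>, N)\<close>: putting an element of \<open>N\<close> in front of a sequence in \<open>E\<close> and distributing the result over \<open>d\<close> sequences
  along a bijection of \<open>{1..d} \<times> \<nat>\<close> with \<open>\<nat>\<close> is unitary from \<open>N \<oplus> E\<close> onto \<open>E\<^sup>d\<close>.  The component in \<open>E\<close> never acts back
  on the old state or on the output, so the transfer function does not change.
\<close>

lemma unitary_from_coisometry: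
  fixes X0 :: "'x::ab_group_add hilb" and U :: "'u::ab_group_add hilb" and Y :: "'y::ab_group_add hilb"
    and V :: "'x \<times> 'u \<Rightarrow> ('d::finite \<Rightarrow> 'x) \<times> 'y"
  assumes X0: "hilbert_space X0" and U: "hilbert_space U" and Y: "hilbert_space Y"
    and V: "contraction_op (X0 \<oplus>\<^sub>H U) (hpow X0 \<oplus>\<^sub>H Y) V"
    and coiso: "\<forall>k\<in>hcarrier (hpow X0 \<oplus>\<^sub>H Y). V (adjoint_op (X0 \<oplus>\<^sub>H U) (hpow X0 \<oplus>\<^sub>H Y) V k) = k"
  shows "\<exists>(X :: ('x \<times> (nat \<Rightarrow> 'x \<times> 'u)) hilb) W.
    hilbert_space X \<and> unitary_op (X \<oplus>\<^sub>H U) (hpow X \<oplus>\<^sub>H Y) W \<and>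
    (\<forall>x e u. snd (W ((x, e), u)) = snd (V (x, u))) \<and>
    (\<forall>x e u j. fst (fst (W ((x, e), u)) j) = fst (V (x, u)) j)"
proof -
  let ?H = "X0 \<oplus>\<^sub>H U" and ?K = "hpow X0 \<oplus>\<^sub>H Y :: (('d \<Rightarrow> 'x) \<times> 'y) hilb"
  interpret X0: hilbert_space X0 by fact
  interpret U: hilbert_space U by fact
  interpret Y: hilbert_space Y by fact
  have H: "hilbert_space ?H" by (intro hilbert_hsum X0 U)
  have K: "hilbert_space ?K" unfolding hpow_eq_l2 by (intro hilbert_hsum X0.hilbert_l2 Y)
  interpret H: hilbert_space ?H by (rule H)
  interpret K: hilbert_space ?K by (rule K)
  define G where "G = adjoint_op ?H ?K V"
  note bdd = contraction_op_bounded[OF V]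
  note lin = bounded_op_linear[OF bdd]
  note Vm = linear_opD(1)[OF lin]
  have Gm: "G k \<in> hcarrier ?H" if "k \<in> hcarrier ?K" for k
    unfolding G_def using adjoint_op_mem[OF H K bdd] that by blast
  have Glin: "linear_op ?K ?H G" unfolding G_def by (rule linear_op_adjoint[OF H K bdd])
  have VG: "V (G k) = k" if "k \<in> hcarrier ?K" for k unfolding G_def using coiso that by blast
  have adj: "hinner ?H h (G k) = hinner ?K (V h) k" if "h \<in> hcarrier ?H" "k \<in> hcarrier ?K" for h k
    unfolding G_def using adjoint_op_inner[OF H K bdd] that by simp
  have adj': "hinner ?H (G k) h = hinner ?K k (V h)" if "h \<in> hcarrier ?H" "k \<in> hcarrier ?K" for h k
    unfolding G_def using adjoint_op_inner'[OF H K bdd] that by simp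
  define N where "N = ocomp ?H (G ` hcarrier ?K)"
  have N: "hilbert_space N" unfolding N_def by (rule H.hilbert_ocomp) (use Gm in auto)
  interpret N: hilbert_space N by (rule N)
  have N_simps: "hscale N = hscale ?H" "hinner N = hinner ?H" by (simp_all add: N_def)
  have N_iff: "h \<in> hcarrier N \<longleftrightarrow> h \<in> hcarrier ?H \<and> V h = 0" for h
  proof
    assume "h \<in> hcarrier N"
    then have h: "h \<in> hcarrier ?H" "\<And>k. k \<in> hcarrier ?K \<Longrightarrow> hinner ?H h (G k) = 0"
      by (auto simp: N_def)
    have "hinner ?K (V h) (V h) = 0" using adj[OF h(1) Vm[OF h(1)]] h(2)[OF Vm[OF h(1)]] by simp
    then show "h \<in> hcarrier ?H \<and> V h = 0" using h Vm K.inner_eq_zero by blast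
  next
    assume "h \<in> hcarrier ?H \<and> V h = 0"
    then show "h \<in> hcarrier N" by (auto simp: N_def adj K.inner_zero_left)
  qed
  define X where "X = X0 \<oplus>\<^sub>H (l2 N :: (nat \<Rightarrow> 'x \<times> 'u) hilb)"
  have X: "hilbert_space X" unfolding X_def by (intro hilbert_hsum X0 N.hilbert_l2)
  have "countable (UNIV :: ('d \<times> nat) set)"
    using countable_SIGMA[of "UNIV :: 'd set" "\<lambda>_. UNIV :: nat set"] countable_finite[of "UNIV :: 'd set"] by simp
  moreover have "infinite (UNIV :: ('d \<times> nat) set)"
    by (simp add: finite_prod)
  ultimately obtain \<phi> :: "'d \<times> nat \<Rightarrow> nat" where \<phi>: "bij \<phi>"
    using to_nat_on_infinite by blast
  define \<delta> where "\<delta> h = h - G (V h)" for h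
  define c where "c p = case_nat (\<delta> (fst (fst p), snd p)) (snd (fst p))"
    for p :: "('x \<times> (nat \<Rightarrow> 'x \<times> 'u)) \<times> 'u"
  define W where "W p = ((\<lambda>j. (fst (V (fst (fst p), snd p)) j, \<lambda>n. c p (\<phi> (j, n)))), snd (V (fst (fst p), snd p)))"
    for p :: "('x \<times> (nat \<Rightarrow> 'x \<times> 'u)) \<times> 'u"
  have \<delta>m: "\<delta> h \<in> hcarrier N" if "h \<in> hcarrier ?H" for h
    unfolding N_iff \<delta>_def using that Gm Vm VG linear_op_diff[OF H lin] by (simp add: H.diff_mem)
  have pD: "(fst (fst p), snd p) \<in> hcarrier ?H" "snd (fst p) \<in> hcarrier (l2 N)"
    if "p \<in> hcarrier (X \<oplus>\<^sub>H U)" for p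
    using that by (auto simp: X_def hsum_simps)
  have cm: "c p \<in> hcarrier (l2 N)" if "p \<in> hcarrier (X \<oplus>\<^sub>H U)" for p
    unfolding c_def N.l2_nat_cons(1) using pD[OF that] \<delta>m by blast
  have cm': "(\<lambda>n. c p (\<phi> (j, n))) \<in> hcarrier (l2 N)" if "p \<in> hcarrier (X \<oplus>\<^sub>H U)" for p j
  proof -
    have "(\<lambda>(j, n). c p (\<phi> (j, n))) \<in> hcarrier (l2 N)"
      using N.l2_reindex(1)[OF \<phi>, of "c p"] cm[OF that] by (simp add: comp_def case_prod_unfold)
    then show ?thesis unfolding N.l2_uncurry(1)[of "\<lambda>j n. c p (\<phi> (j, n))"] by blast
  qed
  have inK: "v \<in> hcarrier ?K \<longleftrightarrow> (\<forall>j. fst v j \<in> hcarrier X0) \<and> snd v \<in> hcarrier Y" for v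
    by (simp add: hsum_simps hpow_def)
  have inX: "q \<in> hcarrier (hpow X \<oplus>\<^sub>H Y) \<longleftrightarrow>
      (\<forall>j. fst (fst q j) \<in> hcarrier X0 \<and> snd (fst q j) \<in> hcarrier (l2 N)) \<and> snd q \<in> hcarrier Y" for q
    by (auto simp: hsum_simps hpow_def X_def)
  have Wm: "W p \<in> hcarrier (hpow X \<oplus>\<^sub>H Y)" if "p \<in> hcarrier (X \<oplus>\<^sub>H U)" for p
    unfolding inX using Vm[OF pD(1)[OF that]] cm'[OF that] unfolding inK by (simp add: W_def)
  have \<delta>_add: "\<delta> (h + h') = \<delta> h + \<delta> h'" if "h \<in> hcarrier ?H" "h' \<in> hcarrier ?H" for h h'
    using that by (simp add: \<delta>_def linear_opD(2)[OF lin] linear_opD(2)[OF Glin] Vm)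
  have \<delta>_scale: "\<delta> (hscale ?H a h) = hscale ?H a (\<delta> h)" if "h \<in> hcarrier ?H" for h a
    using that by (simp add: \<delta>_def linear_opD(3)[OF lin] linear_opD(3)[OF Glin] Vm Gm H.scale_diff_right)
  have Wlin: "linear_op (X \<oplus>\<^sub>H U) (hpow X \<oplus>\<^sub>H Y) W"
    unfolding linear_op_def
  proof (intro conjI ballI allI Wm)
    fix p q assume p: "p \<in> hcarrier (X \<oplus>\<^sub>H U)" and q: "q \<in> hcarrier (X \<oplus>\<^sub>H U)"
    have h: "(fst (fst (p + q)), snd (p + q)) = (fst (fst p), snd p) + (fst (fst q), snd q)" by simp
    have "c (p + q) = c p + c q"
      unfolding c_def h \<delta>_add[OF pD(1)[OF p] pD(1)[OF q]] by (auto simp: fun_eq_iff split: nat.split)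
    then show "W (p + q) = W p + W q"
      unfolding W_def h linear_opD(2)[OF lin pD(1)[OF p] pD(1)[OF q]] by (simp add: fun_eq_iff)
  next
    fix a p assume p: "p \<in> hcarrier (X \<oplus>\<^sub>H U)"
    have h: "(fst (fst (hscale (X \<oplus>\<^sub>H U) a p)), snd (hscale (X \<oplus>\<^sub>H U) a p)) = hscale ?H a (fst (fst p), snd p)"
      by (simp add: hsum_simps X_def)
    have e: "snd (fst (hscale (X \<oplus>\<^sub>H U) a p)) = hscale (l2 N) a (snd (fst p))"
      by (simp add: hsum_simps X_def)
    have "c (hscale (X \<oplus>\<^sub>H U) a p) = hscale (l2 N) a (c p)"
      unfolding c_def h e \<delta>_scale[OF pD(1)[OF p]] by (auto simp: fun_eq_iff l2_simps N_simps split: nat.split)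
    then show "W (hscale (X \<oplus>\<^sub>H U) a p) = hscale (hpow X \<oplus>\<^sub>H Y) a (W p)"
      unfolding W_def h linear_opD(3)[OF lin pD(1)[OF p]]
      by (simp add: fun_eq_iff hsum_simps hpow_def X_def l2_simps)
  qed
  have \<delta>_inner: "hinner ?K (V h) (V h') + hinner N (\<delta> h) (\<delta> h') = hinner ?H h h'"
    if "h \<in> hcarrier ?H" "h' \<in> hcarrier ?H" for h h'
    using that Vm[OF that(1)] Vm[OF that(2)]
    by (simp add: \<delta>_def N_simps H.inner_diff_left H.inner_diff_right Gm H.diff_mem adj adj' VG linear_op_diff[OF H lin] K.inner_zero_left)
  have Winner: "hinner (hpow X \<oplus>\<^sub>H Y) (W p) (W q) = hinner (X \<oplus>\<^sub>H U) p q"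
    if p: "p \<in> hcarrier (X \<oplus>\<^sub>H U)" and q: "q \<in> hcarrier (X \<oplus>\<^sub>H U)" for p q
  proof -
    let ?h = "(fst (fst p), snd p)" and ?h' = "(fst (fst q), snd q)"
    have "(\<Sum>j\<in>UNIV. hinner (l2 N) (\<lambda>n. c p (\<phi> (j, n))) (\<lambda>n. c q (\<phi> (j, n)))) =
        hinner (l2 N) (c p \<circ> \<phi>) (c q \<circ> \<phi>)"
      using N.l2_uncurry(2)[of "\<lambda>j n. c p (\<phi> (j, n))" "\<lambda>j n. c q (\<phi> (j, n))"] cm'[OF p] cm'[OF q]
      by (simp add: comp_def case_prod_unfold)
    also have "\<dots> = hinner (l2 N) (c p) (c q)" by (rule N.l2_reindex(2)[OF \<phi>])
    also have "\<dots> = hinner N (\<delta> ?h) (\<delta> ?h') + hinner (l2 N) (snd (fst p)) (snd (fst q))"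
      unfolding c_def by (rule N.l2_nat_cons(2)) (use pD[OF p] pD[OF q] \<delta>m in auto)
    finally have tail: "(\<Sum>j\<in>UNIV. hinner (l2 N) (\<lambda>n. c p (\<phi> (j, n))) (\<lambda>n. c q (\<phi> (j, n)))) = \<dots>" .
    have "hinner (hpow X \<oplus>\<^sub>H Y) (W p) (W q) = hinner ?K (V ?h) (V ?h') +
        (\<Sum>j\<in>UNIV. hinner (l2 N) (\<lambda>n. c p (\<phi> (j, n))) (\<lambda>n. c q (\<phi> (j, n))))"
      by (simp add: W_def hsum_simps hpow_def X_def sum.distrib)
    also have "\<dots> = hinner ?H ?h ?h' + hinner (l2 N) (snd (fst p)) (snd (fst q))"
      using \<delta>_inner[OF pD(1)[OF p] pD(1)[OF q]] tail by (simp add: add.assoc[symmetric])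
    also have "\<dots> = hinner (X \<oplus>\<^sub>H U) p q"
      by (simp add: hsum_simps X_def)
    finally show ?thesis .
  qed
  have "q \<in> W ` hcarrier (X \<oplus>\<^sub>H U)" if q: "q \<in> hcarrier (hpow X \<oplus>\<^sub>H Y)" for q
  proof -
    define k where "k = (\<lambda>j. fst (fst q j), snd q)"
    define e where "e = (\<lambda>(j, n). snd (fst q j) n) \<circ> inv \<phi>"
    have k: "k \<in> hcarrier ?K" using q unfolding inX inK by (simp add: k_def)
    have "e \<circ> \<phi> = (\<lambda>(j, n). snd (fst q j) n)"
      using \<phi> by (simp add: e_def comp_assoc bij_is_inj)
    then have e\<phi>: "e (\<phi> (j, n)) = snd (fst q j) n" for j n by (metis (mono_tags) comp_apply case_prod_conv)
    have e: "e \<in> hcarrier (l2 N)"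
      unfolding N.l2_reindex(1)[OF \<phi>, of e, symmetric] \<open>e \<circ> \<phi> = _\<close> N.l2_uncurry(1)
      using q unfolding inX by blast
    have e_cons: "e = case_nat (e 0) (\<lambda>n. e (Suc n))" by (auto simp: fun_eq_iff split: nat.split)
    have e': "e 0 \<in> hcarrier N" "(\<lambda>n. e (Suc n)) \<in> hcarrier (l2 N)"
      using e N.l2_nat_cons(1)[of "e 0" "\<lambda>n. e (Suc n)"] e_cons by auto
    define h where "h = G k + e 0"
    have e0: "e 0 \<in> hcarrier ?H" "V (e 0) = 0" using e'(1) N_iff by auto
    have h: "h \<in> hcarrier ?H" unfolding h_def using Gm[OF k] e0 H.add_mem by blast
    have Vh: "V h = k"
      unfolding h_def using linear_opD(2)[OF lin Gm[OF k] e0(1)] by (simp add: VG[OF k] e0)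
    then have \<delta>h: "\<delta> h = e 0" by (simp add: \<delta>_def h_def)
    define p where "p = ((fst h, \<lambda>n. e (Suc n)), snd h)"
    have "p \<in> hcarrier (X \<oplus>\<^sub>H U)" using h e' by (auto simp: p_def hsum_simps X_def)
    moreover have "W p = q"
    proof -
      have "c p = e" using e_cons \<delta>h by (simp add: c_def p_def)
      then show ?thesis
        using Vh by (simp add: W_def e\<phi> p_def k_def prod_eq_iff fun_eq_iff)
    qed
    ultimately show ?thesis by blast
  qed
  then have Wsurj: "W ` hcarrier (X \<oplus>\<^sub>H U) = hcarrier (hpow X \<oplus>\<^sub>H Y)" using Wm by blast
  show ?thesis
  proof (intro exI[of _ X] exI[of _ W] conjI)
    show "hilbert_space X" by (rule X)
    show "unitary_op (X \<oplus>\<^sub>H U) (hpow X \<oplus>\<^sub>H Y) W"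
      unfolding unitary_op_def using Wlin Winner Wsurj by blast
  qed (simp_all add: W_def)
qed

section \<open>Realizations by a single operator\<close>

text \<open>
  A realization in terms of the whole operator \<^term>\<open>W\<close> instead of its blocks, which are \<open>W\<close> restricted to the pairs with a zero
  entry.  Dilations and changes of the state space are simpler to express for one operator.
\<close>

definition op_realizes :: "'u::ab_group_add hilb \<Rightarrow> ('x::ab_group_add \<times> 'u \<Rightarrow> ('d \<Rightarrow> 'x) \<times> 'y) \<Rightarrow>
    ('d, 'u \<Rightarrow> 'y) series \<Rightarrow> bool" where
  "op_realizes U W S \<longleftrightarrow> (\<forall>u\<in>hcarrier U. S [] u = snd (W (0, u)) \<and>
     (\<forall>v j. S (v @ [j]) u = snd (W (foldr (\<lambda>i x. fst (W (x, 0)) i) v (fst (W (0, u)) j), 0))))"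

lemma unitary_op_isometric:
  assumes "unitary_op H K T" "x \<in> hcarrier H"
  shows "hnorm K (T x) = hnorm H x"
  using assms by (simp add: unitary_op_def hnorm_def)

lemma unitary_realization_if_op_realizes:
  fixes X :: "'x::ab_group_add hilb" and U :: "'u::ab_group_add hilb" and Y :: "'y::ab_group_add hilb"
    and W :: "'x \<times> 'u \<Rightarrow> ('d::finite \<Rightarrow> 'x) \<times> 'y"
  assumes X: "hilbert_space X" and U: "hilbert_space U" and Y: "hilbert_space Y"
    and W: "unitary_op (X \<oplus>\<^sub>H U) (hpow X \<oplus>\<^sub>H Y) W" and S: "op_realizes U W S"
  shows "unitary_realization X U Y S"
proof -
  interpret X: hilbert_space X by fact
  interpret U: hilbert_space U by fact
  interpret Y: hilbert_space Y by fact
  have FX: "hilbert_space (hpow X :: ('d \<Rightarrow> 'x) hilb)" unfolding hpow_eq_l2 by (rule X.hilbert_l2)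
  have lin: "linear_op (X \<oplus>\<^sub>H U) (hpow X \<oplus>\<^sub>H Y) W" using W by (simp add: unitary_op_def)
  have in1: "(x, 0) \<in> hcarrier (X \<oplus>\<^sub>H U)" if "x \<in> hcarrier X" for x
    using that U.zero_mem by (simp add: hsum_simps)
  have in2: "(0, u) \<in> hcarrier (X \<oplus>\<^sub>H U)" if "u \<in> hcarrier U" for u
    using that X.zero_mem by (simp add: hsum_simps)
  have n1: "hnorm (X \<oplus>\<^sub>H U) (x, 0) = hnorm X x" if "x \<in> hcarrier X" for x
    using that by (simp add: hnorm_def hsum_simps U.inner_zero_left U.zero_mem)
  have n2: "hnorm (X \<oplus>\<^sub>H U) (0, u) = hnorm U u" if "u \<in> hcarrier U" for u
    using that by (simp add: hnorm_def hsum_simps X.inner_zero_left X.zero_mem)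
  have out: "fst q j \<in> hcarrier X" "snd q \<in> hcarrier Y"
    "hnorm X (fst q j) \<le> hnorm (hpow X \<oplus>\<^sub>H Y) q" "hnorm Y (snd q) \<le> hnorm (hpow X \<oplus>\<^sub>H Y) q"
    if "q \<in> hcarrier (hpow X \<oplus>\<^sub>H Y)" for q :: "('d \<Rightarrow> 'x) \<times> 'y" and j
  proof -
    have f: "fst q \<in> hcarrier (hpow X)" and s: "snd q \<in> hcarrier Y" using that by (auto simp: hsum_simps)
    show "fst q j \<in> hcarrier X" "snd q \<in> hcarrier Y" using f s by (auto simp: hpow_def)
    have nn: "0 \<le> hnorm (hpow X \<oplus>\<^sub>H Y) q" by (rule hilbert_space.norm_nonneg[OF hilbert_hsum[OF FX Y] that])
    have "hnorm (hpow X) (fst q) \<le> hnorm (hpow X \<oplus>\<^sub>H Y) q"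
      by (rule power2_le_imp_le[OF _ nn]) (simp add: hsum_norm_sq[OF FX Y that])
    then show "hnorm X (fst q j) \<le> hnorm (hpow X \<oplus>\<^sub>H Y) q"
      using X.l2_norm_component_le[of "fst q" j] f unfolding hpow_eq_l2 by linarith
    show "hnorm Y (snd q) \<le> hnorm (hpow X \<oplus>\<^sub>H Y) q"
      by (rule power2_le_imp_le[OF _ nn]) (simp add: hsum_norm_sq[OF FX Y that])
  qed
  note Wm1 = linear_opD(1)[OF lin in1] and Wm2 = linear_opD(1)[OF lin in2]
  have add1: "W (x + x', 0) = W (x, 0) + W (x', 0)" if "x \<in> hcarrier X" "x' \<in> hcarrier X" for x x'
    using linear_opD(2)[OF lin in1[OF that(1)] in1[OF that(2)]] by simp
  have add2: "W (0, u + u') = W (0, u) + W (0, u')" if "u \<in> hcarrier U" "u' \<in> hcarrier U" for u u'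
    using linear_opD(2)[OF lin in2[OF that(1)] in2[OF that(2)]] by simp
  have scale1: "W (hscale X c x, 0) = hscale (hpow X \<oplus>\<^sub>H Y) c (W (x, 0))" if "x \<in> hcarrier X" for c x
    using linear_opD(3)[OF lin in1[OF that], of c] by (simp add: hsum_simps U.scale_zero_right)
  have scale2: "W (0, hscale U c u) = hscale (hpow X \<oplus>\<^sub>H Y) c (W (0, u))" if "u \<in> hcarrier U" for c u
    using linear_opD(3)[OF lin in2[OF that], of c] by (simp add: hsum_simps X.scale_zero_right)
  have norm1: "hnorm (hpow X \<oplus>\<^sub>H Y) (W (x, 0)) = hnorm X x" if "x \<in> hcarrier X" for x
    using unitary_op_isometric[OF W in1[OF that]] n1[OF that] by simp
  have norm2: "hnorm (hpow X \<oplus>\<^sub>H Y) (W (0, u)) = hnorm U u" if "u \<in> hcarrier U" for u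
    using unitary_op_isometric[OF W in2[OF that]] n2[OF that] by simp
  define A where "A j x = fst (W (x, 0)) j" for j x
  define B where "B j u = fst (W (0, u)) j" for j u
  define C where "C x = snd (W (x, 0))" for x
  define D where "D u = snd (W (0, u))" for u
  have "bounded_op X X (A j)" "bounded_op U X (B j)" for j
    unfolding bounded_op_def linear_op_def A_def B_def
    using out[OF Wm1] out[OF Wm2] norm1 norm2
    by (auto simp: add1 add2 scale1 scale2 hsum_simps hpow_def intro!: exI[of _ 1])
  moreover have "bounded_op X Y C" "bounded_op U Y D"
    unfolding bounded_op_def linear_op_def C_def D_def
    using out[OF Wm1] out[OF Wm2] norm1 norm2
    by (auto simp: add1 add2 scale1 scale2 hsum_simps hpow_def intro!: exI[of _ 1])
  ultimately have blocks: "bounded_blocks X U Y A B C D" by (simp add: bounded_blocks_def)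
  have block: "block_op A B C D p = W p" if "p \<in> hcarrier (X \<oplus>\<^sub>H U)" for p
  proof -
    obtain x u where p: "p = (x, u)" "x \<in> hcarrier X" "u \<in> hcarrier U"
      using \<open>p \<in> hcarrier (X \<oplus>\<^sub>H U)\<close> unfolding hsum_simps by (metis prod.collapse)
    show ?thesis
      using linear_opD(2)[OF lin in1[OF p(2)] in2[OF p(3)]]
      by (simp add: p block_op_def A_def B_def C_def D_def prod_eq_iff fun_eq_iff)
  qed
  have "unitary_op (X \<oplus>\<^sub>H U) (hpow X \<oplus>\<^sub>H Y) (block_op A B C D)"
  proof -
    have "hilbert_space (X \<oplus>\<^sub>H U)" by (intro hilbert_hsum X U)
    then interpret XU: hilbert_space "X \<oplus>\<^sub>H U" .
    show ?thesis
      using W unfolding unitary_op_def linear_op_def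
      by (simp add: block XU.add_mem XU.scale_mem cong: image_cong)
  qed
  moreover have "series_eq_on U S (transfer A B C D)"
    unfolding series_eq_on_def
  proof (intro allI ballI)
    fix \<alpha> u assume u: "u \<in> hcarrier U"
    show "S \<alpha> u = transfer A B C D \<alpha> u"
      using S u unfolding op_realizes_def
      by (cases \<alpha> rule: rev_cases)
         (simp_all add: transfer_Nil transfer_snoc A_def[abs_def] B_def C_def D_def)
  qed
  ultimately show ?thesis unfolding unitary_realization_def using blocks by blast
qed

section \<open>Changing the ambient type of the state space\<close>

text \<open>
  The functional model lives on a type built from sequences of series.  Being a Hilbert space is a property of a
  carrier, so the model can be moved along any additive injection into the prescribed type of states.
\<close>

definition htransport :: "('a \<Rightarrow> 'b) \<Rightarrow> 'a hilb \<Rightarrow> 'b hilb" where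
  "htransport \<iota> X = \<lparr> hcarrier = \<iota> ` hcarrier X,
     hscale = (\<lambda>c x. \<iota> (hscale X c (inv \<iota> x))),
     hinner = (\<lambda>x y. hinner X (inv \<iota> x) (inv \<iota> y)) \<rparr>"

definition additive_inj :: "('a::ab_group_add \<Rightarrow> 'b::ab_group_add) \<Rightarrow> bool" where
  "additive_inj \<iota> \<longleftrightarrow> inj \<iota> \<and> (\<forall>x y. \<iota> (x + y) = \<iota> x + \<iota> y)"

lemma additive_injD:
  assumes "additive_inj \<iota>"
  shows "inv \<iota> (\<iota> x) = x" "\<iota> (x + y) = \<iota> x + \<iota> y" "\<iota> 0 = 0" "\<iota> (x - y) = \<iota> x - \<iota> y" "\<iota> x = \<iota> y \<longleftrightarrow> x = y"
proof -
  show add: "\<iota> (x + y) = \<iota> x + \<iota> y" for x y using assms by (simp add: additive_inj_def)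
  show "inv \<iota> (\<iota> x) = x" "\<iota> x = \<iota> y \<longleftrightarrow> x = y"
    using assms by (auto simp: additive_inj_def inj_def)
  show "\<iota> 0 = 0" using add[of 0 0] by simp
  show "\<iota> (x - y) = \<iota> x - \<iota> y" using add[of "x - y" y] by (simp add: eq_diff_eq)
qed

lemma hilbert_htransport:
  assumes X: "hilbert_space X" and \<iota>: "additive_inj \<iota>"
  shows "hilbert_space (htransport \<iota> X)"
proof -
  interpret X: hilbert_space X by fact
  note I = additive_injD[OF \<iota>]
  have norm: "hnorm (htransport \<iota> X) (\<iota> x) = hnorm X x" for x
    by (simp add: hnorm_def htransport_def I)
  show ?thesis
  proof unfold_locales
    show "0 \<in> hcarrier (htransport \<iota> X)"
      using X.zero_mem I(3) by (force simp: htransport_def)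
  next
    fix s :: "nat \<Rightarrow> 'b"
    assume "\<And>n. s n \<in> hcarrier (htransport \<iota> X)"
    then have "\<forall>n. \<exists>x. x \<in> hcarrier X \<and> s n = \<iota> x" by (auto simp: htransport_def)
    then obtain t where t: "\<And>n. t n \<in> hcarrier X" "\<And>n. s n = \<iota> (t n)" by metis
    assume "\<And>e. e > 0 \<Longrightarrow> \<exists>N. \<forall>m\<ge>N. \<forall>n\<ge>N. hnorm (htransport \<iota> X) (s m - s n) < e"
    then have "\<And>e. e > 0 \<Longrightarrow> \<exists>N. \<forall>m\<ge>N. \<forall>n\<ge>N. hnorm X (t m - t n) < e"
      by (simp add: t norm flip: I(4))
    then obtain l where l: "l \<in> hcarrier X" "(\<lambda>n. hnorm X (t n - l)) \<longlonglongrightarrow> 0"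
      using X.complete[of t] t by auto
    then show "\<exists>l\<in>hcarrier (htransport \<iota> X). (\<lambda>n. hnorm (htransport \<iota> X) (s n - l)) \<longlonglongrightarrow> 0"
      by (intro bexI[of _ "\<iota> l"]) (simp add: t norm flip: I(4), simp add: htransport_def)
  qed (auto simp: htransport_def I X.scale_add_right X.scale_add_left X.scale_scale X.scale_one
        X.inner_add_left X.inner_scale_left X.inner_nonneg X.scale_mem X.add_mem
        simp flip: I(2) intro: X.inner_commute dest: X.inner_eq_zero)
qed

lemma unitary_realization_htransport:
  fixes X :: "'x::ab_group_add hilb" and U :: "'u::ab_group_add hilb" and Y :: "'y::ab_group_add hilb"
    and W :: "'x \<times> 'u \<Rightarrow> ('d::finite \<Rightarrow> 'x) \<times> 'y" and \<iota> :: "'x \<Rightarrow> 'z::ab_group_add"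
  assumes X: "hilbert_space X" and U: "hilbert_space U" and Y: "hilbert_space Y"
    and W: "unitary_op (X \<oplus>\<^sub>H U) (hpow X \<oplus>\<^sub>H Y) W" and S: "op_realizes U W S"
    and \<iota>: "additive_inj \<iota>"
  shows "unitary_realization (htransport \<iota> X) U Y S"
proof -
  let ?X = "htransport \<iota> X"
  note I = additive_injD[OF \<iota>]
  define W' where "W' p = (let q = W (inv \<iota> (fst p), snd p) in (\<lambda>j. \<iota> (fst q j), snd q))" for p
  have W'\<iota>: "W' (\<iota> x, u) = (\<lambda>j. \<iota> (fst (W (x, u)) j), snd (W (x, u)))" for x u
    by (simp add: W'_def I Let_def)
  have car: "p \<in> hcarrier (?X \<oplus>\<^sub>H U) \<longleftrightarrow> (\<exists>x u. p = (\<iota> x, u) \<and> (x, u) \<in> hcarrier (X \<oplus>\<^sub>H U))" for p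
    by (cases p) (auto simp: hsum_simps htransport_def)
  have lin: "linear_op (X \<oplus>\<^sub>H U) (hpow X \<oplus>\<^sub>H Y) W" using W by (simp add: unitary_op_def)
  have unit: "unitary_op (?X \<oplus>\<^sub>H U) (hpow ?X \<oplus>\<^sub>H Y) W'"
    unfolding unitary_op_def linear_op_def
  proof (intro conjI ballI allI)
    fix p assume "p \<in> hcarrier (?X \<oplus>\<^sub>H U)"
    then obtain x u where p: "p = (\<iota> x, u)" "(x, u) \<in> hcarrier (X \<oplus>\<^sub>H U)" using car by blast
    show "W' p \<in> hcarrier (hpow ?X \<oplus>\<^sub>H Y)"
      using linear_opD(1)[OF lin p(2)] by (simp add: p W'\<iota> hsum_simps hpow_def htransport_def)
    show "W' (hscale (?X \<oplus>\<^sub>H U) c p) = hscale (hpow ?X \<oplus>\<^sub>H Y) c (W' p)" for c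
      using linear_opD(3)[OF lin p(2), of c]
      by (simp add: p W'\<iota> hsum_simps hpow_def htransport_def I)
    fix q assume "q \<in> hcarrier (?X \<oplus>\<^sub>H U)"
    then obtain y w where q: "q = (\<iota> y, w)" "(y, w) \<in> hcarrier (X \<oplus>\<^sub>H U)" using car by blast
    show "W' (p + q) = W' p + W' q"
      using linear_opD(2)[OF lin p(2) q(2)]
      by (simp add: p q W'\<iota> I fun_eq_iff flip: I(2))
    have "hinner (hpow X \<oplus>\<^sub>H Y) (W (x, u)) (W (y, w)) = hinner (X \<oplus>\<^sub>H U) (x, u) (y, w)"
      using W p q by (auto simp: unitary_op_def)
    then show "hinner (hpow ?X \<oplus>\<^sub>H Y) (W' p) (W' q) = hinner (?X \<oplus>\<^sub>H U) p q"
      by (simp add: p q W'\<iota> hsum_simps hpow_def htransport_def I)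
  next
    show "W' ` hcarrier (?X \<oplus>\<^sub>H U) = hcarrier (hpow ?X \<oplus>\<^sub>H Y)"
    proof (intro set_eqI iffI)
      fix q assume "q \<in> W' ` hcarrier (?X \<oplus>\<^sub>H U)"
      then obtain x u where p: "q = W' (\<iota> x, u)" "(x, u) \<in> hcarrier (X \<oplus>\<^sub>H U)"
        by (elim imageE) (use car in metis)
      then show "q \<in> hcarrier (hpow ?X \<oplus>\<^sub>H Y)"
        using linear_opD(1)[OF lin p(2)] by (simp add: p W'\<iota> hsum_simps hpow_def htransport_def)
    next
      fix q :: "('d \<Rightarrow> 'z) \<times> 'y" assume q: "q \<in> hcarrier (hpow ?X \<oplus>\<^sub>H Y)"
      then have "\<forall>j. \<exists>x. x \<in> hcarrier X \<and> fst q j = \<iota> x" by (auto simp: hsum_simps hpow_def htransport_def)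
      then obtain r where r: "\<And>j. r j \<in> hcarrier X" "\<And>j. fst q j = \<iota> (r j)" by metis
      have "(r, snd q) \<in> hcarrier (hpow X \<oplus>\<^sub>H Y)" using r q by (simp add: hsum_simps hpow_def)
      then obtain p where p: "p \<in> hcarrier (X \<oplus>\<^sub>H U)" "W p = (r, snd q)"
        using W unfolding unitary_op_def by (metis imageE)
      have "q = W' (\<iota> (fst p), snd p)"
        using p r by (simp add: W'\<iota> prod_eq_iff fun_eq_iff)
      moreover have "(\<iota> (fst p), snd p) \<in> hcarrier (?X \<oplus>\<^sub>H U)" using p car by (metis prod.collapse)
      ultimately show "q \<in> W' ` hcarrier (?X \<oplus>\<^sub>H U)" by blast
    qed
  qed
  have W'0: "W' (0, u) = (\<lambda>j. \<iota> (fst (W (0, u)) j), snd (W (0, u)))" for u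
    using W'\<iota>[of 0 u] by (simp add: I)
  have fold: "foldr (\<lambda>i x. fst (W' (x, 0)) i) v (\<iota> x) = \<iota> (foldr (\<lambda>i x. fst (W (x, 0)) i) v x)" for v x
    by (induction v) (simp_all add: W'\<iota>)
  have "op_realizes U W' S"
    using S unfolding op_realizes_def by (simp add: W'0 W'\<iota> fold)
  then show ?thesis
    by (intro unitary_realization_if_op_realizes[OF hilbert_htransport[OF X \<iota>] U Y unit])
qed

lemma additive_inj_comp: "additive_inj f \<Longrightarrow> additive_inj g \<Longrightarrow> additive_inj (f \<circ> g)"
  by (auto simp: additive_inj_def intro: inj_compose)

text \<open>
  Additive injections into sequences are closed under products (interleave two sequences) and countable powers
  (use a pairing function), which covers all types built from the coefficient spaces.
\<close>

lemma additive_inj_seq_prod: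
  fixes f :: "'a::ab_group_add \<Rightarrow> nat \<Rightarrow> 'c::ab_group_add" and g :: "'b::ab_group_add \<Rightarrow> nat \<Rightarrow> 'c"
  assumes "additive_inj f" "additive_inj g"
  shows "additive_inj (\<lambda>(a, b) n. if even n then f a (n div 2) else g b (n div 2))"
  unfolding additive_inj_def
proof (intro conjI injI allI)
  fix p q :: "'a \<times> 'b"
  assume eq: "(case p of (a, b) \<Rightarrow> \<lambda>n. if even n then f a (n div 2) else g b (n div 2)) =
    (case q of (a, b) \<Rightarrow> \<lambda>n. if even n then f a (n div 2) else g b (n div 2))"
  have "f (fst p) n = f (fst q) n" "g (snd p) n = g (snd q) n" for n
    using fun_cong[OF eq, of "2 * n"] fun_cong[OF eq, of "Suc (2 * n)"] by (simp_all add: case_prod_unfold)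
  then have "f (fst p) = f (fst q)" "g (snd p) = g (snd q)" by (simp_all add: fun_eq_iff)
  then show "p = q" using additive_injD(5)[OF assms(1)] additive_injD(5)[OF assms(2)] by (simp add: prod_eq_iff)
qed (auto simp: fun_eq_iff additive_injD[OF assms(1)] additive_injD[OF assms(2)])

lemma additive_inj_seq_fun:
  fixes f :: "'a::ab_group_add \<Rightarrow> nat \<Rightarrow> 'c::ab_group_add"
  assumes f: "additive_inj f" and I: "countable (UNIV :: 'i set)"
  shows "additive_inj (\<lambda>(h :: 'i \<Rightarrow> 'a) n. f (h (from_nat_into UNIV (fst (prod_decode n)))) (snd (prod_decode n)))"
  unfolding additive_inj_def
proof (intro conjI injI allI)
  fix h h' :: "'i \<Rightarrow> 'a"
  assume eq: "(\<lambda>n. f (h (from_nat_into UNIV (fst (prod_decode n)))) (snd (prod_decode n))) =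
    (\<lambda>n. f (h' (from_nat_into UNIV (fst (prod_decode n)))) (snd (prod_decode n)))"
  have "f (h i) m = f (h' i) m" for i m
    using fun_cong[OF eq, of "prod_encode (to_nat_on UNIV i, m)"] from_nat_into_to_nat_on[OF I, of i] by simp
  then have "f (h i) = f (h' i)" for i by (simp add: fun_eq_iff)
  then show "h = h'" using additive_injD(5)[OF f] by blast
qed (simp add: fun_eq_iff additive_injD(2)[OF f])

section \<open>Shifts on the Fock space\<close>

text \<open>
  The backward shift is the adjoint of the forward shift, which is right multiplication by \<open>z\<^sub>j\<close>.  Multiplication by
  \<open>S\<close> acts from the left, so it commutes with the forward shifts.
\<close>

definition bshift :: "'d \<Rightarrow> ('d, 'u) series \<Rightarrow> ('d, 'u) series" where
  "bshift j f w = f (w @ [j])"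

definition fshift :: "'d \<Rightarrow> ('d, 'u::zero) series \<Rightarrow> ('d, 'u) series" where
  "fshift j f w = (if w \<noteq> [] \<and> last w = j then f (butlast w) else 0)"

lemma fshift_simps [simp]: "fshift j f [] = 0" "fshift j f (w @ [i]) = (if i = j then f w else 0)"
  by (simp_all add: fshift_def)

lemma fshift_monomial: "fshift j (monomial w u) = monomial (w @ [j]) u"
proof
  show "fshift j (monomial w u) v = monomial (w @ [j]) u v" for v
    by (cases v rule: rev_cases) (auto simp: monomial_def)
qed

lemma bshift_fshift: "bshift i (fshift j f) = (if i = j then f else 0)"
  by (auto simp: bshift_def fun_eq_iff)

lemma series_app_fshift:
  assumes "\<And>\<alpha>. S \<alpha> 0 = 0"
  shows "series_app S (fshift j f) = fshift j (series_app S f)"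
proof
  show "series_app S (fshift j f) v = fshift j (series_app S f) v" for v
    by (cases v rule: rev_cases)
       (auto simp: series_app_def sum_splits_Nil sum_splits_snoc assms)
qed

lemma series_app_monomial_Nil:
  fixes S :: "('d, 'u::ab_group_add \<Rightarrow> 'y::ab_group_add) series"
  assumes "\<And>\<alpha>. S \<alpha> 0 = 0"
  shows "series_app S (monomial [] u) v = S v u"
proof -
  have "(\<Sum>(\<alpha>, \<beta>) | \<alpha> @ \<beta> = v. S \<alpha> (monomial [] u \<beta>)) =
      (\<Sum>(\<alpha>, \<beta>)\<in>{(v, [] :: 'd list)}. S \<alpha> (monomial [] u \<beta>))"
    by (rule sum.mono_neutral_right[OF finite_splits]) (auto simp: monomial_def assms split: if_splits)
  then show ?thesis by (simp add: series_app_def monomial_def)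
qed

context hilbert_space
begin

lemma fock_shift_decomposition:
  fixes f g :: "('d::finite, 'a) series"
  shows "f \<in> hcarrier (fock H) \<longleftrightarrow> f [] \<in> hcarrier H \<and> (\<forall>j. bshift j f \<in> hcarrier (fock H))"
    and "\<lbrakk>f \<in> hcarrier (fock H); g \<in> hcarrier (fock H)\<rbrakk> \<Longrightarrow>
      hinner (fock H) f g = hinner H (f []) (g []) + (\<Sum>j\<in>UNIV. hinner (fock H) (bshift j f) (bshift j g))"
proof -
  have \<sigma>: "bij_betw (\<lambda>(j, w). w @ [j]) UNIV (- {[]} :: 'd list set)"
    unfolding bij_betw_def
  proof
    show "range (\<lambda>(j, w). w @ [j]) = - {[] :: 'd list}"
    proof (intro set_eqI iffI)
      fix v :: "'d list" assume "v \<in> - {[]}"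
      then have "v = (\<lambda>(j, w). w @ [j]) (last v, butlast v)" by simp
      then show "v \<in> range (\<lambda>(j, w). w @ [j])" by (rule range_eqI)
    qed auto
  qed (auto simp: inj_on_def)
  have comp: "f \<circ> (\<lambda>(j, w). w @ [j]) = (\<lambda>(j, w). bshift j f w)" for f :: "('d, 'a) series"
    by (auto simp: fun_eq_iff bshift_def)
  show mem: "f \<in> hcarrier (fock H) \<longleftrightarrow> f [] \<in> hcarrier H \<and> (\<forall>j. bshift j f \<in> hcarrier (fock H))"
    for f :: "('d, 'a) series"
    using l2_split_point(1)[OF \<sigma>, of f] l2_uncurry(1)[of "\<lambda>j. bshift j f"]
    by (simp add: fock_eq_l2 comp)
  assume "f \<in> hcarrier (fock H)" "g \<in> hcarrier (fock H)"
  then show "hinner (fock H) f g = hinner H (f []) (g []) + (\<Sum>j\<in>UNIV. hinner (fock H) (bshift j f) (bshift j g))"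
    using mem[of f] mem[of g] l2_split_point(2)[OF \<sigma>, of f g]
      l2_uncurry(2)[of "\<lambda>j. bshift j f" "\<lambda>j. bshift j g"]
    by (simp add: fock_eq_l2 comp)
qed

lemma fshift_fock:
  fixes f :: "('d::finite, 'a) series"
  assumes "f \<in> hcarrier (fock H)"
  shows "fshift j f \<in> hcarrier (fock H)"
proof -
  have "(0 :: ('d, 'a) series) \<in> hcarrier (fock H)"
    unfolding fock_eq_l2 by (rule hilbert_space.zero_mem[OF hilbert_l2])
  then show ?thesis
    unfolding fock_shift_decomposition(1)[of "fshift j f"] bshift_fshift using assms zero_mem by simp
qed

lemma bshift_fshift_adjoint:
  fixes f g :: "('d::finite, 'a) series"
  assumes f: "f \<in> hcarrier (fock H)" and g: "g \<in> hcarrier (fock H)"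
  shows "hinner (fock H) (bshift j f) g = hinner (fock H) f (fshift j g)"
proof -
  interpret F: hilbert_space "fock H :: ('d list \<Rightarrow> 'a) hilb" unfolding fock_eq_l2 by (rule hilbert_l2)
  have m: "f [] \<in> hcarrier H" "bshift i f \<in> hcarrier (fock H)" for i
    using f fock_shift_decomposition(1)[of f] by auto
  have "(\<Sum>i\<in>UNIV. hinner (fock H) (bshift i f) (bshift i (fshift j g))) =
      (\<Sum>i\<in>UNIV. if i = j then hinner (fock H) (bshift j f) g else 0)"
    by (intro sum.cong refl) (simp add: bshift_fshift F.inner_zero_right m)
  then show ?thesis
    using fock_shift_decomposition(2)[OF f fshift_fock[OF g]] by (simp add: inner_zero_right m)
qed

end

section \<open>Functional model of a contractive multiplier\<close>

text \<open>
  The de Branges-Rovnyak colligation.  Let \<open>T\<close> be multiplication by \<open>S\<close>, \<open>R\<^sub>j\<close> the forward shifts and \<open>\<Delta>\<close> an operator with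
  \<open>\<Delta>\<^sup>*\<Delta> = I - T T\<^sup>*\<close>.  Since \<open>T\<^sup>*\<close> commutes with \<open>R\<^sub>j\<^sup>*\<close> and \<open>\<parallel>f\<parallel>\<^sup>2 = \<parallel>f\<^sub>\<emptyset>\<parallel>\<^sup>2 + \<Sum>j. \<parallel>R\<^sub>j\<^sup>* f\<parallel>\<^sup>2\<close> on both Fock spaces,
  \<open>\<Sum>j. \<parallel>\<Delta> R\<^sub>j\<^sup>* f\<parallel>\<^sup>2 + \<parallel>f\<^sub>\<emptyset>\<parallel>\<^sup>2 = \<parallel>\<Delta> f\<parallel>\<^sup>2 + \<parallel>(T\<^sup>* f)\<^sub>\<emptyset>\<parallel>\<^sup>2\<close>.
  The lurking isometry argument gives a coisometry \<open>V\<close> whose adjoint maps \<open>((\<Delta> R\<^sub>j\<^sup>* f)\<^sub>j, f\<^sub>\<emptyset>)\<close> to \<open>(\<Delta> f, (T\<^sup>* f)\<^sub>\<emptyset>)\<close>;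
  evaluating this adjoint on monomials \<open>f\<close> shows that \<open>V\<close> has transfer function \<open>S\<close>.
\<close>

lemma operator_realization_if_contraction:
  fixes U :: "'u::ab_group_add hilb" and Y :: "'y::ab_group_add hilb"
    and S :: "('d::finite, 'u \<Rightarrow> 'y) series"
  assumes U: "hilbert_space U" and Y: "hilbert_space Y" and S: "op_series U Y S"
    and contr: "contraction_op (fock U) (fock Y) (series_app S)"
  obtains X :: "((nat \<Rightarrow> ('d, 'y) series \<times> ('d, 'u) series) \<times>
      (nat \<Rightarrow> (nat \<Rightarrow> ('d, 'y) series \<times> ('d, 'u) series) \<times> 'u)) hilb" and W
  where "hilbert_space X" "unitary_op (X \<oplus>\<^sub>H U) (hpow X \<oplus>\<^sub>H Y) W" "op_realizes U W S"
proof -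
  interpret U: hilbert_space U by fact
  interpret Y: hilbert_space Y by fact
  let ?FU = "fock U :: ('d list \<Rightarrow> 'u) hilb" and ?FY = "fock Y :: ('d list \<Rightarrow> 'y) hilb"
  have FU: "hilbert_space ?FU" unfolding fock_eq_l2 by (rule U.hilbert_l2)
  have FY: "hilbert_space ?FY" unfolding fock_eq_l2 by (rule Y.hilbert_l2)
  interpret FU: hilbert_space ?FU by (rule FU)
  interpret FY: hilbert_space ?FY by (rule FY)
  have compU: "f \<alpha> \<in> hcarrier U" if "f \<in> hcarrier ?FU" for f \<alpha>
    using that by (auto simp: fock_eq_l2 l2_simps)
  have compY: "f \<alpha> \<in> hcarrier Y" if "f \<in> hcarrier ?FY" for f \<alpha>
    using that by (auto simp: fock_eq_l2 l2_simps)
  have S0: "S \<alpha> 0 = 0" for \<alpha>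
    using S linear_op_zero[OF U] by (auto simp: op_series_def bounded_op_def)
  have Sm: "S \<alpha> u \<in> hcarrier Y" if "u \<in> hcarrier U" for \<alpha> u
    using S that by (auto simp: op_series_def bounded_op_def linear_op_def)
  define T where "T = series_app S"
  have Tc: "contraction_op ?FU ?FY T" using contr by (simp add: T_def)
  note Tb = contraction_op_bounded[OF Tc]
  note Tl = bounded_op_linear[OF Tb]
  note Tm = linear_opD(1)[OF Tl]
  define Ts where "Ts = adjoint_op ?FU ?FY T"
  have Tsc: "contraction_op ?FY ?FU Ts" unfolding Ts_def by (rule contraction_op_adjoint[OF FU FY Tc])
  note Tsl = bounded_op_linear[OF contraction_op_bounded[OF Tsc]]
  note Tsm = linear_opD(1)[OF Tsl]
  have adj: "hinner ?FY (T f) g = hinner ?FU f (Ts g)" if "f \<in> hcarrier ?FU" "g \<in> hcarrier ?FY" for f g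
    unfolding Ts_def using adjoint_op_inner[OF FU FY Tb that] .
  have adj': "hinner ?FY g (T f) = hinner ?FU (Ts g) f" if "f \<in> hcarrier ?FU" "g \<in> hcarrier ?FY" for f g
    unfolding Ts_def using adjoint_op_inner'[OF FU FY Tb that] .
  have bsU: "bshift j f \<in> hcarrier ?FU" if "f \<in> hcarrier ?FU" for f j
    using that U.fock_shift_decomposition(1) by blast
  have bsY: "bshift j f \<in> hcarrier ?FY" if "f \<in> hcarrier ?FY" for f j
    using that Y.fock_shift_decomposition(1) by blast
  have commute: "bshift j (Ts f) = Ts (bshift j f)" if f: "f \<in> hcarrier ?FY" for j f
  proof (rule FU.inner_all_eq)
    fix g assume g: "g \<in> hcarrier ?FU"
    have "hinner ?FU (bshift j (Ts f)) g = hinner ?FU (Ts f) (fshift j g)"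
      by (rule U.bshift_fshift_adjoint[OF Tsm[OF f] g])
    also have "\<dots> = hinner ?FY f (fshift j (T g))"
      using adj'[OF U.fshift_fock[OF g] f] series_app_fshift[where S = S, OF S0] by (simp add: T_def)
    also have "\<dots> = hinner ?FY (bshift j f) (T g)"
      by (rule Y.bshift_fshift_adjoint[OF f Tm[OF g], symmetric])
    also have "\<dots> = hinner ?FU (Ts (bshift j f)) g" by (rule adj'[OF g bsY[OF f]])
    finally show "hinner ?FU (bshift j (Ts f)) g = hinner ?FU (Ts (bshift j f)) g" .
  qed (use f bsU bsY Tsm in auto)

  \<comment> \<open>The selfadjoint contraction with off-diagonal blocks \<open>T\<close> and \<open>T\<^sup>*\<close>; its defect operator restricted to the
    first summand is \<open>\<Delta>\<close>, because \<open>L (f, 0) = (0, T\<^sup>* f)\<close>.\<close>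
  let ?P = "?FY \<oplus>\<^sub>H ?FU"
  have P: "hilbert_space ?P" by (intro hilbert_hsum FU FY)
  interpret P: hilbert_space ?P by (rule P)
  define L where "L p = (T (snd p), Ts (fst p))" for p
  have Lm: "L p \<in> hcarrier ?P" if "p \<in> hcarrier ?P" for p
    using that Tm Tsm by (auto simp: L_def hsum_simps)
  have L: "contraction_op ?P ?P L"
    unfolding contraction_op_def linear_op_def
  proof (intro conjI ballI allI Lm)
    fix p assume p: "p \<in> hcarrier ?P"
    then have m: "fst p \<in> hcarrier ?FY" "snd p \<in> hcarrier ?FU" by (auto simp: hsum_simps)
    have "hnorm ?FY (T (snd p)) \<le> hnorm ?FU (snd p)" "hnorm ?FU (Ts (fst p)) \<le> hnorm ?FY (fst p)"
      using Tc Tsc m by (auto simp: contraction_op_def)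
    then have "(hnorm ?FY (T (snd p)))\<^sup>2 + (hnorm ?FU (Ts (fst p)))\<^sup>2 \<le> (hnorm ?FU (snd p))\<^sup>2 + (hnorm ?FY (fst p))\<^sup>2"
      using m Tm Tsm by (intro add_mono power_mono FU.norm_nonneg FY.norm_nonneg)
    then have "(hnorm ?P (L p))\<^sup>2 \<le> (hnorm ?P p)\<^sup>2"
      by (simp add: hsum_norm_sq[OF FY FU] p Lm, simp add: L_def)
    then show "hnorm ?P (L p) \<le> hnorm ?P p" by (rule power2_le_imp_le) (rule P.norm_nonneg[OF p])
    show "L (hscale ?P c p) = hscale ?P c (L p)" for c
      using m by (simp add: L_def hsum_simps linear_opD(3)[OF Tl] linear_opD(3)[OF Tsl])
    fix q assume "q \<in> hcarrier ?P"
    then show "L (p + q) = L p + L q"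
      using m by (auto simp: L_def hsum_simps linear_opD(2)[OF Tl] linear_opD(2)[OF Tsl])
  qed
  have L_adj: "hinner ?P (L p) q = hinner ?P p (L q)" if "p \<in> hcarrier ?P" "q \<in> hcarrier ?P" for p q
    using that by (simp add: L_def hsum_simps adj adj')
  define \<Delta> where "\<Delta> f = (\<lambda>n. (L ^^ n) (f, 0) - (L ^^ (n + 2)) (f, 0))" for f
  have inP: "(f, 0) \<in> hcarrier ?P" if "f \<in> hcarrier ?FY" for f
    using that FU.zero_mem by (simp add: hsum_simps)
  let ?L = "l2 ?P :: (nat \<Rightarrow> ('d, 'y) series \<times> ('d, 'u) series) hilb"
  have LL: "hilbert_space ?L" by (rule P.hilbert_l2)
  interpret LL: hilbert_space ?L by (rule LL)
  have \<Delta>_lin: "linear_op ?FY ?L \<Delta>"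
    unfolding linear_op_def
  proof (intro conjI ballI allI)
    fix f assume f: "f \<in> hcarrier ?FY"
    show "\<Delta> f \<in> hcarrier ?L"
      unfolding \<Delta>_def by (rule linear_opD(1)[OF P.defect_operator(1)[OF L L_adj] inP[OF f]])
    show "\<Delta> (hscale ?FY c f) = hscale ?L c (\<Delta> f)" for c
      using linear_opD(3)[OF P.defect_operator(1)[OF L L_adj] inP[OF f], of c]
      by (simp add: \<Delta>_def hsum_simps FU.scale_zero_right)
    show "\<Delta> (f + g) = \<Delta> f + \<Delta> g" if "g \<in> hcarrier ?FY" for g
      using linear_opD(2)[OF P.defect_operator(1)[OF L L_adj] inP[OF f] inP[OF that]]
      by (simp add: \<Delta>_def)
  qed
  have Ts0: "T 0 = 0" "Ts 0 = 0" using linear_op_zero[OF FU Tl] linear_op_zero[OF FY Tsl] by auto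
  have \<Delta>_inner: "hinner ?L (\<Delta> f) (\<Delta> g) = hinner ?FY f g - hinner ?FU (Ts f) (Ts g)"
    if f: "f \<in> hcarrier ?FY" and g: "g \<in> hcarrier ?FY" for f g
    using P.defect_operator(2)[OF L L_adj inP[OF f] inP[OF g], folded \<Delta>_def] f g Tsm
      L_def[of "(f, 0)"] L_def[of "(g, 0)"]
    by (simp add: hsum_simps Ts0 FU.inner_zero_left FY.inner_zero_left FU.zero_mem FY.zero_mem)
  \<comment> \<open>The old state space is the closed range of \<open>\<Delta>\<close>, as a double complement.\<close>
  let ?R = "\<Delta> ` hcarrier ?FY"
  have R: "?R \<subseteq> hcarrier ?L" using linear_opD(1)[OF \<Delta>_lin] by blast
  define X0 where "X0 = ocomp ?L (hcarrier (ocomp ?L ?R))"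
  have X0: "hilbert_space X0" unfolding X0_def by (rule LL.hilbert_ocomp) auto
  interpret X0: hilbert_space X0 by (rule X0)
  have X0_simps: "hscale X0 = hscale ?L" "hinner X0 = hinner ?L" by (simp_all add: X0_def)
  have \<Delta>_X0: "\<Delta> f \<in> hcarrier X0" if "f \<in> hcarrier ?FY" for f
  proof -
    have "hinner ?L (\<Delta> f) x = 0" if "x \<in> hcarrier (ocomp ?L ?R)" for x
      using that LL.inner_commute[of x "\<Delta> f"] \<open>f \<in> _\<close> R by auto
    then show ?thesis using that R by (auto simp: X0_def)
  qed
  have X0_dense: "x = 0" if x: "x \<in> hcarrier X0" and orth: "\<And>f. f \<in> hcarrier ?FY \<Longrightarrow> hinner X0 (\<Delta> f) x = 0" for x
  proof -
    have xL: "x \<in> hcarrier ?L" using x by (simp add: X0_def)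
    have "hinner ?L x (\<Delta> f) = 0" if "f \<in> hcarrier ?FY" for f
      using orth[OF that] LL.inner_commute[of "\<Delta> f" x] R that xL by (auto simp: X0_simps)
    then have "x \<in> hcarrier (ocomp ?L ?R)" using xL by auto
    then have "hinner ?L x x = 0" using x by (auto simp: X0_def)
    then show ?thesis using LL.inner_eq_zero xL by blast
  qed

  let ?H = "X0 \<oplus>\<^sub>H U" and ?K = "hpow X0 \<oplus>\<^sub>H Y :: (('d \<Rightarrow> nat \<Rightarrow> ('d, 'y) series \<times> ('d, 'u) series) \<times> 'y) hilb"
  have H: "hilbert_space ?H" by (intro hilbert_hsum X0 U)
  have K: "hilbert_space ?K" unfolding hpow_eq_l2 by (intro hilbert_hsum X0.hilbert_l2 Y)
  interpret H: hilbert_space ?H by (rule H)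
  interpret K: hilbert_space ?K by (rule K)
  have inK: "v \<in> hcarrier ?K \<longleftrightarrow> (\<forall>j. fst v j \<in> hcarrier X0) \<and> snd v \<in> hcarrier Y" for v
    by (simp add: hsum_simps hpow_def)
  have K_inner: "hinner ?K v w = (\<Sum>j\<in>UNIV. hinner X0 (fst v j) (fst w j)) + hinner Y (snd v) (snd w)" for v w
    by (simp add: hsum_simps hpow_def)
  define a where "a f = ((\<lambda>j. \<Delta> (bshift j f)), f [])" for f :: "('d, 'y) series"
  define b where "b f = (\<Delta> f, Ts f [])" for f :: "('d, 'y) series"
  have bs_add: "bshift j (f + g) = bshift j f + bshift j g" for j and f g :: "('d, 'y) series"
    by (simp add: bshift_def fun_eq_iff)
  have bs_scale: "bshift j (hscale ?FY c f) = hscale ?FY c (bshift j f)" for j c and f :: "('d, 'y) series"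
    by (simp add: bshift_def fun_eq_iff fock_def)
  have a: "linear_op ?FY ?K a"
    unfolding linear_op_def
  proof (intro conjI ballI allI)
    fix f assume f: "f \<in> hcarrier ?FY"
    show "a f \<in> hcarrier ?K" unfolding inK using \<Delta>_X0[OF bsY[OF f]] compY[OF f] by (simp add: a_def)
    show "a (hscale ?FY c f) = hscale ?K c (a f)" for c
      unfolding a_def bs_scale linear_opD(3)[OF \<Delta>_lin bsY[OF f]]
      by (simp add: hsum_simps hpow_def X0_simps fock_def)
    show "a (f + g) = a f + a g" if "g \<in> hcarrier ?FY" for g
      unfolding a_def bs_add linear_opD(2)[OF \<Delta>_lin bsY[OF f] bsY[OF that]]
      by (simp add: fun_eq_iff)
  qed
  have b: "linear_op ?FY ?H b"
    unfolding linear_op_def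
  proof (intro conjI ballI allI)
    fix f assume f: "f \<in> hcarrier ?FY"
    show "b f \<in> hcarrier ?H" using \<Delta>_X0[OF f] compU[OF Tsm[OF f]] by (simp add: b_def hsum_simps)
    show "b (hscale ?FY c f) = hscale ?H c (b f)" for c
      unfolding b_def linear_opD(3)[OF \<Delta>_lin f] linear_opD(3)[OF Tsl f]
      by (simp add: hsum_simps X0_simps fock_def)
    show "b (f + g) = b f + b g" if "g \<in> hcarrier ?FY" for g
      unfolding b_def linear_opD(2)[OF \<Delta>_lin f that] linear_opD(2)[OF Tsl f that] by simp
  qed
  have gram: "hinner ?K (a f) (a g) = hinner ?H (b f) (b g)"
    if f: "f \<in> hcarrier ?FY" and g: "g \<in> hcarrier ?FY" for f g
  proof -
    have "hinner ?K (a f) (a g) = (\<Sum>j\<in>UNIV. hinner ?FY (bshift j f) (bshift j g) -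
        hinner ?FU (bshift j (Ts f)) (bshift j (Ts g))) + hinner Y (f []) (g [])"
      unfolding K_inner by (simp add: a_def X0_simps \<Delta>_inner bsY f g commute)
    also have "\<dots> = hinner ?FY f g - (\<Sum>j\<in>UNIV. hinner ?FU (bshift j (Ts f)) (bshift j (Ts g)))"
      using Y.fock_shift_decomposition(2)[OF f g] by (simp add: sum_subtractf)
    also have "\<dots> = hinner ?FY f g - hinner ?FU (Ts f) (Ts g) + hinner U (Ts f []) (Ts g [])"
      using U.fock_shift_decomposition(2)[OF Tsm[OF f] Tsm[OF g]] by simp
    also have "\<dots> = hinner ?H (b f) (b g)"
      by (simp add: b_def hsum_simps X0_simps \<Delta>_inner f g)
    finally show ?thesis .
  qed
  have \<Delta>0: "\<Delta> 0 = 0" by (rule linear_op_zero[OF FY \<Delta>_lin])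
  \<comment> \<open>The data \<open>((R\<^sub>j\<^sup>* f)\<^sub>j, f\<^sub>\<emptyset>)\<close> can be prescribed one entry at a time: forward shifts reach a single row and constants
    reach the output.  Hence the vectors \<open>a f\<close> are dense, and they determine all blocks of \<open>V\<close>.\<close>
  have a_fshift: "a (fshift j f) = ((\<lambda>i. if i = j then \<Delta> f else 0), 0)" for j f
    by (simp add: a_def bshift_fshift \<Delta>0 fun_eq_iff)
  have a_const: "a (monomial [] y) = (0, y)" for y
  proof -
    have bs0: "bshift j (monomial [] y) = 0" for j by (simp add: bshift_def monomial_def fun_eq_iff)
    show ?thesis unfolding a_def bs0 \<Delta>0 by (simp add: monomial_def fun_eq_iff)
  qed
  have row_inner: "hinner ?K v (a (fshift j f)) = hinner X0 (fst v j) (\<Delta> f)"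
    "hinner ?K (a (fshift j f)) v = hinner X0 (\<Delta> f) (fst v j)"
    if v: "v \<in> hcarrier ?K" for v f j
  proof -
    have "hinner X0 (fst v i) (if i = j then \<Delta> f else 0) = (if i = j then hinner X0 (fst v j) (\<Delta> f) else 0)"
      "hinner X0 (if i = j then \<Delta> f else 0) (fst v i) = (if i = j then hinner X0 (\<Delta> f) (fst v j) else 0)" for i
      using v unfolding inK by (simp_all add: X0.inner_zero_right X0.inner_zero_left)
    then show "hinner ?K v (a (fshift j f)) = hinner X0 (fst v j) (\<Delta> f)"
      "hinner ?K (a (fshift j f)) v = hinner X0 (\<Delta> f) (fst v j)"
      using v unfolding inK K_inner a_fshift by (simp_all add: Y.inner_zero_right Y.inner_zero_left)
  qed
  have const_inner: "hinner ?K v (a (monomial [] y)) = hinner Y (snd v) y"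
    "hinner ?K (a (monomial [] y)) v = hinner Y y (snd v)" if "v \<in> hcarrier ?K" for v y
    using that unfolding inK K_inner a_const by (simp_all add: X0.inner_zero_right X0.inner_zero_left)
  have dense: "k = 0" if k: "k \<in> hcarrier ?K" and orth: "\<And>f. f \<in> hcarrier ?FY \<Longrightarrow> hinner ?K (a f) k = 0" for k
  proof -
    have km: "fst k j \<in> hcarrier X0" "snd k \<in> hcarrier Y" for j using k unfolding inK by auto
    have "fst k j = 0" for j
    proof (rule X0_dense[OF km(1)])
      fix f assume f: "f \<in> hcarrier ?FY"
      show "hinner X0 (\<Delta> f) (fst k j) = 0"
        using orth[OF Y.fshift_fock[OF f, of j]] by (simp add: row_inner k)
    qed
    moreover have "snd k = 0"
      using orth[OF Y.monomial_fock(2)[OF km(2), of "[]"]] Y.inner_eq_zero[OF km(2)] by (simp add: const_inner k)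
    ultimately show ?thesis by (simp add: prod_eq_iff fun_eq_iff)
  qed
  obtain V where V: "contraction_op ?H ?K V" "\<And>f. f \<in> hcarrier ?FY \<Longrightarrow> adjoint_op ?H ?K V (a f) = b f"
    "\<And>k. k \<in> hcarrier ?K \<Longrightarrow> V (adjoint_op ?H ?K V k) = k"
    using coisometry_from_equal_gramians[OF FY H K a b gram dense] by blast
  note Vb = contraction_op_bounded[OF V(1)]
  note Vm = linear_opD(1)[OF bounded_op_linear[OF Vb]]
  have V_a: "hinner ?K (V h) (a f) = hinner ?H h (b f)" if "h \<in> hcarrier ?H" "f \<in> hcarrier ?FY" for h f
    using adjoint_op_inner[OF H K Vb that(1) linear_opD(1)[OF a that(2)]] V(2)[OF that(2)] by simp
  have in1: "(x, 0) \<in> hcarrier ?H" if "x \<in> hcarrier X0" for x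
    using that U.zero_mem by (simp add: hsum_simps)
  have in2: "(0, u) \<in> hcarrier ?H" if "u \<in> hcarrier U" for u
    using that X0.zero_mem by (simp add: hsum_simps)
  have b1: "hinner ?H (x, 0) (b f) = hinner X0 x (\<Delta> f)" if "x \<in> hcarrier X0" "f \<in> hcarrier ?FY" for x f
    using that compU[OF Tsm] by (simp add: b_def hsum_simps U.inner_zero_left)
  have b2: "hinner ?H (0, u) (b f) = hinner U u (Ts f [])" if "u \<in> hcarrier U" "f \<in> hcarrier ?FY" for u f
    using that \<Delta>_X0 by (simp add: b_def hsum_simps X0.inner_zero_left)
  have Ts_mono: "hinner U u (Ts (monomial w y) []) = hinner Y (S w u) y"
    if u: "u \<in> hcarrier U" and y: "y \<in> hcarrier Y" for u y w
  proof -
    note yF = Y.monomial_fock(2)[OF y, of w] and uF = U.monomial_fock(2)[OF u, of "[]"]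
    have "hinner U u (Ts (monomial w y) []) = hinner ?FU (monomial [] u) (Ts (monomial w y))"
      by (rule U.monomial_fock(3)[OF u, symmetric]) (rule compU[OF Tsm[OF yF]])
    also have "\<dots> = hinner ?FY (T (monomial [] u)) (monomial w y)" by (rule adj[OF uF yF, symmetric])
    also have "\<dots> = cnj (hinner ?FY (monomial w y) (T (monomial [] u)))"
      by (rule FY.inner_commute[OF yF Tm[OF uF]])
    also have "\<dots> = cnj (hinner Y y (T (monomial [] u) w))"
      by (subst Y.monomial_fock(3)[OF y]) (auto intro: compY Tm uF)
    also have "\<dots> = hinner Y (S w u) y"
      by (simp add: T_def series_app_monomial_Nil[where S = S, OF S0] Y.inner_commute[OF y Sm[OF u]])
    finally show ?thesis .
  qed

  have "\<forall>k\<in>hcarrier ?K. V (adjoint_op ?H ?K V k) = k" using V(3) by blast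
  from unitary_from_coisometry[OF X0 U Y V(1) this]
  obtain X :: "((nat \<Rightarrow> ('d, 'y) series \<times> ('d, 'u) series) \<times>
      (nat \<Rightarrow> (nat \<Rightarrow> ('d, 'y) series \<times> ('d, 'u) series) \<times> 'u)) hilb" and W
    where X: "hilbert_space X" and W: "unitary_op (X \<oplus>\<^sub>H U) (hpow X \<oplus>\<^sub>H Y) W"
      and W_snd': "\<forall>x e u. snd (W ((x, e), u)) = snd (V (x, u))"
      and W_fst': "\<forall>x e u j. fst (fst (W ((x, e), u)) j) = fst (V (x, u)) j"
    by (elim exE conjE) (rule that)
  note W_snd = W_snd'[rule_format] and W_fst = W_fst'[rule_format]
  \<comment> \<open>The coefficients of the transfer function are those of \<open>V\<close>, found by testing against \<open>\<Delta>\<close> of monomials: each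
    application of \<open>A\<^sub>i\<close> appends the letter \<open>i\<close> to the monomial.\<close>
  define A where "A j x = fst (V (x, 0)) j" for j x
  have Am: "foldr A v x \<in> hcarrier X0" if "x \<in> hcarrier X0" for v x
  proof (induction v)
    case (Cons i v)
    then show ?case using Vm[OF in1[OF Cons]] unfolding inK by (simp add: A_def[of i "foldr A v x"])
  qed (use that in simp)
  have A_word: "hinner X0 (foldr A v x) (\<Delta> (monomial w y)) = hinner X0 x (\<Delta> (monomial (w @ v) y))"
    if x: "x \<in> hcarrier X0" and y: "y \<in> hcarrier Y" for v x w y
  proof (induction v arbitrary: w)
    case (Cons i v)
    note fm = Am[OF x, of v] and mw = Y.monomial_fock(2)[OF y]
    have "hinner X0 (foldr A (i # v) x) (\<Delta> (monomial w y)) =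
        hinner ?K (V (foldr A v x, 0)) (a (fshift i (monomial w y)))"
      by (simp add: A_def[of i "foldr A v x"] row_inner Vm in1 fm)
    also have "\<dots> = hinner X0 (foldr A v x) (\<Delta> (monomial (w @ [i]) y))"
      by (simp add: fshift_monomial V_a in1 fm mw b1)
    also have "\<dots> = hinner X0 x (\<Delta> (monomial ((w @ [i]) @ v) y))" by (rule Cons.IH)
    finally show ?case by simp
  qed simp
  have "op_realizes U W S"
    unfolding op_realizes_def
  proof (intro ballI conjI allI)
    fix u assume u: "u \<in> hcarrier U"
    note Vu = Vm[OF in2[OF u]]
    have Vu': "snd (V (0, u)) \<in> hcarrier Y" "fst (V (0, u)) j \<in> hcarrier X0" for j
      using Vu unfolding inK by auto
    show "S [] u = snd (W (0, u))"
    proof (rule Y.inner_all_eq)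
      fix y assume y: "y \<in> hcarrier Y"
      have "hinner Y (snd (V (0, u))) y = hinner ?K (V (0, u)) (a (monomial [] y))"
        by (simp add: const_inner Vu)
      also have "\<dots> = hinner Y (S [] u) y"
        by (simp add: V_a in2 u Y.monomial_fock(2)[OF y] b2 Ts_mono y)
      finally show "hinner Y (S [] u) y = hinner Y (snd (W (0, u))) y"
        using W_snd[of 0 0 u] by (simp flip: zero_prod_def)
    qed (use u Sm Vu' W_snd[of 0 0 u] in \<open>auto simp flip: zero_prod_def\<close>)
    fix v j
    define x where "x = fst (V (0, u)) j"
    have xm: "x \<in> hcarrier X0" unfolding x_def by (rule Vu'(2))
    have W_A: "fst (fst (W (p, 0)) i) = A i (fst p)" for p i
      using W_fst[of "fst p" "snd p" 0 i] by (simp add: A_def)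
    have fst_fold: "fst (foldr (\<lambda>i x. fst (W (x, 0)) i) v p) = foldr A v (fst p)" for v p
      by (induction v) (simp_all add: W_A)
    have W_x: "snd (W (p, 0)) = snd (V (fst p, 0))" for p
      using W_snd[of "fst p" "snd p" 0] by simp
    have out: "snd (W (foldr (\<lambda>i x. fst (W (x, 0)) i) v (fst (W (0, u)) j), 0)) = snd (V (foldr A v x, 0))"
      unfolding W_x fst_fold x_def using W_fst[of 0 0 u j] by (simp flip: zero_prod_def)
    note fm = Am[OF xm, of v]
    have Vf: "V (foldr A v x, 0) \<in> hcarrier ?K" by (rule Vm[OF in1[OF fm]])
    have "S (v @ [j]) u = snd (V (foldr A v x, 0))"
    proof (rule Y.inner_all_eq)
      fix y assume y: "y \<in> hcarrier Y"
      note my = Y.monomial_fock(2)[OF y]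
      have "hinner Y (snd (V (foldr A v x, 0))) y = hinner ?K (V (foldr A v x, 0)) (a (monomial [] y))"
        by (simp add: const_inner Vf)
      also have "\<dots> = hinner X0 (foldr A v x) (\<Delta> (monomial [] y))"
        by (simp add: V_a in1 fm my b1)
      also have "\<dots> = hinner X0 x (\<Delta> (monomial v y))"
        using A_word[OF xm y, of v "[]"] by simp
      also have "\<dots> = hinner ?K (V (0, u)) (a (fshift j (monomial v y)))"
        by (simp add: row_inner Vu x_def)
      also have "\<dots> = hinner Y (S (v @ [j]) u) y"
        by (simp add: fshift_monomial V_a in2 u my b2 Ts_mono y)
      finally show "hinner Y (S (v @ [j]) u) y = hinner Y (snd (V (foldr A v x, 0))) y" by simp
    qed (use u Sm Vf in \<open>auto simp: inK\<close>)
    then show "S (v @ [j]) u = snd (W (foldr (\<lambda>i x. fst (W (x, 0)) i) v (fst (W (0, u)) j), 0))"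
      by (simp add: out)
  qed
  then show thesis using that X W by blast
qed

section \<open>The equivalence\<close>

lemma additive_inj_model_space:
  "\<exists>\<iota> :: ((nat \<Rightarrow> ('d::finite, 'y::ab_group_add) series \<times> ('d, 'u::ab_group_add) series) \<times>
      (nat \<Rightarrow> (nat \<Rightarrow> ('d, 'y) series \<times> ('d, 'u) series) \<times> 'u)) \<Rightarrow>
      ('x::ab_group_add, 'u, 'y) state. additive_inj \<iota>"
proof -
  have words: "countable (UNIV :: 'd list set)"
    using countable_lists[of "UNIV :: 'd set"] by (simp add: countable_finite lists_UNIV)
  note prodI = additive_inj_seq_prod and seqI = additive_inj_seq_fun[OF _ countableI_type]
    and wordI = additive_inj_seq_fun[OF _ words]
  have u: "additive_inj (\<lambda>(u::'u) (n::nat). (u, 0::'y))" and y: "additive_inj (\<lambda>(y::'y) (n::nat). (0::'u, y))"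
    by (auto simp: additive_inj_def inj_def fun_eq_iff)
  have pad: "additive_inj (\<lambda>s::nat \<Rightarrow> 'u \<times> 'y. (0::'x, s))"
    by (auto simp: additive_inj_def inj_def)
  note series_pair = prodI[OF wordI[OF y] wordI[OF u]]
  show ?thesis
    by (rule exI, rule additive_inj_comp[OF pad prodI[OF seqI[OF series_pair] seqI[OF prodI[OF seqI[OF series_pair] u]]]])
qed

lemma contractive_if_unitary_realization:
  assumes "unitary_realization X U Y S"
  shows "contractive_realization X U Y S"
proof -
  have "contraction_op H K T" if "unitary_op H K T" for H :: "('a \<times> 'b) hilb" and K :: "(('d \<Rightarrow> 'a) \<times> 'c) hilb" and T
    using that unitary_op_isometric[OF that] by (simp add: contraction_op_def unitary_op_def)
  then show ?thesis
    using assms unfolding unitary_realization_def contractive_realization_def by blast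
qed

theorem theorem3p1:
  fixes U :: "'u::ab_group_add hilb"
    and Y :: "'y::ab_group_add hilb"
    and S :: "('d::finite, 'u \<Rightarrow> 'y) series"
  assumes "hilbert_space U"
    and "hilbert_space Y"
    and "op_series U Y S"
  shows "(S \<in> schur_class U Y \<longleftrightarrow> positive_kernel Y (kernel_S U Y S)) \<and>
    (S \<in> schur_class U Y \<longleftrightarrow>
       (\<exists>X :: ('x::ab_group_add, 'u, 'y) state hilb.
          hilbert_space X \<and> unitary_realization X U Y S)) \<and>
    (S \<in> schur_class U Y \<longleftrightarrow>
       (\<exists>X :: ('x, 'u, 'y) state hilb.
          hilbert_space X \<and> contractive_realization X U Y S))"
proof -
  have unitary: "\<exists>X :: ('x, 'u, 'y) state hilb. hilbert_space X \<and> unitary_realization X U Y S"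
    if schur: "S \<in> schur_class U Y"
  proof -
    obtain X :: "((nat \<Rightarrow> ('d, 'y) series \<times> ('d, 'u) series) \<times>
        (nat \<Rightarrow> (nat \<Rightarrow> ('d, 'y) series \<times> ('d, 'u) series) \<times> 'u)) hilb" and W
      where X: "hilbert_space X" and W: "unitary_op (X \<oplus>\<^sub>H U) (hpow X \<oplus>\<^sub>H Y) W" "op_realizes U W S"
      using operator_realization_if_contraction[OF assms schur_class_iff_positive_kernel(2)[OF assms schur]]
      by blast
    obtain \<iota> :: "((nat \<Rightarrow> ('d, 'y) series \<times> ('d, 'u) series) \<times>
        (nat \<Rightarrow> (nat \<Rightarrow> ('d, 'y) series \<times> ('d, 'u) series) \<times> 'u)) \<Rightarrow> ('x, 'u, 'y) state" where \<iota>: "additive_inj \<iota>"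
      using additive_inj_model_space by blast
    show ?thesis
      using hilbert_htransport[OF X \<iota>] unitary_realization_htransport[OF X assms(1,2) W \<iota>] by blast
  qed
  have contractive: "S \<in> schur_class U Y"
    if "hilbert_space X" "contractive_realization X U Y S" for X :: "('x, 'u, 'y) state hilb"
    using schur_class_if_contractive_realization[OF that(1) assms that(2)] .
  show ?thesis
    using schur_class_iff_positive_kernel(1)[OF assms] unitary contractive contractive_if_unitary_realization by blast
qed

end
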